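(* Let $p>0$, $\alpha\in\mathbb{R}\setminus\{0\}$, $K\in\{0,1,\dots,\left[\frac{N-1}{2}\right]\}$ and $\omega>\frac{\alpha^2}{(N-2K)^2}$. Let $L_+$ and $L_-$ be the Hessian operators associated with the stationary state $\Phi_{\omega,K}$ on the star graph $\Gamma$ with $N$ edges, and let $n(\cdot)$ and $z(\cdot)$ denote the Morse index and the degeneracy index. Then: (i) $z(L_-)=1$ and $n(L_-)=0$; (ii) $z(L_+)=0$ and $$n(L_+)=\begin{cases}K+1 & \text{if } \alpha<0,\\ N-K & \text{if } \alpha>0.\end{cases}$$ In addition: - if $\alpha<0$ and $K\ge 1$, the negative eigenvalues of $L_+$ consist of two simple eigenvalues $\lambda_1<\lambda_2$ and another eigenvalue $\lambda_*\in(\lambda_1,\lambda_2)$ of multiplicity $K-1$ (multiplicity $0$ meaning that this eigenvalue is absent); - if $\alpha>0$ and $K\ge 0$, the negative eigenvalues of $L_+$ consist of a simple eigenvalue $\lambda_1$ and another eigenvalue $\lambda_{**}\in(\lambda_1,0)$ of multiplicity $N-K-1$.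
   Context: Let $N\ge 2$ be an integer and let $\Gamma$ be the star graph obtained by gluing $N$ half-lines $\mathbb{R}^+=(0,\infty)$ (edges) at a common vertex placed at the origin. Put $L^2(\Gamma)=\bigoplus_{j=1}^N L^2(\mathbb{R}^+)$ and $H^2(\Gamma)=\bigoplus_{j=1}^N H^2(\mathbb{R}^+)$; elements are vectors $\Psi=(\psi_1,\dots,\psi_N)^T$. The Laplacian acts as $\Delta\Psi=(\psi_1'',\dots,\psi_N'')^T$ on the domain $$\mathcal{D}(\Delta)=\Big\{\Psi\in H^2(\Gamma):\ \psi_1(0)=\dots=\psi_N(0),\ \sum_{j=1}^N\psi_j'(0)=\alpha\psi_1(0)\Big\},$$ where $\psi_j'(0)$ is the right-sided derivative. $[\cdot]$ denotes the integer part. For $\omega>\frac{\alpha^2}{(N-2K)^2}$, the stationary state $\Phi_{\omega,K}\in\mathcal{D}(\Delta)$ is $$(\Phi_{\omega,K})_j(x)=\begin{cases}\phi_\omega(x+a_K), & j=1,\dots,K,\\ \phi_\omega(x-a_K), & j=K+1,\dots,N,\end{cases}$$ with $\phi_\omega(x)=\omega^{\frac{1}{2p}}\operatorname{sech}^{1/p}(p\sqrt{\omega}\,x)$ and $a_K=\frac{1}{p\sqrt{\omega}}\operatorname{arctanh}\!\left(\frac{\alpha}{(N-2K)\sqrt{\omega}}\right)$. It solves $-\Delta\Phi-(p+1)|\Phi|^{2p}\Phi=-\omega\Phi$ (nonlinearity taken componentwise). The Hessian operators are the self-adjoint operators in $L^2(\Gamma)$ with domain $\mathcal{D}(\Delta)$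 given by $$L_+=-\Delta+\omega-(2p+1)(p+1)\Phi_{\omega,K}^{2p},\qquad L_-=-\Delta+\omega-(p+1)\Phi_{\omega,K}^{2p},$$ where $\Phi_{\omega,K}^{2p}$ acts by componentwise multiplication. Their continuous spectrum is $[\omega,\infty)$, and $\sigma_p(L_\pm)\subset(-\infty,\omega)$ denotes the discrete spectrum. The Morse index $n(L_\pm)$ is the number of negative eigenvalues of $L_\pm$ counted with multiplicity; the degeneracy index $z(L_\pm)$ is the multiplicity of $0$ as an eigenvalue of $L_\pm$ (zero if $0$ is not an eigenvalue). *)

theory Defs
  imports "HOL-Analysis.Analysis" "HOL-Library.Function_Algebras" "HOL-Library.Extended_Nat"
begin

section \<open>Square-integrable functions and $H^2$ on the half-line\<close>

definition L2_half :: "(real \<Rightarrow> complex) set" where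
  "L2_half = {f. set_borel_measurable lborel {0<..} f \<and>
                 set_integrable lborel {0<..} (\<lambda>x. (cmod (f x))\<^sup>2)}"

text \<open>The test functions for weak derivatives are those of class $C^1_c((0,\infty))$.\<close>

definition test_functions :: "(real \<Rightarrow> real) set" where
  "test_functions = {\<phi>. \<phi> C1_differentiable_on UNIV \<and>
     compact (closure {x. \<phi> x \<noteq> 0}) \<and> closure {x. \<phi> x \<noteq> 0} \<subseteq> {0<..}}"

definition has_weak_deriv :: "(real \<Rightarrow> complex) \<Rightarrow> (real \<Rightarrow> complex) \<Rightarrow> bool" where
  "has_weak_deriv f g \<longleftrightarrow> (\<forall>\<phi>\<in>test_functions.
     (LINT x:{0<..}|lborel. deriv \<phi> x *\<^sub>R f x) = - (LINT x:{0<..}|lborel. \<phi> x *\<^sub>R g x))"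

text \<open>A weak derivative is determined only almost everywhere on $(0,\infty)$; this picks a
  version of it.\<close>

definition weak_deriv :: "(real \<Rightarrow> complex) \<Rightarrow> (real \<Rightarrow> complex)" where
  "weak_deriv f = (SOME g. g \<in> L2_half \<and> has_weak_deriv f g)"

text \<open>An element of $H^2((0,\infty))$ is represented by its unique version that is continuous
  on $[0,\infty)$, extended by zero to the negative half-line. Hence distinct functions represent
  distinct elements of $H^2$, linear dimensions can be taken literally, and the boundary values
  at the vertex are the value and the right-sided derivative at zero.\<close>

definition H2_half :: "(real \<Rightarrow> complex) set" where
  "H2_half = {f. (\<forall>x<0. f x = 0) \<and> continuous_on {0..} f \<and> f \<in> L2_half \<and>
     (\<exists>g\<in>L2_half. has_weak_deriv f g \<and> (\<exists>h\<in>L2_half. has_weak_deriv g h))}"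


section \<open>The Laplacian on the star graph\<close>

text \<open>The edges are numbered $1,\dots,N$; components with an index outside this range are
  zero.\<close>

type_synonym graph_fun = "nat \<Rightarrow> real \<Rightarrow> complex"

definition H2_graph :: "nat \<Rightarrow> graph_fun set" where
  "H2_graph N = {\<Psi>. (\<forall>j\<in>{1..N}. \<Psi> j \<in> H2_half) \<and> (\<forall>j. j \<notin> {1..N} \<longrightarrow> \<Psi> j = (\<lambda>x. 0))}"

definition dom_laplacian :: "nat \<Rightarrow> real \<Rightarrow> graph_fun set" where
  "dom_laplacian N \<alpha> = {\<Psi> \<in> H2_graph N.
     (\<forall>i\<in>{1..N}. \<forall>j\<in>{1..N}. \<Psi> i 0 = \<Psi> j 0) \<and>
     (\<Sum>j=1..N. vector_derivative (\<Psi> j) (at_right 0)) = of_real \<alpha> * \<Psi> 1 0}"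

definition laplacian :: "nat \<Rightarrow> graph_fun \<Rightarrow> graph_fun" where
  "laplacian N \<Psi> = (\<lambda>j. if j \<in> {1..N} then weak_deriv (weak_deriv (\<Psi> j)) else (\<lambda>x. 0))"


section \<open>Eigenvalues and multiplicities\<close>

text \<open>An operator in $L^2(\Gamma)$ is given by its domain and its action.\<close>

type_synonym graph_op = "graph_fun set \<times> (graph_fun \<Rightarrow> graph_fun)"

definition graph_scale :: "complex \<Rightarrow> graph_fun \<Rightarrow> graph_fun" where
  "graph_scale c \<Psi> = (\<lambda>j x. c * \<Psi> j x)"

global_interpretation graph: vector_space graph_scale
  by unfold_locales (auto simp: graph_scale_def fun_eq_iff algebra_simps)

text \<open>The library dimension assigns a junk value to infinite-dimensional spaces.\<close>

definition subspace_dim :: "graph_fun set \<Rightarrow> enat" where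
  "subspace_dim S = (if \<exists>B. finite B \<and> graph.span B = S then enat (graph.dim S) else \<infinity>)"

text \<open>The eigenvalue equation is an equality in $L^2(\Gamma)$, i.e. almost everywhere on each
  edge. Real \<open>\<mu>\<close> suffice, since only negative and zero eigenvalues are counted.\<close>

definition eigenspace :: "graph_op \<Rightarrow> real \<Rightarrow> graph_fun set" where
  "eigenspace A \<mu> = {\<Psi> \<in> fst A. \<forall>j. AE x in lborel. 0 < x \<longrightarrow>
     snd A \<Psi> j x = of_real \<mu> * \<Psi> j x}"

definition is_eigenvalue :: "graph_op \<Rightarrow> real \<Rightarrow> bool" where
  "is_eigenvalue A \<mu> \<longleftrightarrow> (\<exists>\<Psi>\<in>eigenspace A \<mu>. \<Psi> \<noteq> 0)"

definition eigen_mult :: "graph_op \<Rightarrow> real \<Rightarrow> enat" where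
  "eigen_mult A \<mu> = subspace_dim (eigenspace A \<mu>)"

definition negative_eigenvalues :: "graph_op \<Rightarrow> real set" where
  "negative_eigenvalues A = {\<mu>. \<mu> < 0 \<and> is_eigenvalue A \<mu>}"

definition morse_index :: "graph_op \<Rightarrow> enat" where
  "morse_index A = (if finite (negative_eigenvalues A)
     then (\<Sum>\<mu>\<in>negative_eigenvalues A. eigen_mult A \<mu>) else \<infinity>)"

definition degeneracy_index :: "graph_op \<Rightarrow> enat" where
  "degeneracy_index A = eigen_mult A 0"


section \<open>The stationary state and the Hessian operators\<close>

definition soliton :: "real \<Rightarrow> real \<Rightarrow> real \<Rightarrow> real" where
  "soliton p \<omega> x = \<omega> powr (1 / (2 * p)) * (1 / cosh (p * sqrt \<omega> * x)) powr (1 / p)"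

definition shift :: "nat \<Rightarrow> nat \<Rightarrow> real \<Rightarrow> real \<Rightarrow> real \<Rightarrow> real" where
  "shift N K p \<alpha> \<omega> =
     1 / (p * sqrt \<omega>) * artanh (\<alpha> / ((real N - 2 * real K) * sqrt \<omega>))"

definition stationary_state ::
    "nat \<Rightarrow> nat \<Rightarrow> real \<Rightarrow> real \<Rightarrow> real \<Rightarrow> nat \<Rightarrow> real \<Rightarrow> real" where
  "stationary_state N K p \<alpha> \<omega> j x =
     (if j \<le> K then soliton p \<omega> (x + shift N K p \<alpha> \<omega>)
      else soliton p \<omega> (x - shift N K p \<alpha> \<omega>))"

definition hessian ::
    "real \<Rightarrow> nat \<Rightarrow> nat \<Rightarrow> real \<Rightarrow> real \<Rightarrow> real \<Rightarrow> graph_op" where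
  "hessian c N K p \<alpha> \<omega> = (dom_laplacian N \<alpha>,
     \<lambda>\<Psi> j x. - laplacian N \<Psi> j x + of_real \<omega> * \<Psi> j x
              - of_real (c * stationary_state N K p \<alpha> \<omega> j x powr (2 * p)) * \<Psi> j x)"

definition L_plus :: "nat \<Rightarrow> nat \<Rightarrow> real \<Rightarrow> real \<Rightarrow> real \<Rightarrow> graph_op" where
  "L_plus N K p \<alpha> \<omega> = hessian ((2 * p + 1) * (p + 1)) N K p \<alpha> \<omega>"

definition L_minus :: "nat \<Rightarrow> nat \<Rightarrow> real \<Rightarrow> real \<Rightarrow> real \<Rightarrow> graph_op" where
  "L_minus N K p \<alpha> \<omega> = hessian (p + 1) N K p \<alpha> \<omega>"

end

theory Submission
  imports Defs "HOL-Probability.Sinc_Integral" "HOL-Real_Asymp.Real_Asymp"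
begin

text \<open>With $\beta = p\sqrt\omega$ and $\lambda = \omega - \beta^2 s^2$, the eigenvalue equation on every
  edge becomes $v'' = (s^2 - \nu(\nu+1)\,\mathrm{sech}^2 t)\, v$ in the variable $t = \beta(x \pm a_K)$, with
  $\nu = 1 + 1/p$ for $L_+$ and $\nu = 1/p$ for $L_-$. Up to a factor it has one solution $v_s$ that is
  square integrable at infinity, so an eigenfunction is $c_j v_s(\beta(x \pm a_K))$ on edge $j$ and only the
  vertex conditions remain. If $v_s$ vanishes at the vertex ends of the edges that carry a bump, the
  eigenspace consists of functions supported on these edges, with $\sum c_j = 0$; otherwise it is at most
  one-dimensional, and it is nontrivial if and only if the sum of the logarithmic derivatives of $v_s$ at
  the vertex equals $\alpha/\beta$. The Wronskian identity $(v_s' v_r - v_s v_r')' = (s^2 - r^2) v_s v_r$, whose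
  primitive vanishes at infinity, shows that the zero of $v_s$ is unique and moves monotonically in $s$, and
  that the logarithmic derivatives are strictly decreasing in $s$ away from the node. Comparing with
  the explicit solutions $\mathrm{sech}^{1/p} t \tanh t$ ($L_+$) and $\mathrm{sech}^{1/p} t$ ($L_-$) at
  $\lambda = 0$ then counts the roots.\<close>

section \<open>Weak derivatives on the half-line\<close>

text \<open>Write r = 1/p and b = \<beta> |a_K|; B edges carry a bump, T a tail. Energy 0 is s = r,
  so negative eigenvalues are the s > r. The stationary state itself satisfies the vertex condition,
  which gives \<alpha>/\<beta> = (B - T) r tanh b; hence for L_- the secular equation holds at s =
  r, and monotonicity excludes all larger s. For L_+ the logarithmic derivative at the bump ends -b
  has a pole at the parameter s0 for which the node lies there. Beyond s0 the sum falls from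
  +infinity to -infinity: one root, the lowest eigenvalue. On (r, s0) it falls to -infinity from its
  value at r, which exceeds \<alpha>/\<beta> precisely if B < T: a second root or none. At s0 the
  eigenspace has dimension B - 1. The total is B + 1 or B, where B = K for \<alpha> < 0 and B = N -
  K for \<alpha> > 0; without bumps there is no pole and exactly one root. The obstacle is that v_s
  is not elementary for general p and s, while the intermediate value theorem needs its continuity
  and its large-s behaviour in s; a power series with explicit dependence on s provides
  both.\<close>

lemma test_functionI:
  assumes d: "\<And>x. (\<phi> has_real_derivative \<phi>' x) (at x)" and c: "continuous_on UNIV \<phi>'"
    and "0 < a" and z: "\<And>x. x \<notin> {a..b} \<Longrightarrow> \<phi> x = 0"
  shows "\<phi> \<in> test_functions" "deriv \<phi> = \<phi>'"
proof -
  have sub: "closure {x. \<phi> x \<noteq> 0} \<subseteq> {a..b}"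
    using z by (intro closure_minimal) blast+
  have "compact (closure {x. \<phi> x \<noteq> 0})"
    using bounded_subset[OF bounded_closed_interval sub] by (simp add: compact_eq_bounded_closed)
  moreover have "\<phi> C1_differentiable_on UNIV"
    unfolding C1_differentiable_on_def using d c by (auto simp: has_real_derivative_iff_has_vector_derivative)
  moreover have "closure {x. \<phi> x \<noteq> 0} \<subseteq> {0<..}"
    using sub \<open>0 < a\<close> by fastforce
  ultimately show "\<phi> \<in> test_functions"
    by (simp add: test_functions_def)
  show "deriv \<phi> = \<phi>'"
    using d by (auto intro!: DERIV_imp_deriv)
qed

lemma test_functionE:
  assumes "\<phi> \<in> test_functions"
  obtains a b where "0 < a" "a < b" "\<And>x. x \<notin> {a<..<b} \<Longrightarrow> \<phi> x = 0" "\<And>x. x \<notin> {a<..<b} \<Longrightarrow> deriv \<phi> x = 0"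
    "\<And>x. (\<phi> has_real_derivative deriv \<phi> x) (at x)" "continuous_on UNIV (deriv \<phi>)"
    "continuous_on UNIV \<phi>"
proof -
  let ?S = "closure {x. \<phi> x \<noteq> 0}"
  have comp: "compact ?S" and pos: "?S \<subseteq> {0<..}" and C1: "\<phi> C1_differentiable_on UNIV"
    using assms by (auto simp: test_functions_def)
  obtain D where D: "\<And>x. (\<phi> has_vector_derivative D x) (at x)" "continuous_on UNIV D"
    using C1 by (auto simp: C1_differentiable_on_def)
  have d: "(\<phi> has_real_derivative D x) (at x)" for x
    using D by (simp add: has_real_derivative_iff_has_vector_derivative)
  have dD: "deriv \<phi> = D" using d by (auto intro!: DERIV_imp_deriv)
  have "\<exists>a>0. \<forall>x\<in>?S. a < x"
  proof (cases "?S = {}")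
    case True
    then show ?thesis by (intro exI[of _ 1]) simp
  next
    case False
    then obtain m where "m \<in> ?S" "\<forall>t\<in>?S. m \<le> t" using compact_attains_inf[OF comp] by blast
    then show ?thesis using pos by (intro exI[of _ "m/2"]) force
  qed
  then obtain a where a: "0 < a" "\<And>x. x \<in> ?S \<Longrightarrow> a < x" by auto
  obtain B where B: "\<And>x. x \<in> ?S \<Longrightarrow> \<bar>x\<bar> \<le> B"
    using compact_imp_bounded[OF comp] unfolding bounded_real by blast
  \<comment> \<open>The term \<open>a + 1\<close> secures a < b even if the support is
    empty.\<close>
  define b where "b = max (a + 1) (B + 1)"
  have out: "x \<in> - ?S" if "x \<notin> {a<..<b}" for x
  proof -
    have "a < x \<and> x < b" if "x \<in> ?S"
      using a(2)[OF that] B[OF that] by (simp add: b_def)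
    then show ?thesis using that by auto
  qed
  have z: "\<phi> x = 0" if "x \<in> - ?S" for x
    using that closure_subset[of "{x. \<phi> x \<noteq> 0}"] by auto
  have z': "D x = 0" if "x \<in> - ?S" for x
  proof -
    have "((\<lambda>x. 0) has_real_derivative D x) (at x)"
      by (rule has_field_derivative_transform_within_open[OF d open_Compl[OF closed_closure] that z])
    then show ?thesis by (rule DERIV_unique) (rule DERIV_const)
  qed
  show thesis
  proof (rule that[of a b])
    show "continuous_on UNIV \<phi>" by (rule DERIV_continuous_on[of UNIV \<phi> D]) (rule d)
    show "0 < a" by fact
    show "a < b" by (simp add: b_def)
    show "\<phi> x = 0" "deriv \<phi> x = 0" if "x \<notin> {a<..<b}" for x
      unfolding dD using z[OF out[OF that]] z'[OF out[OF that]] by simp_all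
    show "(\<phi> has_real_derivative deriv \<phi> x) (at x)" for x
      unfolding dD by (rule d)
    show "continuous_on UNIV (deriv \<phi>)"
      unfolding dD by (rule D(2))
  qed
qed

section \<open>The fundamental lemma of the calculus of variations\<close>

text \<open>Half-open intervals form an intersection-stable generator of the Borel sets, and the
  sets over which the truncation of \<open>k\<close> to (l, r] has integral 0 form a Dynkin system.
  Truncating first makes the function integrable on the whole line, so that the complement step can
  subtract from the total integral.\<close>

lemma AE_zero_if_Ioc_integrals_zero:
  fixes k :: "real \<Rightarrow> 'a :: {banach, second_countable_topology}"
  assumes int: "set_integrable lborel {l<..r} k" and "l \<le> r"
    and z: "\<And>a b. l \<le> a \<Longrightarrow> a \<le> b \<Longrightarrow> b \<le> r \<Longrightarrow> (LINT x:{a<..b}|lborel. k x) = 0"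
  shows "AE x in lborel. x \<in> {l<..r} \<longrightarrow> k x = 0"
proof -
  let ?K = "\<lambda>x. indicator {l<..r} x *\<^sub>R k x"
  have iK: "integrable lborel ?K" using int by (simp add: set_integrable_def)
  have iA: "set_integrable lborel A ?K" if "A \<in> sets borel" for A
    using integrable_mult_indicator[OF _ iK] that by (simp add: set_integrable_def)
  have "set_lebesgue_integral lborel A ?K = 0" if "A \<in> sets lborel" for A
  proof -
    have "A \<in> sigma_sets UNIV (range (\<lambda>(a, b). {a<..b::real}))"
      using that by (simp add: borel_sigma_sets_Ioc)
    have st: "Int_stable (range (\<lambda>(a, b). {a<..b::real}))"
      by (auto simp: Int_stable_def)
    have cl: "range (\<lambda>(a, b). {a<..b::real}) \<subseteq> Pow UNIV" by simp
    from st cl \<open>A \<in> sigma_sets UNIV (range (\<lambda>(a, b). {a<..b::real}))\<close> show ?thesis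
    proof (induction rule: sigma_sets_induct_disjoint)
      case (basic A)
      then obtain a b where A: "A = {a<..b}" by auto
      have "set_lebesgue_integral lborel A ?K = (LINT x:{max a l<..min b r}|lborel. k x)"
        unfolding set_lebesgue_integral_def A
        by (rule Bochner_Integration.integral_cong) (auto simp: indicator_def)
      also have "\<dots> = 0"
      proof (cases "max a l \<le> min b r")
        case True then show ?thesis by (intro z) auto
      next
        case False then have "{max a l<..min b r} = {}" by auto
        then show ?thesis by (simp only: set_lebesgue_integral_def) simp
      qed
      finally show ?case .
    next
      case (compl A)
      then have A: "A \<in> sets borel" by (simp add: borel_sigma_sets_Ioc)
      have "set_lebesgue_integral lborel ((UNIV - A) \<union> A) ?K =
        set_lebesgue_integral lborel (UNIV - A) ?K + set_lebesgue_integral lborel A ?K"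
        by (rule set_integral_Un) (use A iA in auto)
      moreover have "set_lebesgue_integral lborel ((UNIV - A) \<union> A) ?K = (LINT x:{l<..r}|lborel. k x)"
        unfolding set_lebesgue_integral_def by simp
      ultimately show ?case using compl z[of l r] \<open>l \<le> r\<close> by simp
    next
      case (union A)
      then have A: "A i \<in> sets borel" for i by (auto simp: borel_sigma_sets_Ioc)
      have "set_lebesgue_integral lborel (\<Union>i. A i) ?K = (\<Sum>i. set_lebesgue_integral lborel (A i) ?K)"
        by (rule lebesgue_integral_countable_add)
          (use A iA union in \<open>auto simp: disjoint_family_on_def\<close>)
      then show ?case using union by simp
    qed (auto simp: set_lebesgue_integral_def)
  qed
  then have "AE x in lborel. ?K x = 0" by (rule sigma_finite_measure.density_zero[OF lborel.sigma_finite_measure_axioms, OF iK])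
  then show ?thesis by eventually_elim auto
qed

text \<open>Squaring removes the kink of the positive part at 0, so cut-offs built from it are of
  class C^1.\<close>

lemma has_real_derivative_pos_part_square:
  "((\<lambda>y. (max 0 y)\<^sup>2) has_real_derivative 2 * max 0 y) (at y)"
proof (cases "y = 0")
  case True
  have "((\<lambda>h. (max 0 h)\<^sup>2 / h) \<longlongrightarrow> 0) (at (0::real))"
  proof (rule Lim_null_comparison)
    show "\<forall>\<^sub>F h in at (0::real). norm ((max 0 h)\<^sup>2 / h) \<le> \<bar>h\<bar>"
      by (rule always_eventually) (auto simp: max_def power2_eq_square)
    show "((\<lambda>h::real. \<bar>h\<bar>) \<longlongrightarrow> 0) (at 0)"
      by (intro tendsto_eq_intros) auto
  qed
  then show ?thesis using True by (simp add: DERIV_def)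
next
  case False
  then consider "y > 0" | "y < 0" by linarith
  then show ?thesis
  proof cases
    case 1
    have "((\<lambda>y. y\<^sup>2) has_real_derivative 2 * max 0 y) (at y)"
      using 1 by (auto intro!: derivative_eq_intros)
    then show ?thesis
      by (rule has_field_derivative_transform_within_open[where S = "{0<..}"]) (use 1 in auto)
  next
    case 2
    have "((\<lambda>y. 0) has_real_derivative 2 * max 0 y) (at y)"
      using 2 by (auto intro!: derivative_eq_intros)
    then show ?thesis
      by (rule has_field_derivative_transform_within_open[where S = "{..<0}"]) (use 2 in auto)
  qed
qed

text \<open>The indicator of $(a,b)$ is the limit of $n y_+^2/(1 + n y_+^2)$ with $y = (x-a)(b-x)$,
  which are admissible test functions of class $C^1$.\<close>

lemma fundamental_lemma_Ioc:
  fixes k :: "real \<Rightarrow> complex"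
  assumes int: "\<And>a b. 0 < a \<Longrightarrow> set_integrable lborel {a..b} k"
    and z: "\<And>\<phi>. \<phi> \<in> test_functions \<Longrightarrow> (LINT x:{0<..}|lborel. \<phi> x *\<^sub>R k x) = 0"
    and "0 < a" "a \<le> b"
  shows "(LINT x:{a<..b}|lborel. k x) = 0"
proof -
  define w where "w x = (max 0 ((x - a) * (b - x)))\<^sup>2" for x :: real
  define w' where "w' x = 2 * max 0 ((x - a) * (b - x)) * (a + b - 2 * x)" for x :: real
  have w': "(w has_real_derivative w' x) (at x)" for x
    unfolding w_def w'_def
    by (rule DERIV_chain2[OF has_real_derivative_pos_part_square, THEN DERIV_cong])
       (auto intro!: derivative_eq_intros)
  have w0: "w x \<ge> 0" for x by (simp add: w_def)
  have wz: "w x = 0 \<longleftrightarrow> x \<notin> {a<..<b}" for x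
    using \<open>a \<le> b\<close> by (auto simp: w_def max_def mult_le_0_iff zero_le_mult_iff)
  define \<phi> where "\<phi> n x = real n * w x / (1 + real n * w x)" for n x
  have pos: "1 + real n * w x > 0" for n x
    using w0[of x] by (simp add: add_pos_nonneg)
  have contw: "continuous_on UNIV w" "continuous_on UNIV w'"
    unfolding w_def w'_def by (auto intro!: continuous_intros)
  have \<phi>: "\<phi> n \<in> test_functions" for n
  proof (rule test_functionI(1))
    show "(\<phi> n has_real_derivative real n * w' x / (1 + real n * w x)\<^sup>2) (at x)" for x
      unfolding \<phi>_def using pos[of n x]
      by (auto intro!: derivative_eq_intros w' simp: field_simps power2_eq_square)
    show "continuous_on UNIV (\<lambda>x. real n * w' x / (1 + real n * w x)\<^sup>2)"
      using pos[of n] by (auto intro!: continuous_intros contw simp: less_imp_neq[THEN not_sym])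
    show "0 < a" by fact
    fix x assume "x \<notin> {a..b}"
    then have "w x = 0" unfolding wz by auto
    then show "\<phi> n x = 0" by (simp add: \<phi>_def)
  qed
  have bd: "0 \<le> \<phi> n x" "\<phi> n x \<le> 1" for n x
    using divide_nonneg_pos[OF mult_nonneg_nonneg[OF of_nat_0_le_iff w0] pos, of n x]
      divide_le_eq_1_pos[OF pos, of "real n * w x" n x]
    by (simp_all add: \<phi>_def)
  have \<phi>out: "\<phi> n x = 0" if "x \<notin> {a<..b}" for n x
  proof -
    have "w x = 0" using that unfolding wz by auto
    then show ?thesis by (simp add: \<phi>_def)
  qed
  have lim: "(\<lambda>n. \<phi> n x) \<longlonglongrightarrow> 1" if "x \<in> {a<..<b}" for x
  proof -
    have "w x > 0" using wz[of x] w0[of x] that by linarith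
    then have "(\<lambda>n. 1 - 1 / (1 + real n * w x)) \<longlonglongrightarrow> 1 - 0"
      by real_asymp
    moreover have "1 - 1 / (1 + real n * w x) = \<phi> n x" for n
      using pos[of n x] by (simp add: \<phi>_def field_simps)
    ultimately show ?thesis by simp
  qed
  have intab: "set_integrable lborel {a<..b} k"
    by (rule set_integrable_subset[OF int[OF \<open>0 < a\<close>]]) auto
  then have iK: "integrable lborel (\<lambda>x. indicator {a<..b} x *\<^sub>R k x)"
    by (simp add: set_integrable_def)
  have meas: "(\<lambda>x. indicator {a<..b} x *\<^sub>R k x) \<in> borel_measurable lborel"
    by (rule borel_measurable_integrable[OF iK])
  have \<phi>m: "\<phi> n \<in> borel_measurable lborel" for n
  proof -
    have "continuous_on UNIV (\<phi> n)"
      unfolding \<phi>_def using pos[of n]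
      by (intro continuous_intros contw) (auto simp: less_imp_neq[THEN not_sym])
    then show ?thesis by (simp add: borel_measurable_continuous_onI)
  qed
  have "(\<lambda>n. LINT x|lborel. \<phi> n x *\<^sub>R (indicator {a<..b} x *\<^sub>R k x)) \<longlonglongrightarrow>
        (LINT x|lborel. indicator {a<..b} x *\<^sub>R k x)"
  proof (rule integral_dominated_convergence[where w = "\<lambda>x. norm (indicator {a<..b} x *\<^sub>R k x)"])
    \<comment> \<open>At x = b the approximants vanish but the indicator is 1; this point is
      discarded as a null set.\<close>
    show "AE x in lborel. (\<lambda>n. \<phi> n x *\<^sub>R (indicator {a<..b} x *\<^sub>R k x)) \<longlonglongrightarrow> indicator {a<..b} x *\<^sub>R k x"
      using AE_lborel_singleton[of b]
    proof eventually_elim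
      case (elim x)
      show ?case
      proof (cases "x \<in> {a<..<b}")
        case True
        from tendsto_scaleR[OF lim[OF this] tendsto_const, of "indicator {a<..b} x *\<^sub>R k x"]
        show ?thesis by simp
      next
        case False then have "x \<notin> {a<..b}" using elim by auto
        then show ?thesis by simp
      qed
    qed
    show "AE x in lborel. norm (\<phi> n x *\<^sub>R (indicator {a<..b} x *\<^sub>R k x)) \<le> norm (indicator {a<..b} x *\<^sub>R k x)" for n
    proof (rule AE_I2)
      fix x
      show "norm (\<phi> n x *\<^sub>R (indicator {a<..b} x *\<^sub>R k x)) \<le> norm (indicator {a<..b} x *\<^sub>R k x)"
        using mult_left_le_one_le[OF norm_ge_zero, of "\<phi> n x" "indicator {a<..b} x *\<^sub>R k x"]
          bd[of n x] by simp
    qed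
    show "(\<lambda>x. \<phi> n x *\<^sub>R (indicator {a<..b} x *\<^sub>R k x)) \<in> borel_measurable lborel" for n
      by (intro borel_measurable_scaleR \<phi>m meas)
  qed (fact meas, rule integrable_norm[OF iK])
  moreover have "(LINT x|lborel. \<phi> n x *\<^sub>R (indicator {a<..b} x *\<^sub>R k x)) = 0" for n
  proof -
    have "(LINT x|lborel. \<phi> n x *\<^sub>R (indicator {a<..b} x *\<^sub>R k x)) = (LINT x:{0<..}|lborel. \<phi> n x *\<^sub>R k x)"
      unfolding set_lebesgue_integral_def
      by (rule Bochner_Integration.integral_cong)
         (use \<phi>out[of _ n] \<open>0 < a\<close> in \<open>auto simp: indicator_def\<close>)
    then show ?thesis using z[OF \<phi>] by simp
  qed
  ultimately have "(LINT x|lborel. indicator {a<..b} x *\<^sub>R k x) = 0"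
    by (simp add: LIMSEQ_const_iff)
  then show ?thesis by (simp add: set_lebesgue_integral_def)
qed

text \<open>Since \<open>k\<close> is integrable only on intervals that stay away from 0, the
  half-line is exhausted by the intervals (1/(n+1), n+1] and the countably many exceptional sets are
  merged.\<close>

lemma fundamental_lemma:
  fixes k :: "real \<Rightarrow> complex"
  assumes int: "\<And>a b. 0 < a \<Longrightarrow> set_integrable lborel {a..b} k"
    and z: "\<And>\<phi>. \<phi> \<in> test_functions \<Longrightarrow> (LINT x:{0<..}|lborel. \<phi> x *\<^sub>R k x) = 0"
  shows "AE x in lborel. 0 < x \<longrightarrow> k x = 0"
proof -
  have "AE x in lborel. x \<in> {1 / real (Suc n) <.. real (Suc n)} \<longrightarrow> k x = 0" for n
  proof (rule AE_zero_if_Ioc_integrals_zero)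
    show "set_integrable lborel {1 / real (Suc n)<..real (Suc n)} k"
      by (rule set_integrable_subset[OF int[of "1 / real (Suc n)" "real (Suc n)"]]) auto
    show "1 / real (Suc n) \<le> real (Suc n)"
      by (simp add: field_simps)
    fix a b assume "1 / real (Suc n) \<le> a" "a \<le> b"
    moreover have "0 < 1 / real (Suc n)" by simp
    ultimately show "(LINT x:{a<..b}|lborel. k x) = 0"
      by (intro fundamental_lemma_Ioc assms) linarith+
  qed
  then have "AE x in lborel. \<forall>n. x \<in> {1 / real (Suc n) <.. real (Suc n)} \<longrightarrow> k x = 0"
    by (simp only: AE_all_countable) blast
  then show ?thesis
  proof eventually_elim
    case (elim x)
    show ?case
    proof
      assume "0 < x"
      obtain n1 where "1 / x < real n1" using reals_Archimedean2 by blast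
      obtain n2 where "x < real n2" using reals_Archimedean2 by blast
      let ?n = "max n1 n2"
      have "1 / x < real (Suc ?n)" "x \<le> real (Suc ?n)"
        using \<open>1 / x < real n1\<close> \<open>x < real n2\<close> by auto
      then have "1 / real (Suc ?n) < x" using \<open>0 < x\<close> by (simp add: field_simps)
      then show "k x = 0" using elim \<open>x \<le> real (Suc ?n)\<close> by (metis greaterThanAtMost_iff)
    qed
  qed
qed

section \<open>Square-integrable functions and their weak derivatives\<close>

lemma set_borel_measurable_L2_half: "f \<in> L2_half \<Longrightarrow> set_borel_measurable lborel {0<..} f"
  by (simp add: L2_half_def)

text \<open>On a bounded interval constants are integrable, and |f| \<le> 1 + |f|^2.\<close>

lemma L2_half_set_integrable:
  assumes f: "f \<in> L2_half" and a: "0 < a"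
  shows "set_integrable lborel {a..b} f"
proof (rule set_integrable_bound)
  have 1: "set_integrable lborel {a..b} (\<lambda>x. 1 :: real)"
    by (intro borel_integrable_atLeastAtMost' continuous_intros)
  have 2: "set_integrable lborel {a..b} (\<lambda>x. (cmod (f x))\<^sup>2)"
    by (rule set_integrable_subset[of _ "{0<..}"]) (use f a in \<open>auto simp: L2_half_def\<close>)
  show "set_integrable lborel {a..b} (\<lambda>x. 1 + (cmod (f x))\<^sup>2)"
    by (rule set_integral_add(1)[OF 1 2])
  show "set_borel_measurable lborel {a..b} f"
    by (rule set_borel_measurable_subset[OF set_borel_measurable_L2_half[OF f]]) (use a in auto)
  have "cmod z \<le> norm (1 + (cmod z)\<^sup>2)" for z
  proof -
    have "cmod z \<le> 1 + (cmod z)\<^sup>2"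
      using zero_le_power2[of "cmod z - 1"] norm_ge_zero[of z] unfolding power2_diff one_power2 by linarith
    then show ?thesis by simp
  qed
  then show "AE x in lborel. x \<in> {a..b} \<longrightarrow> cmod (f x) \<le> norm (1 + (cmod (f x))\<^sup>2)"
    by auto
qed

lemma
  fixes f :: "real \<Rightarrow> 'a :: {banach, second_countable_topology}"
  assumes int: "set_integrable lborel {a..b} f" and \<psi>: "continuous_on UNIV \<psi>"
    and a: "0 < a" and z: "\<And>x. x \<notin> {a<..<b} \<Longrightarrow> \<psi> x = 0"
  shows set_integrable_compact_support: "set_integrable lborel {0<..} (\<lambda>x. \<psi> x *\<^sub>R f x)"
    and set_integral_compact_support: "(LINT x:{0<..}|lborel. \<psi> x *\<^sub>R f x) = (LINT x:{a..b}|lborel. \<psi> x *\<^sub>R f x)"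
proof -
  have eq: "indicator {0<..} x *\<^sub>R (\<psi> x *\<^sub>R f x) = indicator {a..b} x *\<^sub>R (\<psi> x *\<^sub>R f x)" for x
    using a z[of x] by (auto simp: indicator_def)
  show "(LINT x:{0<..}|lborel. \<psi> x *\<^sub>R f x) = (LINT x:{a..b}|lborel. \<psi> x *\<^sub>R f x)"
    unfolding set_lebesgue_integral_def eq ..
  have "bounded (\<psi> ` {a..b})"
    by (intro compact_imp_bounded compact_continuous_image continuous_on_subset[OF \<psi>]) auto
  then obtain M where M: "\<And>x. x \<in> {a..b} \<Longrightarrow> \<bar>\<psi> x\<bar> \<le> M"
    unfolding bounded_real by blast
  have "set_integrable lborel {a..b} (\<lambda>x. \<psi> x *\<^sub>R f x)"
  proof (rule set_integrable_bound)
    show "set_integrable lborel {a..b} (\<lambda>x. M *\<^sub>R f x)" using int by simp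
    have "(\<lambda>x. \<psi> x *\<^sub>R (indicator {a..b} x *\<^sub>R f x)) \<in> borel_measurable lborel"
      using borel_measurable_integrable[OF int[unfolded set_integrable_def]] \<psi>
      by - (rule borel_measurable_scaleR, simp_all add: borel_measurable_continuous_onI)
    then show "set_borel_measurable lborel {a..b} (\<lambda>x. \<psi> x *\<^sub>R f x)"
      by (simp add: set_borel_measurable_def mult.commute)
    show "AE x in lborel. x \<in> {a..b} \<longrightarrow> norm (\<psi> x *\<^sub>R f x) \<le> norm (M *\<^sub>R f x)"
    proof (intro AE_I2 impI)
      fix x assume "x \<in> {a..b}"
      from M[OF this] show "norm (\<psi> x *\<^sub>R f x) \<le> norm (M *\<^sub>R f x)"
        by (simp add: mult_right_mono)
    qed
  qed
  then show "set_integrable lborel {0<..} (\<lambda>x. \<psi> x *\<^sub>R f x)"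
    unfolding set_integrable_def eq .
qed

lemma test_function_integrable:
  fixes f :: "real \<Rightarrow> 'a :: {banach, second_countable_topology}"
  assumes \<phi>: "\<phi> \<in> test_functions" and f: "\<And>a b. 0 < a \<Longrightarrow> set_integrable lborel {a..b} f"
  shows "set_integrable lborel {0<..} (\<lambda>x. \<phi> x *\<^sub>R f x)"
    "set_integrable lborel {0<..} (\<lambda>x. deriv \<phi> x *\<^sub>R f x)"
proof -
  obtain a b where *: "0 < a" "\<And>x. x \<notin> {a<..<b} \<Longrightarrow> \<phi> x = 0" "\<And>x. x \<notin> {a<..<b} \<Longrightarrow> deriv \<phi> x = 0"
    "continuous_on UNIV (deriv \<phi>)" "continuous_on UNIV \<phi>"
    using test_functionE[OF \<phi>] by metis
  show "set_integrable lborel {0<..} (\<lambda>x. \<phi> x *\<^sub>R f x)"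
    by (rule set_integrable_compact_support[OF f[OF *(1)] *(5,1,2)])
  show "set_integrable lborel {0<..} (\<lambda>x. deriv \<phi> x *\<^sub>R f x)"
    by (rule set_integrable_compact_support[OF f[OF *(1)] *(4,1,3)])
qed

lemma has_weak_deriv_unique:
  assumes g: "\<And>a b. 0 < a \<Longrightarrow> set_integrable lborel {a..b} g1" "\<And>a b. 0 < a \<Longrightarrow> set_integrable lborel {a..b} g2"
    and w: "has_weak_deriv f g1" "has_weak_deriv f g2"
  shows "AE x in lborel. 0 < x \<longrightarrow> g1 x = g2 x"
proof -
  have "AE x in lborel. 0 < x \<longrightarrow> g1 x - g2 x = 0"
  proof (rule fundamental_lemma)
    show "set_integrable lborel {a..b} (\<lambda>x. g1 x - g2 x)" if "0 < a" for a b
      using that g by (intro set_integral_diff)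
    fix \<phi> assume \<phi>: "\<phi> \<in> test_functions"
    have "(LINT x:{0<..}|lborel. \<phi> x *\<^sub>R (g1 x - g2 x)) =
      (LINT x:{0<..}|lborel. \<phi> x *\<^sub>R g1 x) - (LINT x:{0<..}|lborel. \<phi> x *\<^sub>R g2 x)"
      unfolding scaleR_diff_right
      by (intro set_integral_diff test_function_integrable \<phi> g)
    also have "\<dots> = 0"
      using bspec[OF w(1)[unfolded has_weak_deriv_def] \<phi>] bspec[OF w(2)[unfolded has_weak_deriv_def] \<phi>]
      by simp
    finally show "(LINT x:{0<..}|lborel. \<phi> x *\<^sub>R (g1 x - g2 x)) = 0" .
  qed
  then show ?thesis by simp
qed

lemma LINT_half_cong_AE:
  fixes f g :: "real \<Rightarrow> complex"
  assumes f: "set_borel_measurable lborel {0<..} f" "set_borel_measurable lborel {0<..} g"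
    and ae: "AE x in lborel. 0 < x \<longrightarrow> f x = g x"
    and \<psi>: "continuous_on UNIV \<psi>"
  shows "(LINT x:{0<..}|lborel. \<psi> x *\<^sub>R f x) = (LINT x:{0<..}|lborel. \<psi> x *\<^sub>R g x)"
  unfolding set_lebesgue_integral_def
proof (rule integral_cong_AE)
  have m: "(\<lambda>x. indicator {0<..} x *\<^sub>R \<psi> x *\<^sub>R h x) \<in> borel_measurable lborel" if "set_borel_measurable lborel {0<..} h" for h :: "real \<Rightarrow> complex"
  proof -
    have "(\<lambda>x. \<psi> x *\<^sub>R (indicator {0<..} x *\<^sub>R h x)) \<in> borel_measurable lborel"
      using \<psi> by (intro borel_measurable_scaleR[OF _ that[unfolded set_borel_measurable_def]])
        (simp add: borel_measurable_continuous_onI)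
    then show ?thesis by (simp add: mult.commute)
  qed
  show "(\<lambda>x. indicator {0<..} x *\<^sub>R \<psi> x *\<^sub>R f x) \<in> borel_measurable lborel"
    "(\<lambda>x. indicator {0<..} x *\<^sub>R \<psi> x *\<^sub>R g x) \<in> borel_measurable lborel"
    using m f by blast+
  show "AE x in lborel. indicator {0<..} x *\<^sub>R \<psi> x *\<^sub>R f x = indicator {0<..} x *\<^sub>R \<psi> x *\<^sub>R g x"
    using ae by eventually_elim (simp add: indicator_def)
qed

lemma has_weak_deriv_cong_AE:
  assumes "g \<in> L2_half" "g' \<in> L2_half" and "AE x in lborel. 0 < x \<longrightarrow> g x = g' x"
    and w: "has_weak_deriv g h"
  shows "has_weak_deriv g' h"
  unfolding has_weak_deriv_def
proof
  fix \<phi> assume \<phi>: "\<phi> \<in> test_functions"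
  then have "continuous_on UNIV (deriv \<phi>)" using test_functionE by metis
  from LINT_half_cong_AE[OF assms(1,2)[THEN set_borel_measurable_L2_half] assms(3) this] bspec[OF w[unfolded has_weak_deriv_def] \<phi>]
  show "(LINT x:{0<..}|lborel. deriv \<phi> x *\<^sub>R g' x) = - (LINT x:{0<..}|lborel. \<phi> x *\<^sub>R h x)"
    by simp
qed

text \<open>\<open>weak_deriv\<close> picks some version, not necessarily \<open>g\<close>;
  uniqueness identifies the two almost everywhere on the half-line.\<close>

lemma weak_deriv_works:
  assumes "g \<in> L2_half" "has_weak_deriv f g"
  shows "weak_deriv f \<in> L2_half" "has_weak_deriv f (weak_deriv f)"
    "AE x in lborel. 0 < x \<longrightarrow> weak_deriv f x = g x"
proof -
  have "weak_deriv f \<in> L2_half \<and> has_weak_deriv f (weak_deriv f)"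
    unfolding weak_deriv_def by (rule someI[of _ g]) (use assms in simp)
  then show *: "weak_deriv f \<in> L2_half" "has_weak_deriv f (weak_deriv f)" by auto
  show "AE x in lborel. 0 < x \<longrightarrow> weak_deriv f x = g x"
    by (rule has_weak_deriv_unique[OF L2_half_set_integrable[OF *(1)] L2_half_set_integrable[OF assms(1)] *(2) assms(2)])
qed

text \<open>The outer \<open>weak_deriv\<close> acts on the version chosen by the inner one, which
  may differ from \<open>g\<close> on a null set; integrals against test functions do not notice
  this.\<close>

lemma weak_deriv2_works:
  assumes "g \<in> L2_half" "has_weak_deriv f g" "h \<in> L2_half" "has_weak_deriv g h"
  shows "weak_deriv (weak_deriv f) \<in> L2_half"
    "has_weak_deriv (weak_deriv f) (weak_deriv (weak_deriv f))"
    "AE x in lborel. 0 < x \<longrightarrow> weak_deriv (weak_deriv f) x = h x"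
proof -
  note 1 = weak_deriv_works[OF assms(1,2)]
  have "AE x in lborel. 0 < x \<longrightarrow> g x = weak_deriv f x"
    using 1(3) by eventually_elim simp
  then have "has_weak_deriv (weak_deriv f) h"
    by (rule has_weak_deriv_cong_AE[OF assms(1) 1(1) _ assms(4)])
  from weak_deriv_works[OF assms(3) this]
  show "weak_deriv (weak_deriv f) \<in> L2_half"
    "has_weak_deriv (weak_deriv f) (weak_deriv (weak_deriv f))"
    "AE x in lborel. 0 < x \<longrightarrow> weak_deriv (weak_deriv f) x = h x" by auto
qed

text \<open>Integration by parts over an interval [a, b] with a > 0 outside which the test function
  vanishes, so no boundary term arises.\<close>

lemma has_weak_deriv_classical:
  assumes d: "\<And>x. 0 < x \<Longrightarrow> (f has_vector_derivative f' x) (at x)"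
    and c: "continuous_on {0<..} f'"
  shows "has_weak_deriv f f'"
  unfolding has_weak_deriv_def
proof
  fix \<phi> assume \<phi>: "\<phi> \<in> test_functions"
  obtain a b where *: "0 < a" "a < b" "\<And>x. x \<notin> {a<..<b} \<Longrightarrow> \<phi> x = 0" "\<And>x. x \<notin> {a<..<b} \<Longrightarrow> deriv \<phi> x = 0"
    "\<And>x. (\<phi> has_real_derivative deriv \<phi> x) (at x)" "continuous_on UNIV (deriv \<phi>)" "continuous_on UNIV \<phi>"
    using test_functionE[OF \<phi>] by metis
  have cf: "continuous_on {a..b} f"
    by (intro continuous_at_imp_continuous_on ballI has_vector_derivative_continuous[OF d]) (use *(1) in auto)
  have cf': "continuous_on {a..b} f'"
    by (rule continuous_on_subset[OF c]) (use *(1) in auto)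
  have i: "set_integrable lborel {a..b} f" "set_integrable lborel {a..b} f'"
    by (intro borel_integrable_atLeastAtMost' cf cf')+
  have "(\<integral>x. indicator {a..b} x *\<^sub>R (\<phi> x *\<^sub>R f' x + deriv \<phi> x *\<^sub>R f x) \<partial>lborel) = \<phi> b *\<^sub>R f b - \<phi> a *\<^sub>R f a"
  proof (rule integral_FTC_Icc)
    show "a \<le> b" using *(2) by simp
    show "((\<lambda>x. \<phi> x *\<^sub>R f x) has_vector_derivative \<phi> x *\<^sub>R f' x + deriv \<phi> x *\<^sub>R f x) (at x within {a..b})"
      if "a \<le> x" "x \<le> b" for x
      using has_vector_derivative_scaleR[OF has_field_derivative_at_within[OF *(5)[of x]]
          has_vector_derivative_at_within[OF d[of x]], of "{a..b}"] *(1) that by simp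
    show "continuous_on {a..b} (\<lambda>x. \<phi> x *\<^sub>R f' x + deriv \<phi> x *\<^sub>R f x)"
      by (intro continuous_intros cf cf' continuous_on_subset[OF *(6)] continuous_on_subset[OF *(7)]) auto
  qed
  also have "\<dots> = 0" using *(3)[of a] *(3)[of b] by simp
  finally have 0: "(LINT x:{a..b}|lborel. \<phi> x *\<^sub>R f' x + deriv \<phi> x *\<^sub>R f x) = 0"
    by (simp add: set_lebesgue_integral_def)
  have eq: "(LINT x:{0<..}|lborel. \<phi> x *\<^sub>R f' x) = (LINT x:{a..b}|lborel. \<phi> x *\<^sub>R f' x)"
    "(LINT x:{0<..}|lborel. deriv \<phi> x *\<^sub>R f x) = (LINT x:{a..b}|lborel. deriv \<phi> x *\<^sub>R f x)"
    by (rule set_integral_compact_support[OF i(2) *(7,1,3)] set_integral_compact_support[OF i(1) *(6,1,4)], assumption)+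
  have "set_integrable lborel {a..b} (\<lambda>x. \<phi> x *\<^sub>R f' x)" "set_integrable lborel {a..b} (\<lambda>x. deriv \<phi> x *\<^sub>R f x)"
    by (intro borel_integrable_atLeastAtMost' continuous_intros cf cf' continuous_on_subset[OF *(6)] continuous_on_subset[OF *(7)]; simp)+
  from set_integral_add(2)[OF this] 0 eq
  show "(LINT x:{0<..}|lborel. deriv \<phi> x *\<^sub>R f x) = - (LINT x:{0<..}|lborel. \<phi> x *\<^sub>R f' x)"
    by (simp add: eq_neg_iff_add_eq_0 add.commute)
qed

section \<open>Regularity of weak solutions\<close>

text \<open>An antiderivative of \<psi> is constant on either side of (l, r), and the vanishing
  integral makes the two constants equal, so one normalisation annihilates both.\<close>

lemma antiderivative_compact_support:
  fixes \<psi> :: "real \<Rightarrow> real"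
  assumes c: "continuous_on UNIV \<psi>" and z: "\<And>x. x \<notin> {l<..<r} \<Longrightarrow> \<psi> x = 0" and "l \<le> r"
    and i: "integral {l..r} \<psi> = 0"
  obtains \<phi> where "\<And>x. (\<phi> has_real_derivative \<psi> x) (at x)" "\<And>x. x \<notin> {l<..<r} \<Longrightarrow> \<phi> x = 0"
    "continuous_on UNIV \<phi>"
proof -
  have "isCont \<psi> x" for x using c by (simp add: continuous_on_eq_continuous_at)
  then have "\<exists>F. \<forall>x::real. -\<infinity> < ereal x \<longrightarrow> ereal x < \<infinity> \<longrightarrow> (F has_vector_derivative \<psi> x) (at x)"
    by (intro einterval_antiderivative) auto
  then obtain F where F: "\<And>x. (F has_vector_derivative \<psi> x) (at x)" by auto
  have FTC: "(\<psi> has_integral F y - F x) {x..y}" if "x \<le> y" for x y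
    by (rule fundamental_theorem_of_calculus[OF that has_vector_derivative_at_within[OF F]])
  have z0: "(\<psi> has_integral 0) S" if "\<And>x. x \<in> S \<Longrightarrow> x \<notin> {l<..<r}" for S
    by (rule has_integral_eq[OF _ has_integral_0]) (use z that in auto)
  have Frl: "F r = F l" using FTC[OF \<open>l \<le> r\<close>] i by (simp add: integral_unique)
  have "F x - F l = 0" if "x \<notin> {l<..<r}" for x
  proof (cases "x \<le> l")
    case True
    have "(\<psi> has_integral 0) {x..l}" by (rule z0) auto
    from has_integral_unique[OF FTC[OF True] this] show ?thesis by simp
  next
    case False
    then have "r \<le> x" using that by auto
    have "(\<psi> has_integral 0) {r..x}" by (rule z0) auto
    from has_integral_unique[OF FTC[OF \<open>r \<le> x\<close>] this] show ?thesis using Frl by simp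
  qed
  moreover have "((\<lambda>x. F x - F l) has_real_derivative \<psi> x) (at x)" for x
    using F[of x] by (auto intro!: derivative_eq_intros simp: has_real_derivative_iff_has_vector_derivative[symmetric])
  moreover from this have "continuous_on UNIV (\<lambda>x. F x - F l)"
    by (intro DERIV_continuous_on)
  ultimately show ?thesis using that by blast
qed

text \<open>Testing against $\varphi'' = w (k - A)$ with a weight $w$ and the $w$-orthogonal projection $A$
  of $k$ onto the affine functions gives $\int w (k - A)^2 = 0$.\<close>

lemma affine_if_orthogonal_to_second_derivs:
  fixes k :: "real \<Rightarrow> real"
  assumes c: "continuous_on {0<..} k"
    and z: "\<And>\<phi>. \<phi> \<in> test_functions \<Longrightarrow> deriv \<phi> \<in> test_functions \<Longrightarrow>
      (LINT x:{0<..}|lborel. deriv (deriv \<phi>) x *\<^sub>R k x) = 0"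
    and lr: "0 < l" "l < r"
  shows "\<exists>A B. \<forall>x\<in>{l..r}. k x = A + B * x"
proof -
  define m where "m = (l + r) / 2"
  define h where "h = (r - l) / 2"
  have h: "0 < h" using lr by (simp add: h_def)
  \<comment> \<open>The weight vanishes at \<open>l\<close> and \<open>r\<close>, so its product
    with a continuous function is continuous on the line and zero outside (l, r). Its symmetry about
    \<open>m\<close> makes 1 and x - m orthogonal, which decouples the equations for the two
    projection coefficients \<open>A\<close> and \<open>B\<close>.\<close>
  define w where "w x = max 0 (h\<^sup>2 - (x - m)\<^sup>2)" for x
  have weq: "h\<^sup>2 - (x - m)\<^sup>2 = (x - l) * (r - x)" for x
    by (simp add: h_def m_def power2_eq_square field_simps)
  have wz: "w x = 0" if "x \<notin> {l<..<r}" for x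
    using that lr unfolding w_def weq by (auto simp: max_def mult_le_0_iff zero_le_mult_iff)
  have w0: "w x \<ge> 0" for x by (simp add: w_def)
  have wpos: "w x > 0" if "x \<in> {l<..<r}" for x
    using that unfolding w_def weq by (auto simp: max_def mult_le_0_iff)
  have win: "w x = h\<^sup>2 - (x - m)\<^sup>2" if "x \<in> {l..r}" for x
    using that unfolding w_def weq by (auto simp: max_def mult_le_0_iff zero_le_mult_iff)
  have contw: "continuous_on S w" for S unfolding w_def by (intro continuous_intros)
  \<comment> \<open>\<open>k\<close> is continuous on the open half-line only; clamping the argument
    extends its restriction to [l, r] continuously to the whole line.\<close>
  define kc where "kc x = k (max l (min r x))" for x
  have kc: "kc x = k x" if "x \<in> {l..r}" for x using that by (auto simp: kc_def max_def min_def)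
  have contkc: "continuous_on S kc" for S unfolding kc_def
    by (rule continuous_on_compose2[OF c]) (use lr in \<open>auto intro!: continuous_intros simp: less_max_iff_disj\<close>)
  note ci = integrable_continuous_real continuous_intros contw contkc
  have pos1: "integral {l..r} w > 0"
  proof -
    have "integral {l..r} w \<noteq> 0"
      using integral_eq_0_iff[of l r w] contw lr w0 wpos[of m] by (force simp: m_def)
    moreover have "integral {l..r} w \<ge> 0" by (intro integral_nonneg ci w0)
    ultimately show ?thesis by simp
  qed
  have pos2: "integral {l..r} (\<lambda>x. w x * (x - m)\<^sup>2) > 0"
  proof -
    have "continuous_on {l..r} (\<lambda>x. w x * (x - m)\<^sup>2)" by (intro ci)
    then have "integral {l..r} (\<lambda>x. w x * (x - m)\<^sup>2) = 0 \<longleftrightarrow> (\<forall>x\<in>{l..r}. w x * (x - m)\<^sup>2 = 0)"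
      using lr w0 by (intro integral_eq_0_iff) auto
    moreover have "w (m + h/2) * (m + h/2 - m)\<^sup>2 \<noteq> 0" "m + h/2 \<in> {l..r}"
      using wpos[of "m + h/2"] lr h by (auto simp: m_def h_def field_simps)
    moreover have "integral {l..r} (\<lambda>x. w x * (x - m)\<^sup>2) \<ge> 0"
      by (intro integral_nonneg ci) (use w0 in auto)
    ultimately show ?thesis by (metis less_eq_real_def)
  qed
  have sym: "integral {l..r} (\<lambda>x. w x * (x - m)) = 0"
  proof -
    let ?G = "\<lambda>x. h\<^sup>2 * (x - m)\<^sup>2 / 2 - (x - m)^4 / 4"
    have "((\<lambda>x. w x * (x - m)) has_integral ?G r - ?G l) {l..r}"
    proof (rule fundamental_theorem_of_calculus)
      fix x assume "x \<in> {l..r}"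
      then have "w x * (x - m) = (h\<^sup>2 - (x - m)\<^sup>2) * (x - m)" using win by simp
      also have "\<dots> = h\<^sup>2 * (x - m) - (x - m)^3" by (simp add: algebra_simps power3_eq_cube power2_eq_square)
      finally have eq: "w x * (x - m) = h\<^sup>2 * (x - m) - (x - m)^3" .
      show "(?G has_vector_derivative w x * (x - m)) (at x within {l..r})"
        unfolding eq has_real_derivative_iff_has_vector_derivative[symmetric]
        by (auto intro!: derivative_eq_intros)
    qed (use lr in simp)
    moreover have "r - m = h" "l - m = - h" by (simp_all add: m_def h_def field_simps)
    ultimately show ?thesis by (simp add: integral_unique)
  qed
  define A where "A = integral {l..r} (\<lambda>x. w x * kc x) / integral {l..r} w"
  define B where "B = integral {l..r} (\<lambda>x. w x * kc x * (x - m)) / integral {l..r} (\<lambda>x. w x * (x - m)\<^sup>2)"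
  define d where "d x = kc x - (A + B * (x - m))" for x
  define \<psi> where "\<psi> x = w x * d x" for x
  have contd: "continuous_on S d" for S unfolding d_def by (intro ci)
  have cont\<psi>: "continuous_on S \<psi>" for S unfolding \<psi>_def by (intro ci contd)
  have \<psi>z: "\<psi> x = 0" if "x \<notin> {l<..<r}" for x using wz[OF that] by (simp add: \<psi>_def)
  have m0: "integral {l..r} \<psi> = 0"
  proof -
    have "integral {l..r} \<psi> = integral {l..r} (\<lambda>x. w x * kc x - (A * w x + B * (w x * (x - m))))"
      by (rule arg_cong[of _ _ "integral _"]) (auto simp: \<psi>_def d_def algebra_simps fun_eq_iff)
    also have "\<dots> = integral {l..r} (\<lambda>x. w x * kc x) - (A * integral {l..r} w + B * integral {l..r} (\<lambda>x. w x * (x - m)))"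
      by (subst integral_diff, intro ci, intro ci, subst integral_add, intro ci, intro ci) simp
    also have "\<dots> = 0" using pos1 sym by (simp add: A_def)
    finally show ?thesis .
  qed
  have m1: "integral {l..r} (\<lambda>x. (x - m) * \<psi> x) = 0"
  proof -
    have "integral {l..r} (\<lambda>x. (x - m) * \<psi> x) = integral {l..r} (\<lambda>x. w x * kc x * (x - m) - (A * (w x * (x - m)) + B * (w x * (x - m)\<^sup>2)))"
      by (rule arg_cong[of _ _ "integral _"]) (auto simp: \<psi>_def d_def algebra_simps fun_eq_iff power2_eq_square)
    also have "\<dots> = integral {l..r} (\<lambda>x. w x * kc x * (x - m)) - (A * integral {l..r} (\<lambda>x. w x * (x - m)) + B * integral {l..r} (\<lambda>x. w x * (x - m)\<^sup>2))"
      by (subst integral_diff, intro ci, intro ci, subst integral_add, intro ci, intro ci) simp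
    also have "\<dots> = 0" using pos2 sym by (simp add: B_def)
    finally show ?thesis .
  qed
  obtain \<phi>1 where \<phi>1: "\<And>x. (\<phi>1 has_real_derivative \<psi> x) (at x)" "\<And>x. x \<notin> {l<..<r} \<Longrightarrow> \<phi>1 x = 0" "continuous_on UNIV \<phi>1"
    using antiderivative_compact_support[OF cont\<psi> \<psi>z less_imp_le[OF lr(2)] m0] by metis
  \<comment> \<open>Integration by parts turns the vanishing first moment of \<psi> into a vanishing
    integral of \<open>\<phi>1\<close>, so that \<open>\<phi>1\<close> has a compactly supported
    antiderivative as well.\<close>
  have "((\<lambda>x. \<phi>1 x + (x - m) * \<psi> x) has_integral (r - m) * \<phi>1 r - (l - m) * \<phi>1 l) {l..r}"
  proof (rule fundamental_theorem_of_calculus)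
    show "((\<lambda>x. (x - m) * \<phi>1 x) has_vector_derivative \<phi>1 x + (x - m) * \<psi> x) (at x within {l..r})" for x
      unfolding has_real_derivative_iff_has_vector_derivative[symmetric]
      by (auto intro!: derivative_eq_intros has_field_derivative_at_within[OF \<phi>1(1)])
  qed (use lr in simp)
  then have "integral {l..r} (\<lambda>x. \<phi>1 x + (x - m) * \<psi> x) = 0"
    using \<phi>1(2)[of l] \<phi>1(2)[of r] by (simp add: integral_unique)
  then have m2: "integral {l..r} \<phi>1 = 0"
    using m1 by (subst (asm) integral_add) (auto intro!: ci cont\<psi> continuous_on_subset[OF \<phi>1(3)])
  obtain \<phi> where \<phi>: "\<And>x. (\<phi> has_real_derivative \<phi>1 x) (at x)" "\<And>x. x \<notin> {l<..<r} \<Longrightarrow> \<phi> x = 0"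
    using antiderivative_compact_support[OF \<phi>1(3,2) less_imp_le[OF lr(2)] m2] by metis
  have out: "x \<notin> {l<..<r}" if "x \<notin> {l..r}" for x using that by auto
  have t: "\<phi> \<in> test_functions" "deriv \<phi> = \<phi>1"
    using test_functionI[OF \<phi>(1) \<phi>1(3) lr(1), of r] \<phi>(2)[OF out] by auto
  have t1: "\<phi>1 \<in> test_functions" "deriv \<phi>1 = \<psi>"
    using test_functionI[OF \<phi>1(1) cont\<psi> lr(1), of r] \<phi>1(2)[OF out] by auto
  have ck: "continuous_on {l..r} k" by (rule continuous_on_subset[OF c]) (use lr in auto)
  have "0 = (LINT x:{0<..}|lborel. \<psi> x *\<^sub>R k x)" using z[of \<phi>] t t1 by simp
  also have "\<dots> = (LINT x:{l..r}|lborel. \<psi> x *\<^sub>R k x)"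
    by (rule set_integral_compact_support[OF _ cont\<psi> lr(1) \<psi>z]) (intro borel_integrable_atLeastAtMost' ck)
  also have "\<dots> = integral {l..r} (\<lambda>x. \<psi> x *\<^sub>R k x)"
    by (intro set_borel_integral_eq_integral borel_integrable_atLeastAtMost' continuous_intros ck cont\<psi>)
  \<comment> \<open>Since k = d + A + B (x - m), the affine part contributes only the two vanishing
    moments of \<psi> and leaves the weighted square of \<open>d\<close>.\<close>
  also have "\<dots> = integral {l..r} (\<lambda>x. w x * (d x)\<^sup>2 + (A * \<psi> x + B * ((x - m) * \<psi> x)))"
    by (rule integral_cong) (simp add: \<psi>_def kc[symmetric] d_def power2_eq_square algebra_simps)
  also have "\<dots> = integral {l..r} (\<lambda>x. w x * (d x)\<^sup>2) + (A * integral {l..r} \<psi> + B * integral {l..r} (\<lambda>x. (x - m) * \<psi> x))"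
    by (subst integral_add, intro ci contd, intro ci cont\<psi>, subst integral_add, intro ci cont\<psi>, intro ci cont\<psi>) simp
  finally have "integral {l..r} (\<lambda>x. w x * (d x)\<^sup>2) = 0" using m0 m1 by simp
  then have zz: "\<forall>x\<in>{l..r}. w x * (d x)\<^sup>2 = 0"
    by (subst (asm) integral_eq_0_iff) (use lr w0 in \<open>auto intro!: ci contd\<close>)
  have dz: "d x = 0" if "x \<in> {l<..<r}" for x
  proof -
    have "w x * (d x)\<^sup>2 = 0" using zz that by auto
    then show ?thesis using wpos[OF that] by simp
  qed
  \<comment> \<open>At the end points the weight is zero and gives no information; there the
    continuity of \<open>d\<close> decides.\<close>
  have "d x = 0" if "x \<in> {l..r}" for x
  proof (rule continuous_constant_on_closure[of "{l<..<r}" d 0 x])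
    show "continuous_on (closure {l<..<r}) d" by (rule contd)
    show "x \<in> closure {l<..<r}" using that lr by (simp add: closure_greaterThanLessThan)
  qed (use dz in auto)
  then have "\<forall>x\<in>{l..r}. k x = (A - B * m) + B * x"
    using kc by (auto simp: d_def algebra_simps)
  then show ?thesis by blast
qed

lemma set_borel_measurable_halfline_continuous:
  fixes f :: "real \<Rightarrow> 'a :: real_normed_vector"
  assumes "continuous_on {0<..} f"
  shows "set_borel_measurable lborel {0<..} f"
  unfolding set_borel_measurable_def
  using borel_measurable_continuous_on_indicator[OF _ assms] by simp

lemma L2_half_cong_AE:
  assumes g: "g \<in> L2_half" and f: "set_borel_measurable lborel {0<..} f"
    and ae: "AE x in lborel. 0 < x \<longrightarrow> f x = g x"
  shows "f \<in> L2_half"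
proof -
  have "set_integrable lborel {0<..} (\<lambda>x. (cmod (f x))\<^sup>2)"
  proof (rule set_integrable_bound)
    show "set_integrable lborel {0<..} (\<lambda>x. (cmod (g x))\<^sup>2)" using g by (simp add: L2_half_def)
    have "(\<lambda>x. (cmod (indicator {0<..} x *\<^sub>R f x))\<^sup>2) \<in> borel_measurable lborel"
      using f unfolding set_borel_measurable_def by measurable
    moreover have "(\<lambda>x. (cmod (indicator {0<..} x *\<^sub>R f x))\<^sup>2) = (\<lambda>x. indicator {0<..} x *\<^sub>R (cmod (f x))\<^sup>2)"
      by (auto simp: indicator_def)
    ultimately show "set_borel_measurable lborel {0<..} (\<lambda>x. (cmod (f x))\<^sup>2)"
      by (simp add: set_borel_measurable_def)
    show "AE x in lborel. x \<in> {0<..} \<longrightarrow> norm ((cmod (f x))\<^sup>2) \<le> norm ((cmod (g x))\<^sup>2)"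
      using ae by eventually_elim simp
  qed
  then show ?thesis using f by (simp add: L2_half_def)
qed

lemma L2_half_exp_decay:
  assumes c: "continuous_on {0<..} f" and b: "\<And>x. 0 < x \<Longrightarrow> cmod (f x) \<le> C * exp (- s * x)" and s: "0 < s"
  shows "f \<in> L2_half"
proof -
  have m: "set_borel_measurable lborel {0<..} f"
    by (rule set_borel_measurable_halfline_continuous[OF c])
  have "set_integrable lborel {0<..} (\<lambda>x. (cmod (f x))\<^sup>2)"
  proof (rule set_integrable_bound)
    have "set_integrable lborel {0<..} (\<lambda>x. exp (- (x * (2 * s))))"
      by (rule integrable_I0i_exp_mscale) (use s in simp)
    then show "set_integrable lborel {0<..} (\<lambda>x. C\<^sup>2 * exp (- (x * (2 * s))))" by simp
    show "set_borel_measurable lborel {0<..} (\<lambda>x. (cmod (f x))\<^sup>2)"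
      by (intro set_borel_measurable_halfline_continuous continuous_intros c)
    show "AE x in lborel. x \<in> {0<..} \<longrightarrow> norm ((cmod (f x))\<^sup>2) \<le> norm (C\<^sup>2 * exp (- (x * (2 * s))))"
    proof (intro AE_I2 impI)
      fix x :: real assume "x \<in> {0<..}"
      then have "(cmod (f x))\<^sup>2 \<le> (C * exp (- s * x))\<^sup>2" using b[of x] by (intro power_mono) auto
      also have "\<dots> = C\<^sup>2 * exp (- (x * (2 * s)))"
        by (simp add: power_mult_distrib exp_double[symmetric] algebra_simps)
      finally show "norm ((cmod (f x))\<^sup>2) \<le> norm (C\<^sup>2 * exp (- (x * (2 * s))))" by simp
    qed
  qed
  then show ?thesis using m by (simp add: L2_half_def)
qed

text \<open>The half-line has infinite measure. This is what kills the constant Wronskian of two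
  solutions that are square integrable together with their derivatives.\<close>

lemma set_integrable_halfline_const:
  fixes c :: "'a :: {banach, second_countable_topology}"
  assumes "set_integrable lborel {0<..} (\<lambda>x::real. c)"
  shows "c = 0"
proof (rule ccontr)
  assume "c \<noteq> 0"
  have "integrable lborel (\<lambda>x::real. norm (indicator {0<..} x *\<^sub>R c))"
    using assms unfolding set_integrable_def by (rule integrable_norm)
  then have "integrable lborel (\<lambda>x::real. indicator {0<..} x * norm c)" by simp
  then have "integrable lborel (\<lambda>x::real. indicator {0<..} x * norm c / norm c)" by (rule integrable_divide)
  then have "integrable lborel (indicator {0<..} :: real \<Rightarrow> real)" using \<open>c \<noteq> 0\<close> by simp
  then have "emeasure lborel {0::real<..} < \<infinity>" by (subst (asm) integrable_indicator_iff) simp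
  then obtain r where r: "emeasure lborel {0::real<..} = ennreal r" "0 \<le> r"
    by (cases "emeasure lborel {0::real<..}") auto
  obtain n where n: "r < real n" using reals_Archimedean2 by blast
  have "ennreal (real n) = emeasure lborel {0<..<real n}" by simp
  also have "\<dots> \<le> emeasure lborel {0::real<..}" by (intro emeasure_mono) auto
  finally show False using r n by simp
qed

lemma H2_half_weak_derivs:
  assumes "f \<in> H2_half"
  shows "weak_deriv f \<in> L2_half" "has_weak_deriv f (weak_deriv f)"
    "weak_deriv (weak_deriv f) \<in> L2_half" "has_weak_deriv (weak_deriv f) (weak_deriv (weak_deriv f))"
proof -
  obtain g h where "g \<in> L2_half" "has_weak_deriv f g" "h \<in> L2_half" "has_weak_deriv g h"
    using assms by (auto simp: H2_half_def)
  with weak_deriv_works(1,2)[of g f] weak_deriv2_works(1,2)[of g f h] show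
    "weak_deriv f \<in> L2_half" "has_weak_deriv f (weak_deriv f)"
    "weak_deriv (weak_deriv f) \<in> L2_half" "has_weak_deriv (weak_deriv f) (weak_deriv (weak_deriv f))"
    by blast+
qed

lemma continuous_imp_set_integrable:
  fixes f :: "real \<Rightarrow> 'a :: {banach, second_countable_topology}"
  assumes "continuous_on {0<..} f" "0 < a"
  shows "set_integrable lborel {a..b} f"
  by (intro borel_integrable_atLeastAtMost' continuous_on_subset[OF assms(1)]) (use assms(2) in auto)

text \<open>Integrating by parts twice, for the weak chain f, g, h and for the classical chain P,
  P', P2, gives the same integral, so f - P is orthogonal to every second derivative \<phi>'' with
  \<phi> and \<phi>' admissible. The real-valued lemma then applies through the bounded linear maps
  Re and Im.\<close>

lemma weak_solution_affine_difference:
  fixes f P P' P2 :: "real \<Rightarrow> complex"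
  assumes cf: "continuous_on {0<..} f"
    and w: "has_weak_deriv f g" "has_weak_deriv g h" and h: "h \<in> L2_half"
    and P: "\<And>x. 0 < x \<Longrightarrow> (P has_vector_derivative P' x) (at x)"
      "\<And>x. 0 < x \<Longrightarrow> (P' has_vector_derivative P2 x) (at x)"
    and cP2: "continuous_on {0<..} P2" and ae: "AE x in lborel. 0 < x \<longrightarrow> h x = P2 x"
    and lr: "0 < l" "l < r"
  shows "\<exists>A B. \<forall>x\<in>{l..r}. f x = P x + (A + B * of_real x)"
proof -
  have cP: "continuous_on {0<..} P"
    by (intro continuous_at_imp_continuous_on ballI has_vector_derivative_continuous[OF P(1)]) auto
  have cP': "continuous_on {0<..} P'"
    by (intro continuous_at_imp_continuous_on ballI has_vector_derivative_continuous[OF P(2)]) auto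
  have wP: "has_weak_deriv P P'" "has_weak_deriv P' P2"
    by (rule has_weak_deriv_classical[OF P(1) cP'] has_weak_deriv_classical[OF P(2) cP2]; assumption)+
  let ?d = "\<lambda>x. f x - P x"
  have z: "(LINT x:{0<..}|lborel. deriv (deriv \<phi>) x *\<^sub>R ?d x) = 0"
    and i: "set_integrable lborel {0<..} (\<lambda>x. deriv (deriv \<phi>) x *\<^sub>R ?d x)"
    if \<phi>: "\<phi> \<in> test_functions" and \<phi>': "deriv \<phi> \<in> test_functions" for \<phi>
  proof -
    have c\<phi>: "continuous_on UNIV \<phi>" using test_functionE[OF \<phi>] by metis
    have "(LINT x:{0<..}|lborel. deriv (deriv \<phi>) x *\<^sub>R f x) = (LINT x:{0<..}|lborel. \<phi> x *\<^sub>R h x)"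
      using bspec[OF w(1)[unfolded has_weak_deriv_def] \<phi>'] bspec[OF w(2)[unfolded has_weak_deriv_def] \<phi>]
      by simp
    also have "\<dots> = (LINT x:{0<..}|lborel. \<phi> x *\<^sub>R P2 x)"
      by (intro LINT_half_cong_AE set_borel_measurable_L2_half h set_borel_measurable_halfline_continuous cP2 ae c\<phi>)
    also have "\<dots> = (LINT x:{0<..}|lborel. deriv (deriv \<phi>) x *\<^sub>R P x)"
      using bspec[OF wP(1)[unfolded has_weak_deriv_def] \<phi>'] bspec[OF wP(2)[unfolded has_weak_deriv_def] \<phi>]
      by simp
    finally have eq: "(LINT x:{0<..}|lborel. deriv (deriv \<phi>) x *\<^sub>R f x) =
      (LINT x:{0<..}|lborel. deriv (deriv \<phi>) x *\<^sub>R P x)" .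
    have ii: "set_integrable lborel {0<..} (\<lambda>x. deriv (deriv \<phi>) x *\<^sub>R f x)"
      "set_integrable lborel {0<..} (\<lambda>x. deriv (deriv \<phi>) x *\<^sub>R P x)"
      by (intro test_function_integrable \<phi>' continuous_imp_set_integrable cf cP; assumption)+
    show "(LINT x:{0<..}|lborel. deriv (deriv \<phi>) x *\<^sub>R ?d x) = 0"
      "set_integrable lborel {0<..} (\<lambda>x. deriv (deriv \<phi>) x *\<^sub>R ?d x)"
      unfolding scaleR_diff_right using set_integral_diff[OF ii] eq by auto
  qed
  have aff: "\<exists>A B. \<forall>x\<in>{l..r}. T (?d x) = A + B * x" if T: "bounded_linear T" for T :: "complex \<Rightarrow> real"
  proof (rule affine_if_orthogonal_to_second_derivs[OF _ _ lr])
    interpret bounded_linear T by fact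
    show "continuous_on {0<..} (\<lambda>x. T (?d x))" by (intro continuous_on continuous_intros cf cP)
    fix \<phi> assume "\<phi> \<in> test_functions" "deriv \<phi> \<in> test_functions"
    note zi = z[OF this] i[OF this]
    have "(LINT x:{0<..}|lborel. deriv (deriv \<phi>) x *\<^sub>R T (?d x)) =
      (LINT x|lborel. T (indicator {0<..} x *\<^sub>R deriv (deriv \<phi>) x *\<^sub>R ?d x))"
      unfolding set_lebesgue_integral_def by (simp only: scale)
    also have "\<dots> = T 0"
      using integral_bounded_linear[OF T zi(2)[unfolded set_integrable_def]] zi(1)
      unfolding set_lebesgue_integral_def by simp
    finally show "(LINT x:{0<..}|lborel. deriv (deriv \<phi>) x *\<^sub>R T (?d x)) = 0" by (simp add: zero)
  qed
  obtain A1 B1 where 1: "\<forall>x\<in>{l..r}. Re (?d x) = A1 + B1 * x" using aff[OF bounded_linear_Re] by blast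
  obtain A2 B2 where 2: "\<forall>x\<in>{l..r}. Im (?d x) = A2 + B2 * x" using aff[OF bounded_linear_Im] by blast
  have "\<forall>x\<in>{l..r}. f x = P x + (Complex A1 A2 + Complex B1 B2 * of_real x)"
    using 1 2 by (auto simp: complex_eq_iff algebra_simps)
  then show ?thesis by blast
qed

text \<open>Elliptic regularity in one dimension: q f is continuous, so it is the second derivative
  of a classical function, and f differs from that by an affine function on every compact interval.
  The derivative is square integrable because it agrees with g almost everywhere.\<close>

lemma weak_solution_is_classical:
  fixes f :: "real \<Rightarrow> complex" and q :: "real \<Rightarrow> real"
  assumes cf: "continuous_on {0<..} f" and g: "g \<in> L2_half" "has_weak_deriv f g"
    and h: "h \<in> L2_half" "has_weak_deriv g h"
    and ae: "AE x in lborel. 0 < x \<longrightarrow> h x = q x *\<^sub>R f x" and q: "continuous_on {0<..} q"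
  obtains f' where "\<And>x. 0 < x \<Longrightarrow> (f has_vector_derivative f' x) (at x)"
    "\<And>x. 0 < x \<Longrightarrow> (f' has_vector_derivative q x *\<^sub>R f x) (at x)" "f' \<in> L2_half"
proof -
  let ?P2 = "\<lambda>x. q x *\<^sub>R f x"
  have c2: "continuous_on {0<..} ?P2" by (intro continuous_intros q cf)
  have ex: "\<exists>F. \<forall>x. 0 < x \<longrightarrow> (F has_vector_derivative k x) (at x)"
    if "continuous_on {0<..} k" for k :: "real \<Rightarrow> complex"
  proof -
    have "isCont k x" if "0 < x" for x
      using \<open>continuous_on {0<..} k\<close> that by (simp add: continuous_on_eq_continuous_at)
    then have "\<exists>F. \<forall>x::real. ereal 0 < ereal x \<longrightarrow> ereal x < \<infinity> \<longrightarrow> (F has_vector_derivative k x) (at x)"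
      by (intro einterval_antiderivative) auto
    then show ?thesis by auto
  qed
  obtain P' where P': "\<And>x. 0 < x \<Longrightarrow> (P' has_vector_derivative ?P2 x) (at x)" using ex[OF c2] by blast
  have cP': "continuous_on {0<..} P'"
    by (intro continuous_at_imp_continuous_on ballI has_vector_derivative_continuous[OF P']) auto
  obtain P where P: "\<And>x. 0 < x \<Longrightarrow> (P has_vector_derivative P' x) (at x)" using ex[OF cP'] by blast
  \<comment> \<open>Taken as the derivative itself, so that the constants \<open>B\<close> obtained
    on different intervals need not be matched.\<close>
  define f' where "f' x = vector_derivative f (at x)" for x
  have loc: "\<exists>B. \<forall>y\<in>{l<..<r}. (f has_vector_derivative P' y + B) (at y)" if lr: "0 < l" "l < r" for l r
  proof -
    obtain A B where AB: "\<forall>x\<in>{l..r}. f x = P x + (A + B * of_real x)"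
      using weak_solution_affine_difference[OF cf g(2) h(2,1) P P' c2 ae lr] by blast
    have "(f has_vector_derivative P' y + B) (at y)" if y: "y \<in> {l<..<r}" for y
    proof (rule has_vector_derivative_transform_within_open[of "\<lambda>x. P x + (A + B * of_real x)" _ _ "{l<..<r}"])
      have "0 < y" using y lr by auto
      show "((\<lambda>x. P x + (A + B * complex_of_real x)) has_vector_derivative P' y + B) (at y)"
        by (auto intro!: derivative_eq_intros P[OF \<open>0 < y\<close>])
      show "P z + (A + B * complex_of_real z) = f z" if "z \<in> {l<..<r}" for z using AB that by auto
    qed (use y in auto)
    then show ?thesis by blast
  qed
  have f1: "(f has_vector_derivative f' x) (at x)" if "0 < x" for x
  proof -
    obtain B where "\<forall>y\<in>{x/2<..<x+1}. (f has_vector_derivative P' y + B) (at y)"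
      using loc[of "x/2" "x+1"] \<open>0 < x\<close> by auto
    then show ?thesis unfolding f'_def using that
      by (intro vector_derivative_works[THEN iffD1] differentiableI_vector) auto
  qed
  have f2: "(f' has_vector_derivative ?P2 x) (at x)" if "0 < x" for x
  proof -
    obtain B where B: "\<forall>y\<in>{x/2<..<x+1}. (f has_vector_derivative P' y + B) (at y)"
      using loc[of "x/2" "x+1"] \<open>0 < x\<close> by auto
    show ?thesis
    proof (rule has_vector_derivative_transform_within_open[of "\<lambda>x. P' x + B" _ _ "{x/2<..<x+1}"])
      show "((\<lambda>x. P' x + B) has_vector_derivative ?P2 x) (at x)"
        using has_vector_derivative_add[OF P'[OF that] has_vector_derivative_const[of B]] by simp
      show "P' y + B = f' y" if "y \<in> {x/2<..<x+1}" for y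
        unfolding f'_def using B that vector_derivative_at by metis
    qed (use that in auto)
  qed
  have cf': "continuous_on {0<..} f'"
    by (intro continuous_at_imp_continuous_on ballI has_vector_derivative_continuous[OF f2]) auto
  have w: "has_weak_deriv f f'" by (rule has_weak_deriv_classical[OF f1 cf'])
  have "AE x in lborel. 0 < x \<longrightarrow> f' x = g x"
    by (rule has_weak_deriv_unique[OF _ _ w g(2)])
      (simp_all add: continuous_imp_set_integrable[OF cf'] L2_half_set_integrable[OF g(1)])
  then have "f' \<in> L2_half"
    by (intro L2_half_cong_AE[OF g(1)] set_borel_measurable_halfline_continuous cf')
  then show ?thesis using that f1 f2 by blast
qed

text \<open>This supplies the eigenfunctions. As \<open>u\<close> is differentiable across 0, the
  function cut off at the vertex inherits its right-sided derivative there from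
  \<open>u'\<close>.\<close>

lemma decaying_classical_in_H2_half:
  fixes u u' u2 :: "real \<Rightarrow> real" and c :: complex
  assumes u: "\<And>x. (u has_real_derivative u' x) (at x)" "\<And>x. (u' has_real_derivative u2 x) (at x)"
    and c2: "continuous_on UNIV u2" and s: "0 < s"
    and b: "\<And>x. 0 \<le> x \<Longrightarrow> \<bar>u x\<bar> \<le> C * exp (- s * x)" "\<And>x. 0 \<le> x \<Longrightarrow> \<bar>u' x\<bar> \<le> C * exp (- s * x)"
      "\<And>x. 0 \<le> x \<Longrightarrow> \<bar>u2 x\<bar> \<le> C * exp (- s * x)"
  defines "F \<equiv> (\<lambda>x. if x < 0 then 0 else c * complex_of_real (u x))"
  shows "F \<in> H2_half" "AE x in lborel. 0 < x \<longrightarrow> weak_deriv (weak_deriv F) x = c * of_real (u2 x)"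
    "vector_derivative F (at_right 0) = c * of_real (u' 0)"
proof -
  have cu: "continuous_on UNIV u" "continuous_on UNIV u'"
    using DERIV_continuous_on[of UNIV u u'] DERIV_continuous_on[of UNIV u' u2] u by auto
  define D where "D k x = c * complex_of_real (k x)" for k :: "real \<Rightarrow> real" and x :: real
  have der: "(D k has_vector_derivative D k' x) (at x)" if "(k has_real_derivative k' x) (at x)" for k k' x
    unfolding D_def
    by (rule has_vector_derivative_mult_right[OF has_vector_derivative_of_real[OF that]])
  have contD: "continuous_on S (D k)" if "continuous_on UNIV k" for k S
    unfolding D_def by (intro continuous_intros continuous_on_subset[OF that]) auto
  have L2: "D k \<in> L2_half" if "continuous_on UNIV k" "\<And>x. 0 \<le> x \<Longrightarrow> \<bar>k x\<bar> \<le> C * exp (- s * x)" for k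
  proof (rule L2_half_exp_decay[OF contD[OF that(1)] _ s])
    show "cmod (D k x) \<le> cmod c * C * exp (- s * x)" if "0 < x" for x
      using mult_left_mono[OF \<open>\<And>x. 0 \<le> x \<Longrightarrow> \<bar>k x\<bar> \<le> C * exp (- s * x)\<close>[of x], of "cmod c"] that
      by (simp add: D_def norm_mult mult.assoc)
  qed
  have w: "has_weak_deriv F (D u')"
  proof (rule has_weak_deriv_classical)
    show "(F has_vector_derivative D u' x) (at x)" if "0 < x" for x
      by (rule has_vector_derivative_transform_within_open[OF der[OF u(1)], where S = "{0<..}"])
        (use that in \<open>auto simp: F_def D_def\<close>)
  qed (rule contD[OF cu(2)])
  have w': "has_weak_deriv (D u') (D u2)"
    by (rule has_weak_deriv_classical[OF der[OF u(2)] contD[OF c2]])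
  have LF: "F \<in> L2_half"
  proof (rule L2_half_cong_AE[OF L2[OF cu(1) b(1)]])
    have "continuous_on {0<..} F"
      by (rule continuous_on_eq[OF contD[OF cu(1)]]) (auto simp: F_def D_def)
    then show "set_borel_measurable lborel {0<..} F" by (rule set_borel_measurable_halfline_continuous)
  qed (auto simp: F_def D_def)
  have "continuous_on {0..} F"
    by (rule continuous_on_eq[OF contD[OF cu(1)]]) (auto simp: F_def D_def)
  then show "F \<in> H2_half"
    unfolding H2_half_def using LF w w' L2[OF cu(2) b(2)] L2[OF c2 b(3)] by (auto simp: F_def)
  show "AE x in lborel. 0 < x \<longrightarrow> weak_deriv (weak_deriv F) x = c * of_real (u2 x)"
    using weak_deriv2_works(3)[OF L2[OF cu(2) b(2)] w L2[OF c2 b(3)] w'] unfolding D_def .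
  have "(F has_vector_derivative D u' 0) (at_right 0)"
  proof (rule has_vector_derivative_within_subset)
    show "(F has_vector_derivative D u' 0) (at 0 within {0..})"
      by (rule has_vector_derivative_transform[OF _ _ has_vector_derivative_at_within[OF der[OF u(1)]]])
        (auto simp: F_def D_def)
  qed auto
  then show "vector_derivative F (at_right 0) = c * of_real (u' 0)"
    unfolding D_def by (intro vector_derivative_within) auto
qed

section \<open>The decaying solution\<close>

text \<open>The quotient of Pochhammer symbols (-\<nu>)_n (\<nu>+1)_n / ((1+s)_n n!).\<close>

primrec jost_coeff :: "real \<Rightarrow> real \<Rightarrow> nat \<Rightarrow> real" where
  "jost_coeff \<nu> s 0 = 1"
| "jost_coeff \<nu> s (Suc n) = jost_coeff \<nu> s n * ((real n - \<nu>) * (real n + 1 + \<nu>) / ((real n + 1 + s) * (real n + 1)))"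

text \<open>The series is ${}_2F_1(-\nu, \nu+1; 1+s; z)$. The parameter $s$ enters its coefficients only through
  the denominators, which makes the estimates uniform in $s \ge 0$; at $z = (1 - \tanh t)/2$ it gives the
  solution that behaves like $e^{-st}$ for $t \to \infty$.\<close>

definition jost_series :: "real \<Rightarrow> real \<Rightarrow> real \<Rightarrow> real" where
  "jost_series \<nu> s z = (\<Sum>n. jost_coeff \<nu> s n * z ^ n)"

definition jost_series' :: "real \<Rightarrow> real \<Rightarrow> real \<Rightarrow> real" where
  "jost_series' \<nu> s z = (\<Sum>n. diffs (jost_coeff \<nu> s) n * z ^ n)"

text \<open>Known in scattering theory as the Jost solution at plus infinity, here for the
  Poschl-Teller potential -\<nu>(\<nu>+1) sech^2 t at energy -s^2.\<close>

definition jost :: "real \<Rightarrow> real \<Rightarrow> real \<Rightarrow> real" where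
  "jost \<nu> s t = exp (- s * t) * jost_series \<nu> s ((1 - tanh t) / 2)"

text \<open>The chain rule with dz/dt = -(1 - tanh^2 t)/2, kept explicit so that continuity and
  bounds in \<open>s\<close> can be read off from the two series.\<close>

definition jost' :: "real \<Rightarrow> real \<Rightarrow> real \<Rightarrow> real" where
  "jost' \<nu> s t = exp (- s * t) * (- s * jost_series \<nu> s ((1 - tanh t) / 2)
     - (1 - (tanh t)\<^sup>2) / 2 * jost_series' \<nu> s ((1 - tanh t) / 2))"

abbreviation jost_potential :: "real \<Rightarrow> real \<Rightarrow> real \<Rightarrow> real" where
  "jost_potential \<nu> s t \<equiv> s\<^sup>2 - \<nu> * (\<nu> + 1) * (1 - (tanh t)\<^sup>2)"

abbreviation wronskian :: "real \<Rightarrow> real \<Rightarrow> real \<Rightarrow> real \<Rightarrow> real" where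
  "wronskian \<nu> s r t \<equiv> jost' \<nu> s t * jost \<nu> r t - jost \<nu> s t * jost' \<nu> r t"

lemma jost_coeff_factor_le:
  assumes "0 \<le> s"
  shows "\<bar>(real n - \<nu>) * (real n + 1 + \<nu>) / ((real n + 1 + s) * (real n + 1))\<bar> \<le>
         \<bar>(real n - \<nu>) * (real n + 1 + \<nu>) / ((real n + 1 + 0) * (real n + 1))\<bar>"
  unfolding abs_divide using assms
  by (intro divide_left_mono mult_pos_pos) (auto simp: abs_mult intro!: mult_right_mono)

lemma jost_coeff_le:
  assumes "0 \<le> s"
  shows "\<bar>jost_coeff \<nu> s n\<bar> \<le> \<bar>jost_coeff \<nu> 0 n\<bar>"
proof (induction n)
  case (Suc n)
  show ?case unfolding jost_coeff.simps abs_mult[of "jost_coeff \<nu> _ _"]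
    by (rule mult_mono[OF Suc jost_coeff_factor_le[OF assms]]) auto
qed simp

text \<open>Every coefficient except the one of index 0 carries the factor 1/(1+s) of the first step
  of the recursion; this makes the series tend to 1 for large s.\<close>

lemma jost_coeff_Suc_le:
  assumes "0 \<le> s"
  shows "\<bar>jost_coeff \<nu> s (Suc n)\<bar> \<le> \<bar>jost_coeff \<nu> 0 (Suc n)\<bar> / (1 + s)"
proof (induction n)
  case 0
  then show ?case using assms by (simp add: abs_mult abs_divide)
next
  case (Suc n)
  have "\<bar>jost_coeff \<nu> s (Suc (Suc n))\<bar> = \<bar>jost_coeff \<nu> s (Suc n)\<bar> *
      \<bar>(real (Suc n) - \<nu>) * (real (Suc n) + 1 + \<nu>) / ((real (Suc n) + 1 + s) * (real (Suc n) + 1))\<bar>"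
    by (simp only: jost_coeff.simps(2)[of \<nu> s "Suc n"] abs_mult[of "jost_coeff \<nu> s (Suc n)"])
  also have "\<dots> \<le> \<bar>jost_coeff \<nu> 0 (Suc n)\<bar> / (1 + s) *
      \<bar>(real (Suc n) - \<nu>) * (real (Suc n) + 1 + \<nu>) / ((real (Suc n) + 1 + 0) * (real (Suc n) + 1))\<bar>"
    by (rule mult_mono[OF Suc jost_coeff_factor_le[OF assms]]) (use assms in auto)
  also have "\<dots> = \<bar>jost_coeff \<nu> 0 (Suc (Suc n))\<bar> / (1 + s)"
    by (simp only: jost_coeff.simps(2)[of \<nu> 0 "Suc n"] abs_mult[of "jost_coeff \<nu> 0 (Suc n)"] times_divide_eq_left)
  finally show ?case .
qed

text \<open>For $n \ge \nu$ the ratio of consecutive coefficients is at most $1$ in absolute value.\<close>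

lemma jost_coeff_bounded:
  assumes "0 \<le> \<nu>"
  obtains C where "0 \<le> C" "\<And>s n. 0 \<le> s \<Longrightarrow> \<bar>jost_coeff \<nu> s n\<bar> \<le> C"
    "\<And>s n. 0 \<le> s \<Longrightarrow> \<bar>jost_coeff \<nu> s (Suc n)\<bar> \<le> C / (1 + s)"
proof -
  obtain m where m: "\<nu> \<le> real m" using real_arch_simple by blast
  have ge: "\<bar>jost_coeff \<nu> 0 n\<bar> \<le> \<bar>jost_coeff \<nu> 0 m\<bar>" if "m \<le> n" for n
    using that
  proof (induction n rule: dec_induct)
    case (step n)
    have "\<nu> \<le> real n" using m step by linarith
    then have "0 \<le> (real n - \<nu>) * (real n + 1 + \<nu>)" using assms by simp
    moreover have "(real n - \<nu>) * (real n + 1 + \<nu>) \<le> (real n + 1 + 0) * (real n + 1)"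
      using assms by (simp add: algebra_simps)
    ultimately have "\<bar>(real n - \<nu>) * (real n + 1 + \<nu>) / ((real n + 1 + 0) * (real n + 1))\<bar> \<le> 1"
      by (subst abs_of_nonneg) (auto simp: divide_le_eq_1 intro: divide_nonneg_pos)
    then have "\<bar>jost_coeff \<nu> 0 (Suc n)\<bar> \<le> \<bar>jost_coeff \<nu> 0 n\<bar>"
      unfolding jost_coeff.simps abs_mult[of "jost_coeff \<nu> _ _"] by (rule mult_right_le_one_le[rotated 2]) auto
    then show ?case using step by linarith
  qed simp
  define C where "C = (\<Sum>k\<le>m. \<bar>jost_coeff \<nu> 0 k\<bar>)"
  have le: "\<bar>jost_coeff \<nu> 0 n\<bar> \<le> C" for n
  proof -
    have "\<bar>jost_coeff \<nu> 0 (min n m)\<bar> \<le> C"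
      unfolding C_def by (rule member_le_sum) auto
    then show ?thesis using ge[of n] by (cases "n \<le> m") (auto simp: min_def)
  qed
  show ?thesis
  proof (rule that[of C])
    show "0 \<le> C" unfolding C_def by (intro sum_nonneg) auto
    show "\<bar>jost_coeff \<nu> s n\<bar> \<le> C" if "0 \<le> s" for s n
      using jost_coeff_le[OF that] le order_trans by blast
    show "\<bar>jost_coeff \<nu> s (Suc n)\<bar> \<le> C / (1 + s)" if "0 \<le> s" for s n
      by (rule order_trans[OF jost_coeff_Suc_le[OF that] divide_right_mono[OF le]]) (use that in simp)
  qed
qed

lemma jost_series_summable:
  assumes "0 \<le> \<nu>" "0 \<le> s" "\<bar>z\<bar> < 1"
  shows "summable (\<lambda>n. jost_coeff \<nu> s n * z ^ n)"
proof -
  obtain C where C: "0 \<le> C" "\<And>s n. 0 \<le> s \<Longrightarrow> \<bar>jost_coeff \<nu> s n\<bar> \<le> C" using jost_coeff_bounded[OF assms(1)] by metis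
  show ?thesis
  proof (rule summable_comparison_test)
    show "\<exists>N. \<forall>n\<ge>N. norm (jost_coeff \<nu> s n * z ^ n) \<le> C * \<bar>z\<bar> ^ n"
      using C(2)[OF assms(2)] by (auto simp: abs_mult power_abs intro!: mult_right_mono exI[of _ 0])
    show "summable (\<lambda>n. C * \<bar>z\<bar> ^ n)" using assms(3) by (intro summable_mult summable_geometric) auto
  qed
qed

lemma jost_series_deriv:
  assumes "0 \<le> \<nu>" "0 \<le> s" "\<bar>z\<bar> < 1"
  shows "(jost_series \<nu> s has_real_derivative jost_series' \<nu> s z) (at z)"
  unfolding jost_series_def[abs_def] jost_series'_def
  by (rule termdiffs_strong'[of 1]) (use assms jost_series_summable in auto)

text \<open>Compared coefficient by coefficient, the hypergeometric equation is the recursion of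
  \<open>jost_coeff\<close>.\<close>

lemma jost_series_ode:
  assumes \<nu>: "0 \<le> \<nu>" and s: "0 \<le> s" and z: "\<bar>z\<bar> < 1"
  obtains G2 where "(jost_series' \<nu> s has_real_derivative G2) (at z)"
    "z * (1 - z) * G2 + (1 + s - 2 * z) * jost_series' \<nu> s z + \<nu> * (\<nu> + 1) * jost_series \<nu> s z = 0"
proof -
  let ?a = "jost_coeff \<nu> s"
  have s0: "summable (\<lambda>n. ?a n * x ^ n)" if "norm x < 1" for x
    using jost_series_summable[OF \<nu> s] that by simp
  have s1: "summable (\<lambda>n. diffs ?a n * x ^ n)" if "norm x < 1" for x
    by (rule termdiff_converges[OF that]) (rule s0)
  have s2: "summable (\<lambda>n. diffs (diffs ?a) n * x ^ n)" if "norm x < 1" for x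
    by (rule termdiff_converges[OF that]) (rule s1)
  define G2 where "G2 = (\<Sum>n. diffs (diffs ?a) n * z ^ n)"
  have z': "norm z < 1" using z by simp
  have d: "(jost_series' \<nu> s has_real_derivative G2) (at z)"
    unfolding jost_series'_def[abs_def] G2_def by (rule termdiffs_strong'[OF s1 z'])
  have S0: "(\<lambda>n. ?a n * z ^ n) sums jost_series \<nu> s z"
    unfolding jost_series_def by (rule summable_sums[OF s0[OF z']])
  have S1: "(\<lambda>n. diffs ?a n * z ^ n) sums jost_series' \<nu> s z"
    unfolding jost_series'_def by (rule summable_sums[OF s1[OF z']])
  have S2: "(\<lambda>n. diffs (diffs ?a) n * z ^ n) sums G2"
    unfolding G2_def by (rule summable_sums[OF s2[OF z']])
  \<comment> \<open>Multiplication by z moves the coefficients up by one index; the new entry at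
    index 0 is zero because of the factor n.\<close>
  have shift: "f sums L" if "(\<lambda>n. f (Suc n)) sums L" "f 0 = 0" for f :: "nat \<Rightarrow> real" and L
    using sums_Suc[OF that(1)] that(2) by simp
  have A1: "(\<lambda>n. real n * ?a n * z ^ n) sums (z * jost_series' \<nu> s z)"
    by (rule shift) (use sums_mult[OF S1, of z] in \<open>simp_all add: diffs_def algebra_simps del: jost_coeff.simps\<close>)
  have A2: "(\<lambda>n. real n * (real n + 1) * ?a (Suc n) * z ^ n) sums (z * G2)"
    by (rule shift) (use sums_mult[OF S2, of z] in \<open>simp_all add: diffs_def algebra_simps del: jost_coeff.simps\<close>)
  have A3: "(\<lambda>n. real n * (real n - 1) * ?a n * z ^ n) sums (z * (z * G2))"
    by (rule shift) (use sums_mult[OF A2, of z] in \<open>simp_all add: algebra_simps del: jost_coeff.simps\<close>)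
  have "(\<lambda>n. real n * (real n + 1) * ?a (Suc n) * z ^ n - real n * (real n - 1) * ?a n * z ^ n
      + (1 + s) * (diffs ?a n * z ^ n) - 2 * (real n * ?a n * z ^ n) + \<nu> * (\<nu> + 1) * (?a n * z ^ n))
    sums (z * G2 - z * (z * G2) + (1 + s) * jost_series' \<nu> s z - 2 * (z * jost_series' \<nu> s z)
      + \<nu> * (\<nu> + 1) * jost_series \<nu> s z)"
    by (intro sums_add sums_diff sums_mult A1 A2 A3 S0 S1)
  moreover have "real n * (real n + 1) * ?a (Suc n) * z ^ n - real n * (real n - 1) * ?a n * z ^ n
      + (1 + s) * (diffs ?a n * z ^ n) - 2 * (real n * ?a n * z ^ n) + \<nu> * (\<nu> + 1) * (?a n * z ^ n) = 0" for n
  proof -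
    have pos: "real n + 1 + s > 0" "real n + 1 > 0" using s by auto
    have "?a (Suc n) * ((real n + 1 + s) * (real n + 1)) = ?a n * ((real n - \<nu>) * (real n + 1 + \<nu>))"
      using pos by simp
    then have "(?a (Suc n) * ((real n + 1 + s) * (real n + 1)) - ?a n * ((real n - \<nu>) * (real n + 1 + \<nu>))) * z ^ n = 0"
      by simp
    then show ?thesis by (simp add: diffs_def algebra_simps del: jost_coeff.simps)
  qed
  ultimately have "z * G2 - z * (z * G2) + (1 + s) * jost_series' \<nu> s z - 2 * (z * jost_series' \<nu> s z)
      + \<nu> * (\<nu> + 1) * jost_series \<nu> s z = 0"
    using sums_unique2[OF _ sums_zero] by simp
  then have "z * (1 - z) * G2 + (1 + s - 2 * z) * jost_series' \<nu> s z + \<nu> * (\<nu> + 1) * jost_series \<nu> s z = 0"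
    by (simp add: algebra_simps)
  with d show ?thesis by (rule that)
qed

lemma jost_arg_bounds:
  fixes t :: real
  shows "0 < (1 - tanh t) / 2" "(1 - tanh t) / 2 < 1" "\<bar>(1 - tanh t) / 2\<bar> < 1"
  using tanh_real_bounds[of t] by auto

lemma half_sech_square_le: "\<bar>(1 - (tanh (t::real))\<^sup>2) / 2\<bar> \<le> 1"
proof -
  have *: "\<bar>(1 - x) / 2\<bar> \<le> 1" if "0 \<le> x" "x < 1" for x :: real using that by simp
  show ?thesis
    by (rule *[OF zero_le_power2]) (use tanh_real_bounds[of t] in \<open>auto simp: abs_square_less_1\<close>)
qed

text \<open>For z = (1 - tanh t)/2 one has z (1 - z) = (1 - tanh^2 t)/4 and 1 + s - 2z = s + tanh t.
  Multiplied by 1 - tanh^2 t, the hypergeometric equation then eliminates the second derivative of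
  the series from that of the solution.\<close>

lemma
  assumes \<nu>: "0 \<le> \<nu>" and s: "0 \<le> s"
  shows jost_deriv: "(jost \<nu> s has_real_derivative jost' \<nu> s t) (at t)"
    and jost'_deriv: "(jost' \<nu> s has_real_derivative jost_potential \<nu> s t * jost \<nu> s t) (at t)"
proof -
  let ?z = "\<lambda>t::real. (1 - tanh t) / 2"
  obtain G2 where d2: "(jost_series' \<nu> s has_real_derivative G2) (at (?z t))"
    and ode: "?z t * (1 - ?z t) * G2 + (1 + s - 2 * ?z t) * jost_series' \<nu> s (?z t) + \<nu> * (\<nu> + 1) * jost_series \<nu> s (?z t) = 0"
    using jost_series_ode[OF \<nu> s jost_arg_bounds(3)] .
  have dz: "(?z has_real_derivative - (1 - (tanh t)\<^sup>2) / 2) (at t)"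
    by (auto intro!: derivative_eq_intros)
  note d0 = DERIV_chain2[OF jost_series_deriv[OF \<nu> s jost_arg_bounds(3)] dz]
  note d1 = DERIV_chain2[OF d2 dz]
  show "(jost \<nu> s has_real_derivative jost' \<nu> s t) (at t)"
    unfolding jost_def[abs_def] jost'_def
    by (auto intro!: derivative_eq_intros d0 simp: field_simps)
  let ?\<tau> = "tanh t"
  have "(1 - ?\<tau>\<^sup>2) / 4 * G2 + (s + ?\<tau>) * jost_series' \<nu> s (?z t) + \<nu> * (\<nu> + 1) * jost_series \<nu> s (?z t) = 0"
    using ode by (simp add: power2_eq_square field_simps)
  then have "(1 - ?\<tau>\<^sup>2) * ((1 - ?\<tau>\<^sup>2) / 4 * G2 + (s + ?\<tau>) * jost_series' \<nu> s (?z t) + \<nu> * (\<nu> + 1) * jost_series \<nu> s (?z t)) = 0"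
    by simp
  then have eq: "(1 - ?\<tau>\<^sup>2)\<^sup>2 / 4 * G2 = - ((1 - ?\<tau>\<^sup>2) * ((s + ?\<tau>) * jost_series' \<nu> s (?z t) + \<nu> * (\<nu> + 1) * jost_series \<nu> s (?z t)))"
    by (simp add: algebra_simps power2_eq_square)
  show "(jost' \<nu> s has_real_derivative jost_potential \<nu> s t * jost \<nu> s t) (at t)"
  proof -
    have "(jost' \<nu> s has_real_derivative - s * exp (- s * t) * (- s * jost_series \<nu> s (?z t)
        - (1 - ?\<tau>\<^sup>2) / 2 * jost_series' \<nu> s (?z t)) + exp (- s * t) * (- s * (jost_series' \<nu> s (?z t) * (- (1 - ?\<tau>\<^sup>2) / 2))
        - (- (?\<tau> * (1 - ?\<tau>\<^sup>2)) * jost_series' \<nu> s (?z t) + (1 - ?\<tau>\<^sup>2) / 2 * (G2 * (- (1 - ?\<tau>\<^sup>2) / 2))))) (at t)"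
      unfolding jost'_def[abs_def]
      by (auto intro!: derivative_eq_intros d0 d1 simp: field_simps)
    moreover have "- s * exp (- s * t) * (- s * jost_series \<nu> s (?z t)
        - (1 - ?\<tau>\<^sup>2) / 2 * jost_series' \<nu> s (?z t)) + exp (- s * t) * (- s * (jost_series' \<nu> s (?z t) * (- (1 - ?\<tau>\<^sup>2) / 2))
        - (- (?\<tau> * (1 - ?\<tau>\<^sup>2)) * jost_series' \<nu> s (?z t) + (1 - ?\<tau>\<^sup>2) / 2 * (G2 * (- (1 - ?\<tau>\<^sup>2) / 2))))
      = exp (- s * t) * (s\<^sup>2 * jost_series \<nu> s (?z t) + (1 - ?\<tau>\<^sup>2) * (s + ?\<tau>) * jost_series' \<nu> s (?z t) + (1 - ?\<tau>\<^sup>2)\<^sup>2 / 4 * G2)"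
      by (simp add: field_simps power2_eq_square)
    moreover have "\<dots> = jost_potential \<nu> s t * jost \<nu> s t"
      unfolding eq jost_def by (simp add: algebra_simps)
    ultimately show ?thesis by simp
  qed
qed

text \<open>For t \<ge> t0 the argument of the two series stays in the compact interval
  [0, (1 - tanh t0)/2] inside the disc of convergence, so both are bounded.\<close>

lemma jost_decay:
  assumes \<nu>: "0 \<le> \<nu>" and s: "0 \<le> s"
  obtains C where "\<And>t. t0 \<le> t \<Longrightarrow> \<bar>jost \<nu> s t\<bar> \<le> C * exp (- s * t)"
    "\<And>t. t0 \<le> t \<Longrightarrow> \<bar>jost' \<nu> s t\<bar> \<le> C * exp (- s * t)"
proof -
  let ?z = "\<lambda>t::real. (1 - tanh t) / 2"
  have "continuous_on {0..?z t0} (jost_series \<nu> s)"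
    by (intro continuous_at_imp_continuous_on ballI DERIV_isCont[OF jost_series_deriv[OF \<nu> s]])
      (use jost_arg_bounds(2)[of t0] in auto)
  then have "bounded (jost_series \<nu> s ` {0..?z t0})"
    by (intro compact_imp_bounded compact_continuous_image) auto
  then obtain A where A: "\<forall>x\<in>jost_series \<nu> s ` {0..?z t0}. \<bar>x\<bar> \<le> A" unfolding bounded_real by blast
  have "isCont (jost_series' \<nu> s) x" if "x \<in> {0..?z t0}" for x
  proof -
    have "\<bar>x\<bar> < 1" using that jost_arg_bounds(2)[of t0] by auto
    from jost_series_ode[OF \<nu> s this] show ?thesis using DERIV_isCont by metis
  qed
  then have "bounded (jost_series' \<nu> s ` {0..?z t0})"
    by (intro compact_imp_bounded compact_continuous_image continuous_at_imp_continuous_on) auto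
  then obtain B where B: "\<forall>x\<in>jost_series' \<nu> s ` {0..?z t0}. \<bar>x\<bar> \<le> B" unfolding bounded_real by blast
  have bd: "\<bar>jost_series \<nu> s (?z t)\<bar> \<le> A" "\<bar>jost_series' \<nu> s (?z t)\<bar> \<le> B" if "t0 \<le> t" for t
  proof -
    have "?z t \<in> {0..?z t0}" using that jost_arg_bounds(1)[of t] by (simp add: tanh_real_le_iff)
    then show "\<bar>jost_series \<nu> s (?z t)\<bar> \<le> A" "\<bar>jost_series' \<nu> s (?z t)\<bar> \<le> B" using A B by blast+
  qed
  show ?thesis
  proof (rule that[of "max A (s * A + B)"])
    fix t assume t: "t0 \<le> t"
    have "\<bar>jost \<nu> s t\<bar> = \<bar>jost_series \<nu> s (?z t)\<bar> * exp (- s * t)"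
      by (simp add: jost_def abs_mult)
    also have "\<dots> \<le> max A (s * A + B) * exp (- s * t)"
      by (rule mult_right_mono) (use bd(1)[OF t] in auto)
    finally show "\<bar>jost \<nu> s t\<bar> \<le> max A (s * A + B) * exp (- s * t)" .
    from half_sech_square_le[of t] have 1: "\<bar>(1 - (tanh t)\<^sup>2) / 2 * jost_series' \<nu> s (?z t)\<bar> \<le> 1 * B"
      unfolding abs_mult by (rule mult_mono) (use bd(2)[OF t] in auto)
    have 2: "\<bar>- s * jost_series \<nu> s (?z t)\<bar> \<le> s * A"
      using bd(1)[OF t] s by (simp add: abs_mult mult_left_mono)
    have "\<bar>jost' \<nu> s t\<bar> = \<bar>- s * jost_series \<nu> s (?z t) - (1 - (tanh t)\<^sup>2) / 2 * jost_series' \<nu> s (?z t)\<bar> * exp (- s * t)"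
      unfolding jost'_def abs_mult by (simp only: abs_exp_cancel mult.commute)
    also have "\<dots> \<le> max A (s * A + B) * exp (- s * t)"
      using 1 2 by (intro mult_right_mono) (linarith, simp)
    finally show "\<bar>jost' \<nu> s t\<bar> \<le> max A (s * A + B) * exp (- s * t)" .
  qed
qed

lemma jost_eventually_pos:
  assumes \<nu>: "0 \<le> \<nu>" and s: "0 \<le> s"
  shows "\<forall>\<^sub>F t in at_top. 0 < jost \<nu> s t"
proof -
  have "((\<lambda>t::real. (1 - tanh t) / 2) \<longlongrightarrow> (1 - 1) / 2) at_top"
    by (intro tendsto_intros tanh_real_at_top) auto
  then have z: "((\<lambda>t::real. (1 - tanh t) / 2) \<longlongrightarrow> 0) at_top" by simp
  have "isCont (jost_series \<nu> s) 0" by (rule DERIV_isCont[OF jost_series_deriv[OF \<nu> s]]) simp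
  moreover have "jost_series \<nu> s 0 = 1" by (simp add: jost_series_def)
  ultimately have "((\<lambda>t. jost_series \<nu> s ((1 - tanh t) / 2)) \<longlongrightarrow> 1) at_top"
    using isCont_tendsto_compose[OF _ z] by metis
  then have "\<forall>\<^sub>F t in at_top. 0 < jost_series \<nu> s ((1 - tanh t) / 2)"
    by (rule order_tendstoD) simp
  then show ?thesis by eventually_elim (simp add: jost_def)
qed

section \<open>Dependence on the spectral parameter\<close>

lemma continuous_on_jost_coeff: "continuous_on {0..} (\<lambda>s. jost_coeff \<nu> s n)"
proof (induction n)
  case (Suc n)
  have "(real n + 1 + s) * (real n + 1) \<noteq> 0" if "s \<in> {0..}" for s using that by auto
  then show ?case unfolding jost_coeff.simps by (intro continuous_intros Suc) blast
qed simp

lemma summable_Suc_power: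
  fixes z :: real
  assumes "\<bar>z\<bar> < 1"
  shows "summable (\<lambda>n. real (Suc n) * z ^ n)"
proof -
  have "summable (\<lambda>n. diffs (\<lambda>n. 1) n * z ^ n)"
    by (rule termdiff_converges[of z 1]) (use assms in auto)
  then show ?thesis by (simp add: diffs_def)
qed

text \<open>The bound on the coefficients is independent of s, so for fixed t the Weierstrass test
  gives convergence uniformly in s \<ge> 0.\<close>

lemma continuous_on_jost_parameter:
  assumes \<nu>: "0 \<le> \<nu>"
  shows "continuous_on {0..} (\<lambda>s. jost \<nu> s t)" "continuous_on {0..} (\<lambda>s. jost' \<nu> s t)"
proof -
  define z where "z = (1 - tanh t) / 2"
  have z: "0 < z" "z < 1" "\<bar>z\<bar> < 1" unfolding z_def using jost_arg_bounds by auto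
  obtain C where C: "0 \<le> C" "\<And>s n. 0 \<le> s \<Longrightarrow> \<bar>jost_coeff \<nu> s n\<bar> \<le> C" using jost_coeff_bounded[OF \<nu>] by metis
  have "uniform_limit {0..} (\<lambda>n s. \<Sum>i<n. jost_coeff \<nu> s i * z ^ i) (\<lambda>s. jost_series \<nu> s z) sequentially"
    unfolding jost_series_def
  proof (rule Weierstrass_m_test)
    show "norm (jost_coeff \<nu> s n * z ^ n) \<le> C * z ^ n" if "s \<in> {0..}" for s n
      using C(2)[of s n] that z unfolding real_norm_def abs_mult power_abs by (intro mult_mono) auto
    show "summable (\<lambda>n. C * z ^ n)" using z by (intro summable_mult summable_geometric) auto
  qed
  then have c0: "continuous_on {0..} (\<lambda>s. jost_series \<nu> s z)"
    by (rule uniform_limit_theorem[rotated])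
      (auto intro!: always_eventually continuous_intros continuous_on_jost_coeff)
  have "uniform_limit {0..} (\<lambda>n s. \<Sum>i<n. diffs (jost_coeff \<nu> s) i * z ^ i) (\<lambda>s. jost_series' \<nu> s z) sequentially"
    unfolding jost_series'_def
  proof (rule Weierstrass_m_test)
    show "norm (diffs (jost_coeff \<nu> s) n * z ^ n) \<le> C * (real (Suc n) * z ^ n)" if "s \<in> {0..}" for s n
    proof -
      have "norm (diffs (jost_coeff \<nu> s) n * z ^ n) = \<bar>jost_coeff \<nu> s (Suc n)\<bar> * (real (Suc n) * z ^ n)"
        using z(3) z(1) unfolding diffs_def real_norm_def abs_mult power_abs
        by (simp add: mult_ac del: jost_coeff.simps)
      also have "\<dots> \<le> C * (real (Suc n) * z ^ n)"
        using C(2)[of s "Suc n"] that z by (intro mult_right_mono) auto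
      finally show ?thesis .
    qed
    show "summable (\<lambda>n. C * (real (Suc n) * z ^ n))" by (intro summable_mult summable_Suc_power z)
  qed
  then have c1: "continuous_on {0..} (\<lambda>s. jost_series' \<nu> s z)"
    by (rule uniform_limit_theorem[rotated])
      (auto intro!: always_eventually continuous_intros continuous_on_jost_coeff simp: diffs_def simp del: jost_coeff.simps)
  show "continuous_on {0..} (\<lambda>s. jost \<nu> s t)" "continuous_on {0..} (\<lambda>s. jost' \<nu> s t)"
    unfolding jost_def jost'_def z_def[symmetric] by (intro continuous_intros c0 c1)+
qed

text \<open>All terms beyond the first are of order 1/(1+s), so the solution is close to e^(-st) at
  fixed t. The bound pushes its logarithmic derivative to -infinity as s grows.\<close>

lemma jost_large_parameter:
  assumes \<nu>: "0 \<le> \<nu>"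
  obtains S where "\<And>s. S \<le> s \<Longrightarrow> 0 < jost \<nu> s t" "\<And>s. S \<le> s \<Longrightarrow> jost' \<nu> s t \<le> (1 - s) * jost \<nu> s t"
proof -
  define z where "z = (1 - tanh t) / 2"
  have z: "0 < z" "z < 1" "\<bar>z\<bar> < 1" unfolding z_def using jost_arg_bounds by auto
  obtain C where C: "0 \<le> C" "\<And>s n. 0 \<le> s \<Longrightarrow> \<bar>jost_coeff \<nu> s (Suc n)\<bar> \<le> C / (1 + s)"
    using jost_coeff_bounded[OF \<nu>] by metis
  define A where "A = (\<Sum>n. C * (real (Suc n) * z ^ n))"
  have sA: "summable (\<lambda>n. C * (real (Suc n) * z ^ n))" by (intro summable_mult summable_Suc_power z)
  have A0: "0 \<le> A" unfolding A_def by (rule suminf_nonneg[OF sA]) (use C z in auto)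
  have b1: "\<bar>jost_series' \<nu> s z\<bar> \<le> A / (1 + s)" if s: "0 \<le> s" for s
  proof -
    have "norm (\<Sum>n. diffs (jost_coeff \<nu> s) n * z ^ n) \<le> (\<Sum>n. C * (real (Suc n) * z ^ n) / (1 + s))"
    proof (rule norm_suminf_le)
      show "norm (diffs (jost_coeff \<nu> s) n * z ^ n) \<le> C * (real (Suc n) * z ^ n) / (1 + s)" for n
      proof -
        have "norm (diffs (jost_coeff \<nu> s) n * z ^ n) = \<bar>jost_coeff \<nu> s (Suc n)\<bar> * (real (Suc n) * z ^ n)"
          using z(3) z(1) unfolding diffs_def real_norm_def abs_mult power_abs
          by (simp add: mult_ac del: jost_coeff.simps)
        also have "\<dots> \<le> C / (1 + s) * (real (Suc n) * z ^ n)"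
          using C(2)[OF s, of n] z by (intro mult_right_mono) auto
        finally show ?thesis by simp
      qed
    qed (intro summable_divide sA)
    also have "\<dots> = A / (1 + s)" unfolding A_def by (rule suminf_divide[OF sA])
    finally show ?thesis by (simp add: jost_series'_def)
  qed
  have b0: "\<bar>jost_series \<nu> s z - 1\<bar> \<le> A / (1 + s)" if s: "0 \<le> s" for s
  proof -
    have "jost_series \<nu> s z = (\<Sum>n. jost_coeff \<nu> s (Suc n) * z ^ Suc n) + 1"
      unfolding jost_series_def
      using suminf_split_head[OF jost_series_summable[OF \<nu> s z(3)]] by simp
    then have "\<bar>jost_series \<nu> s z - 1\<bar> = norm (\<Sum>n. jost_coeff \<nu> s (Suc n) * z ^ Suc n)" by simp
    also have "\<dots> \<le> (\<Sum>n. C * (real (Suc n) * z ^ n) / (1 + s))"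
    proof (rule norm_suminf_le)
      show "norm (jost_coeff \<nu> s (Suc n) * z ^ Suc n) \<le> C * (real (Suc n) * z ^ n) / (1 + s)" for n
      proof -
        have "norm (jost_coeff \<nu> s (Suc n) * z ^ Suc n) = \<bar>jost_coeff \<nu> s (Suc n)\<bar> * (z * z ^ n)"
          using z(1) z(3) by (simp add: abs_mult power_abs del: jost_coeff.simps)
        also have "\<dots> \<le> C / (1 + s) * (real (Suc n) * z ^ n)"
          using C(2)[OF s, of n] z C(1) s by (intro mult_mono mult_right_mono) auto
        finally show ?thesis by simp
      qed
    qed (intro summable_divide sA)
    also have "\<dots> = A / (1 + s)" unfolding A_def by (rule suminf_divide[OF sA])
    finally show ?thesis .
  qed
  \<comment> \<open>From 2 A \<le> s on, both error terms are at most 1/2. The remaining 1/2 from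
    the derivative is then absorbed by the series, which is at least 1/2; this costs the 1 in 1 -
    s.\<close>
  have half: "jost_series \<nu> s z \<ge> 1/2 \<and> \<bar>jost_series' \<nu> s z\<bar> \<le> 1/2" if "2 * A \<le> s" for s
  proof -
    have s: "0 \<le> s" using that A0 by linarith
    then have "A / (1 + s) \<le> 1/2" using that by (simp add: field_simps)
    then show ?thesis using b0[OF s] b1[OF s] by linarith
  qed
  show ?thesis
  proof (rule that[of "2 * A"])
    fix s assume s: "2 * A \<le> s"
    show "0 < jost \<nu> s t" using half[OF s] by (auto simp: jost_def z_def[symmetric])
    from half_sech_square_le[of t] have "\<bar>(1 - (tanh t)\<^sup>2) / 2 * jost_series' \<nu> s z\<bar> \<le> 1 * (1/2)"
      unfolding abs_mult by (rule mult_mono) (use half[OF s] in auto)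
    then have "- s * jost_series \<nu> s z - (1 - (tanh t)\<^sup>2) / 2 * jost_series' \<nu> s z \<le> (1 - s) * jost_series \<nu> s z"
      using half[OF s] unfolding left_diff_distrib mult_1 mult_minus_left by linarith
    then have "exp (- s * t) * (- s * jost_series \<nu> s z - (1 - (tanh t)\<^sup>2) / 2 * jost_series' \<nu> s z) \<le> exp (- s * t) * ((1 - s) * jost_series \<nu> s z)"
      by (rule mult_left_mono) simp
    then show "jost' \<nu> s t \<le> (1 - s) * jost \<nu> s t"
      by (simp add: jost'_def jost_def z_def[symmetric] mult_ac)
  qed
qed

section \<open>Wronskians and Sturm comparison\<close>

text \<open>With $E = u^2 + u'^2$ and $\lvert q\rvert \le M$ one has $\lvert E'\rvert \le (1+M)E$.\<close>

lemma linear_ode_unique: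
  fixes u u' q :: "real \<Rightarrow> real"
  assumes u: "\<And>x. x \<in> {a..b} \<Longrightarrow> (u has_real_derivative u' x) (at x)"
      "\<And>x. x \<in> {a..b} \<Longrightarrow> (u' has_real_derivative q x * u x) (at x)"
    and q: "\<And>x. x \<in> {a..b} \<Longrightarrow> \<bar>q x\<bar> \<le> M"
    and c: "c \<in> {a..b}" "u c = 0" "u' c = 0" and x: "x \<in> {a..b}"
  shows "u x = 0" "u' x = 0"
proof -
  define E where "E y = (u y)\<^sup>2 + (u' y)\<^sup>2" for y
  define E' where "E' y = 2 * (1 + q y) * u y * u' y" for y
  have dE: "(E has_real_derivative E' y) (at y)" if "y \<in> {a..b}" for y
    unfolding E_def[abs_def] E'_def
    by (auto intro!: derivative_eq_intros u[OF that] simp: algebra_simps)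
  have bE: "\<bar>E' y\<bar> \<le> (1 + M) * E y" if "y \<in> {a..b}" for y
  proof -
    have 1: "\<bar>1 + q y\<bar> \<le> 1 + M" using q[OF that] by linarith
    have 2: "\<bar>2 * u y * u' y\<bar> \<le> E y"
      using sum_squares_bound[of "\<bar>u y\<bar>" "\<bar>u' y\<bar>"] by (simp add: E_def abs_mult)
    have "\<bar>E' y\<bar> = \<bar>1 + q y\<bar> * \<bar>2 * u y * u' y\<bar>"
      unfolding E'_def abs_mult[symmetric] by (rule arg_cong[of _ _ abs]) (simp add: mult_ac)
    also have "\<dots> \<le> (1 + M) * E y" using 1 2 by (intro mult_mono) auto
    finally show ?thesis .
  qed
  have E0: "E c = 0" using c by (simp add: E_def)
  have Epos: "E y \<ge> 0" for y by (simp add: E_def)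
  define k where "k = 1 + M"
  have "E x \<le> 0"
  proof (cases "c \<le> x")
    case True
    have "E x * exp (- k * x) \<le> E c * exp (- k * c)"
    proof (rule DERIV_nonpos_imp_nonincreasing[OF True])
      fix y assume "c \<le> y" "y \<le> x"
      then have y: "y \<in> {a..b}" using c x by auto
      have "((\<lambda>y. E y * exp (- k * y)) has_real_derivative (E' y - k * E y) * exp (- k * y)) (at y)"
        by (auto intro!: derivative_eq_intros dE[OF y] simp: algebra_simps)
      moreover have "(E' y - k * E y) * exp (- k * y) \<le> 0"
        using bE[OF y] by (intro mult_nonpos_nonneg) (auto simp: k_def)
      ultimately show "\<exists>z. ((\<lambda>y. E y * exp (- k * y)) has_real_derivative z) (at y) \<and> z \<le> 0" by blast
    qed
    then show ?thesis using E0 by (simp add: mult_le_0_iff)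
  next
    case False
    then have xx: "x \<le> c" by simp
    have "E x * exp (k * x) \<le> E c * exp (k * c)"
    proof (rule DERIV_nonneg_imp_nondecreasing[OF xx])
      fix y assume "x \<le> y" "y \<le> c"
      then have y: "y \<in> {a..b}" using c x by auto
      have "((\<lambda>y. E y * exp (k * y)) has_real_derivative (E' y + k * E y) * exp (k * y)) (at y)"
        by (auto intro!: derivative_eq_intros dE[OF y] simp: algebra_simps)
      moreover have "0 \<le> (E' y + k * E y) * exp (k * y)"
        using bE[OF y] by (intro mult_nonneg_nonneg) (auto simp: k_def)
      ultimately show "\<exists>z. ((\<lambda>y. E y * exp (k * y)) has_real_derivative z) (at y) \<and> 0 \<le> z" by blast
    qed
    then show ?thesis using E0 by (simp add: mult_le_0_iff)
  qed
  then show "u x = 0" "u' x = 0" by (simp_all add: E_def sum_power2_le_zero_iff)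
qed

text \<open>A vanishing Wronskian at \<open>T\<close> says that w - c v with c = w T / v T has zero
  Cauchy data there, and uniqueness propagates this. Order-convexity keeps the interval between
  \<open>x\<close> and \<open>T\<close> in \<open>S\<close>, which is the whole line in one
  application and the half-line in another.\<close>

lemma multiple_if_wronskian_zero:
  fixes v v' w w' q :: "real \<Rightarrow> real"
  assumes v: "\<And>x. x \<in> S \<Longrightarrow> (v has_real_derivative v' x) (at x)"
      "\<And>x. x \<in> S \<Longrightarrow> (v' has_real_derivative q x * v x) (at x)"
    and w: "\<And>x. x \<in> S \<Longrightarrow> (w has_real_derivative w' x) (at x)"
      "\<And>x. x \<in> S \<Longrightarrow> (w' has_real_derivative q x * w x) (at x)"
    and q: "\<And>x. x \<in> S \<Longrightarrow> \<bar>q x\<bar> \<le> M"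
    and S: "\<And>x y z. x \<in> S \<Longrightarrow> z \<in> S \<Longrightarrow> x \<le> y \<Longrightarrow> y \<le> z \<Longrightarrow> y \<in> S"
    and T: "T \<in> S" "v T \<noteq> 0" and W: "w' T * v T = w T * v' T" and x: "x \<in> S"
  shows "w x = w T / v T * v x" "w' x = w T / v T * v' x"
proof -
  define c where "c = w T / v T"
  let ?u = "\<lambda>x. w x - c * v x" and ?u' = "\<lambda>x. w' x - c * v' x"
  have sub: "y \<in> S" if "y \<in> {min x T..max x T}" for y
    using S[of "min x T" "max x T" y] that T(1) x by (auto simp: min_def max_def split: if_splits)
  have "w' T - c * v' T = 0" using W T(2) by (simp add: c_def field_simps)
  moreover have "w T - c * v T = 0" using T(2) by (simp add: c_def)
  moreover have "(?u has_real_derivative ?u' y) (at y)" "(?u' has_real_derivative q y * ?u y) (at y)"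
    if "y \<in> {min x T..max x T}" for y
    using v(1,2)[OF sub[OF that]] w(1,2)[OF sub[OF that]]
    by (auto intro!: derivative_eq_intros simp: algebra_simps)
  ultimately have "?u x = 0 \<and> ?u' x = 0"
    using linear_ode_unique[where u = ?u and u' = ?u' and q = q and a = "min x T" and b = "max x T" and M = M and c = T and x = x]
      q[OF sub] by auto
  then show "w x = w T / v T * v x" "w' x = w T / v T * v' x" by (simp_all add: c_def)
qed

lemma jost_potential_bounded:
  fixes t :: real
  assumes "0 \<le> \<nu>"
  shows "\<bar>jost_potential \<nu> s t\<bar> \<le> s\<^sup>2 + \<nu> * (\<nu> + 1) * 2"
proof -
  have "\<bar>1 - (tanh t)\<^sup>2\<bar> \<le> 2" using half_sech_square_le[of t] by simp
  then have "\<nu> * (\<nu> + 1) * \<bar>1 - (tanh t)\<^sup>2\<bar> \<le> \<nu> * (\<nu> + 1) * 2"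
    by (rule mult_left_mono) (use assms in simp)
  moreover have "\<nu> * (\<nu> + 1) * \<bar>1 - (tanh t)\<^sup>2\<bar> = \<bar>\<nu> * (\<nu> + 1) * (1 - (tanh t)\<^sup>2)\<bar>"
    using assms by (simp add: abs_mult)
  ultimately show ?thesis
    using abs_triangle_ineq4[of "s\<^sup>2" "\<nu> * (\<nu> + 1) * (1 - (tanh t)\<^sup>2)"] by simp
qed

lemma tendsto_0_if_exp_decay:
  fixes f :: "real \<Rightarrow> real"
  assumes "\<And>t. t0 \<le> t \<Longrightarrow> \<bar>f t\<bar> \<le> C * exp (- s * t)" and "0 < s"
  shows "(f \<longlongrightarrow> 0) at_top"
proof (rule Lim_null_comparison)
  show "\<forall>\<^sub>F t in at_top. norm (f t) \<le> C * exp (- s * t)"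
    using assms(1) by (auto simp: eventually_at_top_linorder)
  have "((\<lambda>t. exp (- s * t)) \<longlongrightarrow> 0) at_top" using \<open>0 < s\<close> by real_asymp
  then show "((\<lambda>t. C * exp (- s * t)) \<longlongrightarrow> 0) at_top" by (rule tendsto_mult_right_zero)
qed

text \<open>The Wronskian of two solutions of the same equation is constant, and here it decays, so
  it is zero. This recognises explicit solutions without summing the series.\<close>

lemma decaying_solution_multiple_of_jost:
  assumes \<nu>: "0 \<le> \<nu>" and s: "0 < s"
    and w: "\<And>t. (w has_real_derivative w' t) (at t)"
      "\<And>t. (w' has_real_derivative jost_potential \<nu> s t * w t) (at t)"
    and d: "\<And>t. 0 \<le> t \<Longrightarrow> \<bar>w t\<bar> \<le> C * exp (- s * t)" "\<And>t. 0 \<le> t \<Longrightarrow> \<bar>w' t\<bar> \<le> C * exp (- s * t)"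
  obtains c where "\<And>t. w t = c * jost \<nu> s t" "\<And>t. w' t = c * jost' \<nu> s t"
proof -
  note s0 = less_imp_le[OF s]
  obtain D where D: "\<And>t. 0 \<le> t \<Longrightarrow> \<bar>jost \<nu> s t\<bar> \<le> D * exp (- s * t)"
    "\<And>t. 0 \<le> t \<Longrightarrow> \<bar>jost' \<nu> s t\<bar> \<le> D * exp (- s * t)" using jost_decay[OF \<nu> s0] by metis
  let ?W = "\<lambda>t. w' t * jost \<nu> s t - w t * jost' \<nu> s t"
  have "(?W has_real_derivative 0) (at t)" for t
    by (auto intro!: derivative_eq_intros w jost_deriv[OF \<nu> s0] jost'_deriv[OF \<nu> s0] simp: algebra_simps)
  then obtain k where k: "\<And>t. ?W t = k" using DERIV_isconst_all[of ?W] by metis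
  have "((\<lambda>t. w' t * jost \<nu> s t - w t * jost' \<nu> s t) \<longlongrightarrow> 0 * 0 - 0 * 0) at_top"
    by (intro tendsto_intros tendsto_0_if_exp_decay[OF d(1) s] tendsto_0_if_exp_decay[OF d(2) s]
        tendsto_0_if_exp_decay[OF D(1) s] tendsto_0_if_exp_decay[OF D(2) s])
  then have "k = 0" using k by (simp add: tendsto_const_iff)
  have "\<exists>T. 0 < jost \<nu> s T"
    using eventually_happens[OF jost_eventually_pos[OF \<nu> s0]] by simp
  then obtain T where T: "0 < jost \<nu> s T" by blast
  have "w' T * jost \<nu> s T = w T * jost' \<nu> s T" using k[of T] \<open>k = 0\<close> by simp
  note m = multiple_if_wronskian_zero[where S = UNIV and v = "jost \<nu> s" and v' = "jost' \<nu> s" and w = w and w' = w'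
      and q = "\<lambda>t. jost_potential \<nu> s t",
      OF jost_deriv[OF \<nu> s0] jost'_deriv[OF \<nu> s0] w jost_potential_bounded[OF \<nu>] UNIV_I UNIV_I
      less_imp_neq[OF T, symmetric] this UNIV_I]
  show ?thesis by (rule that[OF m])
qed

section \<open>Explicit solutions\<close>

text \<open>This is sech(t)^s; the exponential form suits differentiation and the comparison with
  e^(-st).\<close>

definition sech_powr :: "real \<Rightarrow> real \<Rightarrow> real" where
  "sech_powr s t = exp (- s * ln (cosh t))"

lemma sech_powr_pos: "0 < sech_powr s t"
  by (simp add: sech_powr_def)

lemma sech_powr_deriv: "(sech_powr s has_real_derivative - s * tanh t * sech_powr s t) (at t)"
  unfolding sech_powr_def[abs_def]
  by (auto intro!: derivative_eq_intros cosh_real_pos simp: tanh_def field_simps)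

lemma sech_powr_le:
  assumes "0 \<le> s"
  shows "sech_powr s t \<le> exp (s * ln 2) * exp (- s * t)"
proof -
  have "exp t / 2 \<le> cosh t" by (simp add: cosh_def field_simps)
  then have "ln (exp t / 2) \<le> ln (cosh t)" by (subst ln_le_cancel_iff) auto
  then have "t - ln 2 \<le> ln (cosh t)" by (simp add: ln_div)
  then have "s * (t - ln 2) \<le> s * ln (cosh t)" using assms by (rule mult_left_mono)
  then show ?thesis by (simp add: sech_powr_def exp_add[symmetric] algebra_simps)
qed

text \<open>The case \<nu> = s, the ground state of the Poschl-Teller potential. The factor is not
  computed; its sign follows because both functions are positive far out.\<close>

lemma jost_ground:
  assumes s: "0 < s"
  obtains c where "0 < c" "\<And>t. jost s s t = c * sech_powr s t" "\<And>t. jost' s s t = c * (- s * tanh t * sech_powr s t)"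
proof -
  note s0 = less_imp_le[OF s]
  let ?w = "sech_powr s" and ?w' = "\<lambda>t. - s * tanh t * sech_powr s t"
  have d2: "(?w' has_real_derivative (s\<^sup>2 - s * (s + 1) * (1 - (tanh t)\<^sup>2)) * ?w t) (at t)" for t
    by (auto intro!: derivative_eq_intros sech_powr_deriv simp: algebra_simps power2_eq_square)
  have b: "\<bar>?w t\<bar> \<le> (1 + s) * exp (s * ln 2) * exp (- s * t)" "\<bar>?w' t\<bar> \<le> (1 + s) * exp (s * ln 2) * exp (- s * t)" for t
  proof -
    have le: "k * sech_powr s t \<le> (1 + s) * exp (s * ln 2) * exp (- s * t)" if "0 \<le> k" "k \<le> 1 + s" for k
      using mult_mono[OF that(2) sech_powr_le[OF s0, of t]] that s sech_powr_pos[of s t] by (simp add: mult.assoc)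
    show "\<bar>?w t\<bar> \<le> (1 + s) * exp (s * ln 2) * exp (- s * t)"
      using le[of 1] s sech_powr_pos[of s t] by simp
    have "\<bar>tanh t\<bar> \<le> 1" using tanh_real_bounds[of t] by auto
    then have "s * \<bar>tanh t\<bar> \<le> s * 1" using s0 by (rule mult_left_mono)
    moreover have "\<bar>s * tanh t\<bar> = s * \<bar>tanh t\<bar>" using s by (simp add: abs_mult)
    ultimately have "\<bar>s * tanh t\<bar> \<le> 1 + s" by linarith
    from le[OF _ this] show "\<bar>?w' t\<bar> \<le> (1 + s) * exp (s * ln 2) * exp (- s * t)"
      using sech_powr_pos[of s t] by (simp add: abs_mult)
  qed
  obtain c where c: "\<And>t. ?w t = c * jost s s t" "\<And>t. ?w' t = c * jost' s s t"
    by (rule decaying_solution_multiple_of_jost[OF s0 s sech_powr_deriv d2 b]) blast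
  obtain T where T: "0 < jost s s T"
    using eventually_happens[OF jost_eventually_pos[OF s0 s0]] by auto
  have "0 < c" using c(1)[of T] sech_powr_pos[of s T] T by (metis zero_less_mult_pos2)
  show ?thesis
  proof (rule that[of "1 / c"])
    show "jost s s t = 1 / c * sech_powr s t" for t using c(1)[of t] \<open>0 < c\<close> by simp
    show "jost' s s t = 1 / c * (- s * tanh t * sech_powr s t)" for t unfolding c(2) using \<open>0 < c\<close> by simp
  qed (use \<open>0 < c\<close> in simp)
qed

text \<open>The case \<nu> = s + 1, the first excited state. For s = 1/p it is, up to scaling, the
  derivative of the soliton, which translation invariance on the line makes a zero mode.\<close>

lemma jost_excited:
  assumes s: "0 < s"
  obtains c where "0 < c" "\<And>t. jost (s + 1) s t = c * (tanh t * sech_powr s t)"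
    "\<And>t. jost' (s + 1) s t = c * ((1 - (1 + s) * (tanh t)\<^sup>2) * sech_powr s t)"
proof -
  have s0: "0 \<le> s" "0 \<le> s + 1" using s by auto
  let ?w = "\<lambda>t. tanh t * sech_powr s t" and ?w' = "\<lambda>t. (1 - (1 + s) * (tanh t)\<^sup>2) * sech_powr s t"
  have d1: "(?w has_real_derivative ?w' t) (at t)" for t
    by (auto intro!: derivative_eq_intros sech_powr_deriv simp: algebra_simps power2_eq_square)
  have d2: "(?w' has_real_derivative (s\<^sup>2 - (s + 1) * (s + 1 + 1) * (1 - (tanh t)\<^sup>2)) * ?w t) (at t)" for t
    by (auto intro!: derivative_eq_intros sech_powr_deriv simp: algebra_simps power2_eq_square)
  have b: "\<bar>?w t\<bar> \<le> (2 + s) * exp (s * ln 2) * exp (- s * t)" "\<bar>?w' t\<bar> \<le> (2 + s) * exp (s * ln 2) * exp (- s * t)" for t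
  proof -
    have le: "k * sech_powr s t \<le> (2 + s) * exp (s * ln 2) * exp (- s * t)" if "0 \<le> k" "k \<le> 2 + s" for k
      using mult_mono[OF that(2) sech_powr_le[OF s0(1), of t]] that s sech_powr_pos[of s t] by (simp add: mult.assoc)
    have "\<bar>tanh t\<bar> \<le> 2 + s" using tanh_real_bounds[of t] s by auto
    from le[OF _ this] show "\<bar>?w t\<bar> \<le> (2 + s) * exp (s * ln 2) * exp (- s * t)"
      using sech_powr_pos[of s t] by (simp add: abs_mult)
    have t1: "(tanh t)\<^sup>2 \<le> 1" using tanh_real_bounds[of t] by (auto simp: abs_square_le_1)
    have "(1 + s) * (tanh t)\<^sup>2 \<le> 1 + s" using mult_left_mono[OF t1, of "1 + s"] s by simp
    moreover have "0 \<le> (1 + s) * (tanh t)\<^sup>2" using s by simp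
    ultimately have "\<bar>1 - (1 + s) * (tanh t)\<^sup>2\<bar> \<le> 2 + s" using s by (intro abs_leI) linarith+
    from le[OF _ this] show "\<bar>?w' t\<bar> \<le> (2 + s) * exp (s * ln 2) * exp (- s * t)"
      using sech_powr_pos[of s t] by (simp add: abs_mult)
  qed
  obtain c where c: "\<And>t. ?w t = c * jost (s + 1) s t" "\<And>t. ?w' t = c * jost' (s + 1) s t"
    by (rule decaying_solution_multiple_of_jost[OF s0(2) s d1 d2 b]) blast
  have "\<forall>\<^sub>F t in at_top. 0 < jost (s + 1) s t \<and> 0 < t"
    using jost_eventually_pos[OF s0(2,1)] eventually_gt_at_top[of 0] by eventually_elim simp
  then obtain T where T: "0 < jost (s + 1) s T" "0 < T"
    using eventually_happens[of _ at_top] by fastforce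
  have "0 < ?w T" using T(2) sech_powr_pos[of s T] by simp
  then have "0 < c" unfolding c(1) using T(1) by (metis zero_less_mult_pos2)
  show ?thesis
  proof (rule that[of "1 / c"])
    show "jost (s + 1) s t = 1 / c * ?w t" for t unfolding c(1) using \<open>0 < c\<close> by simp
    show "jost' (s + 1) s t = 1 / c * ?w' t" for t unfolding c(2) using \<open>0 < c\<close> by simp
  qed (use \<open>0 < c\<close> in simp)
qed

section \<open>Zeros and Wronskian comparison\<close>

text \<open>The zero is the supremum of the closed set of points in [a, b] with f \<le> 0; a
  negative derivative there would make f negative immediately to the right.\<close>

lemma last_zero:
  fixes f f' :: "real \<Rightarrow> real"
  assumes d: "\<And>x. (f has_real_derivative f' x) (at x)" and a: "f a \<le> 0" "a \<le> b" and b: "0 < f b"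
  obtains z where "a \<le> z" "z < b" "f z = 0" "0 \<le> f' z" "\<And>x. z < x \<Longrightarrow> x \<le> b \<Longrightarrow> 0 < f x"
proof -
  let ?S = "{x. a \<le> x \<and> x \<le> b \<and> f x \<le> 0}"
  have cf: "continuous_on UNIV f" by (rule DERIV_continuous_on[of UNIV f f']) (rule d)
  have bdd: "bdd_above ?S" by (rule bdd_aboveI[of _ b]) simp
  have cl: "closed ?S"
    by (intro closed_Collect_conj closed_Collect_le continuous_intros cf)
  define z where "z = Sup ?S"
  have zS: "z \<in> ?S" unfolding z_def using a by (intro closed_contains_Sup[OF _ bdd cl]) auto
  then have zb: "z < b" using b by (cases "z = b") auto
  have pos: "0 < f x" if "z < x" "x \<le> b" for x
  proof (rule ccontr)
    assume "\<not> 0 < f x"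
    then have "x \<in> ?S" using that zS by auto
    then have "x \<le> z" unfolding z_def by (rule cSup_upper[OF _ bdd])
    then show False using that by simp
  qed
  have fz: "f z = 0"
  proof (rule ccontr)
    assume "f z \<noteq> 0"
    then have "f z < 0" using zS by auto
    have "\<exists>x\<ge>z. x \<le> b \<and> f x = 0"
      by (rule IVT'[OF _ _ _ continuous_on_subset[OF cf]]) (use \<open>f z < 0\<close> b zb in auto)
    then obtain x where "z \<le> x" "x \<le> b" "f x = 0" by blast
    then show False using pos[of x] \<open>f z < 0\<close> by (cases "x = z") auto
  qed
  have "0 \<le> f' z"
  proof (rule ccontr)
    assume "\<not> 0 \<le> f' z"
    then obtain e where e: "0 < e" "\<And>h. 0 < h \<Longrightarrow> h < e \<Longrightarrow> f (z + h) < f z"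
      using DERIV_neg_dec_right[OF d[of z]] by auto
    define h where "h = min (e / 2) (b - z)"
    have "0 < h" "h < e" "z + h \<le> b" using e(1) zb by (auto simp: h_def min_def)
    then show False using e(2)[of h] pos[of "z + h"] fz by auto
  qed
  then show ?thesis using that zS zb fz pos by auto
qed

lemma last_zero_at_top:
  fixes f f' :: "real \<Rightarrow> real"
  assumes d: "\<And>x. (f has_real_derivative f' x) (at x)" and ev: "\<forall>\<^sub>F x in at_top. 0 < f x"
    and a: "f a \<le> 0"
  obtains z where "a \<le> z" "f z = 0" "0 \<le> f' z" "\<And>x. z < x \<Longrightarrow> 0 < f x"
proof -
  obtain B where B: "\<And>x. B \<le> x \<Longrightarrow> 0 < f x" using ev by (auto simp: eventually_at_top_linorder)
  obtain z where z: "a \<le> z" "f z = 0" "0 \<le> f' z" "\<And>x. z < x \<Longrightarrow> x \<le> max a B \<Longrightarrow> 0 < f x"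
    using last_zero[where f = f and f' = f' and a = a and b = "max a B"] d a B by (metis max.cobounded1 max.cobounded2)
  have "0 < f x" if "z < x" for x
    using z(4)[OF that] B[of x] by (cases "x \<le> max a B") auto
  with z show ?thesis using that by blast
qed

lemma wronskian_deriv:
  assumes "0 \<le> \<nu>" "0 \<le> s" "0 \<le> r"
  shows "((\<lambda>t. wronskian \<nu> s r t) has_real_derivative
    (s\<^sup>2 - r\<^sup>2) * (jost \<nu> s t * jost \<nu> r t)) (at t)"
  by (auto intro!: derivative_eq_intros jost_deriv jost'_deriv assms simp: algebra_simps)

lemma wronskian_tendsto_0:
  assumes \<nu>: "0 \<le> \<nu>" and "0 < s" "0 < r"
  shows "((\<lambda>t. wronskian \<nu> s r t) \<longlongrightarrow> 0) at_top"
proof -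
  have lim: "(jost \<nu> k \<longlongrightarrow> 0) at_top \<and> (jost' \<nu> k \<longlongrightarrow> 0) at_top" if k: "0 < k" for k
  proof -
    obtain D where D: "\<And>t. 0 \<le> t \<Longrightarrow> \<bar>jost \<nu> k t\<bar> \<le> D * exp (- k * t)"
      "\<And>t. 0 \<le> t \<Longrightarrow> \<bar>jost' \<nu> k t\<bar> \<le> D * exp (- k * t)" using jost_decay[OF \<nu> less_imp_le[OF k]] by metis
    then show ?thesis using tendsto_0_if_exp_decay[OF D(1) k] tendsto_0_if_exp_decay[OF D(2) k] by blast
  qed
  have "((\<lambda>t. wronskian \<nu> s r t) \<longlongrightarrow> 0 * 0 - 0 * 0) at_top"
    by (intro tendsto_intros lim[THEN conjunct1] lim[THEN conjunct2] assms)
  then show ?thesis by simp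
qed

lemma wronskian_increasing:
  assumes \<nu>: "0 \<le> \<nu>" and r: "0 \<le> r" "r < s" and ab: "a < b"
    and pos: "\<And>x. a < x \<Longrightarrow> x < b \<Longrightarrow> 0 < jost \<nu> s x * jost \<nu> r x"
  shows "wronskian \<nu> s r a < wronskian \<nu> s r b"
proof (rule DERIV_pos_imp_increasing_open[OF ab])
  have s: "0 \<le> s" using r by simp
  have rs: "r\<^sup>2 < s\<^sup>2" using r by (intro power_strict_mono) auto
  show "\<exists>y. ((\<lambda>t. wronskian \<nu> s r t) has_real_derivative y) (at x) \<and> 0 < y"
    if "a < x" "x < b" for x
    using wronskian_deriv[OF \<nu> s r(1), of x] mult_pos_pos[OF _ pos[OF that], of "s\<^sup>2 - r\<^sup>2"] rs by auto
  show "continuous_on {a..b} (\<lambda>t. wronskian \<nu> s r t)"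
    by (intro continuous_at_imp_continuous_on ballI DERIV_isCont[OF wronskian_deriv[OF \<nu> s r(1)]])
qed

text \<open>While both functions have the same sign the Wronskian increases strictly, and it tends
  to 0 at infinity.\<close>

lemma wronskian_neg:
  assumes \<nu>: "0 \<le> \<nu>" and r: "0 < r" "r < s" and pos: "\<And>x. t < x \<Longrightarrow> 0 < jost \<nu> s x * jost \<nu> r x"
  shows "wronskian \<nu> s r t < 0"
proof -
  let ?W = "\<lambda>t. wronskian \<nu> s r t"
  have incr: "?W a < ?W b" if "t \<le> a" "a < b" for a b
    by (rule wronskian_increasing) (use \<nu> r pos that in auto)
  \<comment> \<open>The limit yields only a weak inequality, taken at \<open>t + 1\<close>; strict
    increase from \<open>t\<close> to \<open>t + 1\<close> makes it strict at
    \<open>t\<close>.\<close>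
  have "?W (t + 1) \<le> 0"
  proof (rule tendsto_lowerbound)
    show "(?W \<longlongrightarrow> 0) at_top" by (rule wronskian_tendsto_0) (use \<nu> r in auto)
    show "\<forall>\<^sub>F x in at_top. ?W (t + 1) \<le> ?W x"
      using eventually_gt_at_top[of "t + 1"] by eventually_elim (use incr[of "t + 1"] in \<open>auto intro: less_imp_le\<close>)
  qed simp
  then show ?thesis using incr[of t "t + 1"] by simp
qed

text \<open>At the last zero z of v_s the Wronskian reduces to v_s'(z) v_r(z) \<ge> 0, whereas
  positivity of both functions to the right of z makes it negative.\<close>

lemma jost_pos_by_comparison:
  assumes \<nu>: "0 \<le> \<nu>" and r: "0 < r" "r < s"
    and w: "\<And>x. c < x \<Longrightarrow> 0 < jost \<nu> r x" "0 \<le> jost \<nu> r c" and x: "c \<le> x"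
  shows "0 < jost \<nu> s x"
proof (rule ccontr)
  assume "\<not> 0 < jost \<nu> s x"
  then have "jost \<nu> s x \<le> 0" by simp
  have s: "0 \<le> s" using r by simp
  obtain z where z: "x \<le> z" "jost \<nu> s z = 0" "0 \<le> jost' \<nu> s z" "\<And>y. z < y \<Longrightarrow> 0 < jost \<nu> s y"
    using last_zero_at_top[OF jost_deriv[OF \<nu> s] jost_eventually_pos[OF \<nu> s] \<open>jost \<nu> s x \<le> 0\<close>] by metis
  have "wronskian \<nu> s r z < 0"
    by (rule wronskian_neg[OF \<nu> r]) (use w z x in auto)
  moreover have "0 \<le> jost \<nu> r z" using w z(1) x by (cases "z = c") (auto simp: less_imp_le)
  ultimately show False using z(2,3) by (simp add: mult_less_0_iff)
qed

lemma jost_nontrivial: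
  assumes \<nu>: "0 \<le> \<nu>" and s: "0 \<le> s" and z: "jost \<nu> s t = 0"
  shows "jost' \<nu> s t \<noteq> 0"
proof
  assume z': "jost' \<nu> s t = 0"
  have "\<forall>\<^sub>F x in at_top. 0 < jost \<nu> s x \<and> t \<le> x"
    using jost_eventually_pos[OF \<nu> s] eventually_ge_at_top[of t] by eventually_elim simp
  then obtain T where T: "0 < jost \<nu> s T" "t \<le> T"
    using eventually_happens[of _ at_top] by fastforce
  have "jost \<nu> s T = 0"
    by (rule linear_ode_unique(1)[where a = t and b = T and c = t and u' = "jost' \<nu> s"
          and q = "\<lambda>t. jost_potential \<nu> s t", OF jost_deriv[OF \<nu> s] jost'_deriv[OF \<nu> s] jost_potential_bounded[OF \<nu>]])
      (use T z z' in auto)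
  then show False using T by simp
qed

text \<open>The reference solution sech^r t tanh t has its only zero at 0, so comparison confines
  the zeros of v_s with s > r to the negative half-line. Suppose z is a zero to the left of the last
  zero y, with v_s negative in between. Both functions are negative on (z, y), so the Wronskian
  increases strictly from z to y; but it is nonnegative at z and nonpositive at y.\<close>

lemma jost_sign_structure:
  assumes r: "0 < r" "r \<le> s"
  shows "(\<forall>t. 0 < jost (r + 1) s t) \<or> (\<exists>y\<le>0. jost (r + 1) s y = 0 \<and> 0 < jost' (r + 1) s y \<and>
    (\<forall>x>y. 0 < jost (r + 1) s x) \<and> (\<forall>x<y. jost (r + 1) s x < 0))"
proof -
  have \<nu>: "0 \<le> r + 1" and s0: "0 \<le> s" using r by auto
  obtain c where c: "0 < c" "\<And>t. jost (r + 1) r t = c * (tanh t * sech_powr r t)"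
    "\<And>t. jost' (r + 1) r t = c * ((1 - (1 + r) * (tanh t)\<^sup>2) * sech_powr r t)"
    using jost_excited[OF r(1)] by blast
  have wpos: "0 < jost (r + 1) r x" if "0 < x" for x
    unfolding c(2) using that c(1) sech_powr_pos[of r x] by simp
  have wneg: "jost (r + 1) r x < 0" if "x < 0" for x
    unfolding c(2) using that c(1) sech_powr_pos[of r x] by (simp add: mult_pos_neg mult_neg_pos)
  have w0: "jost (r + 1) r 0 = 0" "0 < jost' (r + 1) r 0"
    unfolding c(2,3) using c(1) sech_powr_pos[of r 0] by auto
  show ?thesis
  proof (cases "s = r")
    case True
    then show ?thesis using wpos wneg w0 by auto
  next
    case False
    then have rs: "r < s" using r by simp
    show ?thesis
    proof (cases "\<forall>t. 0 < jost (r + 1) s t")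
      case False
      then obtain a where a: "jost (r + 1) s a \<le> 0" by (auto simp: not_less)
      obtain y where y: "a \<le> y" "jost (r + 1) s y = 0" "0 \<le> jost' (r + 1) s y" "\<And>x. y < x \<Longrightarrow> 0 < jost (r + 1) s x"
        using last_zero_at_top[OF jost_deriv[OF \<nu> s0] jost_eventually_pos[OF \<nu> s0] a] by metis
      have "0 < jost (r + 1) s x" if "0 \<le> x" for x
        by (rule jost_pos_by_comparison[OF \<nu> r(1) rs wpos _ that]) (use w0 in auto)
      then have y0: "y < 0" using y(2) by (metis less_irrefl not_less)
      have y': "0 < jost' (r + 1) s y" using y(3) jost_nontrivial[OF \<nu> s0 y(2)] by simp
      have "jost (r + 1) s x < 0" if xy: "x < y" for x
      proof (rule ccontr)
        assume "\<not> jost (r + 1) s x < 0"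
        then have x0: "- jost (r + 1) s x \<le> 0" by simp
        obtain e where e: "0 < e" "\<And>h. 0 < h \<Longrightarrow> h < e \<Longrightarrow> jost (r + 1) s (y - h) < jost (r + 1) s y"
          using DERIV_pos_inc_left[OF jost_deriv[OF \<nu> s0] y'] by auto
        \<comment> \<open>\<open>last_zero\<close> needs a strictly positive right end, which y is
          not for -v_s. The point y - h is not left of x and lies in the range where v_s is known to
          be negative.\<close>
        define h where "h = min (e / 2) (y - x)"
        have h: "0 < h" "h < e" "x \<le> y - h" using e(1) xy by (auto simp: h_def min_def)
        have pos: "0 < - jost (r + 1) s (y - h)" using e(2)[OF h(1,2)] y(2) by simp
        have d: "((\<lambda>t. - jost (r + 1) s t) has_real_derivative - jost' (r + 1) s t) (at t)" for t
          by (rule DERIV_minus[OF jost_deriv[OF \<nu> s0]])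
        obtain z where z: "x \<le> z" "z < y - h" "- jost (r + 1) s z = 0" "0 \<le> - jost' (r + 1) s z"
          "\<And>t. z < t \<Longrightarrow> t \<le> y - h \<Longrightarrow> 0 < - jost (r + 1) s t"
          using last_zero[where f = "\<lambda>t. - jost (r + 1) s t" and f' = "\<lambda>t. - jost' (r + 1) s t", OF d x0 h(3) pos] by metis
        have neg: "jost (r + 1) s t < 0" if "z < t" "t < y" for t
        proof (cases "t \<le> y - h")
          case True then show ?thesis using z(5)[OF that(1)] by simp
        next
          case False
          then show ?thesis using e(2)[of "y - t"] h(2) that y(2) by simp
        qed
        have "wronskian (r + 1) s r z
          < wronskian (r + 1) s r y"
        proof (rule wronskian_increasing[OF \<nu> less_imp_le[OF r(1)] rs])
          show "z < y" using z(2) h(1) by simp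
          show "0 < jost (r + 1) s t * jost (r + 1) r t" if "z < t" "t < y" for t
            using neg[OF that] wneg[of t] that y0 by (simp add: mult_neg_neg)
        qed
        moreover have "jost' (r + 1) s y * jost (r + 1) r y \<le> 0"
          using y' wneg[OF y0] by (simp add: mult_pos_neg less_imp_le)
        moreover have "0 \<le> jost' (r + 1) s z * jost (r + 1) r z"
          using z(2,4) wneg[of z] y0 h(1) by (intro mult_nonpos_nonpos) auto
        ultimately show False using y(2) z(3) by simp
      qed
      then show ?thesis using y y' y0 by (intro disjI2 exI[of _ y]) auto
    qed simp
  qed
qed

lemma jost_pos_of_pos:
  assumes r: "0 < r" "r \<le> s" and b: "0 \<le> jost (r + 1) s b" "b < x"
  shows "0 < jost (r + 1) s x"
  using jost_sign_structure[OF r] b by (metis less_le_not_le less_trans not_less_iff_gr_or_eq)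

lemma jost_pos_right:
  assumes r: "0 < r" "r \<le> s" and b: "0 < b"
  shows "0 < jost (r + 1) s b"
  using jost_sign_structure[OF r] b by (metis order_le_less_trans)

text \<open>In other words, the node moves to the left as the parameter grows.\<close>

lemma jost_pos_parameter_mono:
  assumes r: "0 < r" "r \<le> k" "k < s" and b: "0 \<le> jost (r + 1) k b"
  shows "0 < jost (r + 1) s b"
  by (rule jost_pos_by_comparison[of "r + 1" k s b b]) (use r b jost_pos_of_pos[OF r(1,2) b] in auto)

lemma ratio_less_if_wronskian_neg:
  fixes a a' c c' :: real
  assumes "0 < a * c" "a' * c - a * c' < 0"
  shows "a' / a < c' / c"
proof -
  have "a' / a - c' / c = (a' * c - a * c') / (a * c)"
    using assms(1) by (cases "a = 0"; cases "c = 0") (auto simp: field_simps)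
  also have "\<dots> < 0" using assms by (simp add: divide_neg_pos)
  finally show ?thesis by simp
qed

text \<open>The difference of the logarithmic derivatives is the Wronskian divided by the product of
  the values. If both values are positive, the Wronskian is negative as before. If both are
  negative, it increases up to the node y of v_s, where it equals v_s'(y) v_k(y) < 0, because v_k
  has its node further to the right.\<close>

lemma jost_log_deriv_less:
  assumes r: "0 < r" "r \<le> k" "k < s" and pos: "0 < jost (r + 1) s b * jost (r + 1) k b"
  shows "jost' (r + 1) s b / jost (r + 1) s b < jost' (r + 1) k b / jost (r + 1) k b"
proof (rule ratio_less_if_wronskian_neg[OF pos])
  have \<nu>: "0 \<le> r + 1" and k: "0 < k" and rs: "r \<le> s" using r by auto
  let ?W = "\<lambda>b. wronskian (r + 1) s k b"
  show "?W b < 0"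
  proof (cases "0 < jost (r + 1) k b")
    case True
    then have "0 < jost (r + 1) s b" using pos by (simp add: zero_less_mult_iff)
    then show ?thesis using True
      by (intro wronskian_neg[OF \<nu> k r(3)] mult_pos_pos jost_pos_of_pos[of r _ b]) (use r in auto)
  next
    case False
    then have neg: "jost (r + 1) k b < 0" "jost (r + 1) s b < 0" using pos by (auto simp: zero_less_mult_iff)
    obtain y where y: "jost (r + 1) s y = 0" "0 < jost' (r + 1) s y"
      "\<And>x. y < x \<Longrightarrow> 0 < jost (r + 1) s x" "\<And>x. x < y \<Longrightarrow> jost (r + 1) s x < 0"
      using jost_sign_structure[OF r(1) rs] neg(2) by (metis less_asym)
    have b_less: "b < y" using neg(2) y(1,3) by (metis less_asym less_irrefl not_less_iff_gr_or_eq)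
    have ky: "jost (r + 1) k y < 0"
    proof (rule ccontr)
      assume "\<not> jost (r + 1) k y < 0"
      then have "0 < jost (r + 1) s y" by (intro jost_pos_parameter_mono[OF r]) simp
      then show False using y(1) by simp
    qed
    have "?W b < ?W y"
    proof (rule wronskian_increasing[OF \<nu> less_imp_le[OF k] r(3) b_less])
      fix x assume x: "b < x" "x < y"
      have "jost (r + 1) k x < 0"
      proof (rule ccontr)
        assume "\<not> jost (r + 1) k x < 0"
        then have "0 < jost (r + 1) k y" using x by (intro jost_pos_of_pos[OF r(1,2), of x]) auto
        then show False using ky by simp
      qed
      then show "0 < jost (r + 1) s x * jost (r + 1) k x" using y(4)[OF x(2)] by (rule mult_neg_neg[rotated])
    qed
    also have "\<dots> < 0" using y(1,2) ky by (simp add: mult_pos_neg)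
    finally show ?thesis .
  qed
qed

section \<open>The secular equation\<close>

text \<open>The \<open>B\<close> edges with a bump meet the vertex at argument -b, the
  \<open>T\<close> tails at b. Where a denominator vanishes the quotient is 0 by convention, so for
  B > 0 statements about this sum keep away from the node parameter.\<close>

definition log_deriv_sum :: "real \<Rightarrow> nat \<Rightarrow> nat \<Rightarrow> real \<Rightarrow> real \<Rightarrow> real" where
  "log_deriv_sum \<nu> B T b s = real B * (jost' \<nu> s (- b) / jost \<nu> s (- b)) + real T * (jost' \<nu> s b / jost \<nu> s b)"

lemma log_deriv_sum_less:
  assumes r: "0 < r" "r \<le> k" "k < s" and b: "0 < b"
    and pos: "B = 0 \<or> 0 < jost (r + 1) s (- b) * jost (r + 1) k (- b)" and BT: "0 < B + T"
  shows "log_deriv_sum (r + 1) B T b s < log_deriv_sum (r + 1) B T b k"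
proof -
  have rs: "r \<le> s" using r by simp
  have 1: "jost' (r + 1) s b / jost (r + 1) s b < jost' (r + 1) k b / jost (r + 1) k b"
    by (intro jost_log_deriv_less r mult_pos_pos jost_pos_right rs b)
  have 2: "jost' (r + 1) s (- b) / jost (r + 1) s (- b) < jost' (r + 1) k (- b) / jost (r + 1) k (- b)" if "B \<noteq> 0"
    by (intro jost_log_deriv_less r) (use pos that in auto)
  have "real B * (jost' (r + 1) s (- b) / jost (r + 1) s (- b)) \<le> real B * (jost' (r + 1) k (- b) / jost (r + 1) k (- b))"
  proof (cases "B = 0")
    case False then show ?thesis by (intro mult_left_mono less_imp_le[OF 2]) auto
  qed simp
  moreover have "real T * (jost' (r + 1) s b / jost (r + 1) s b) \<le> real T * (jost' (r + 1) k b / jost (r + 1) k b)"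
    using 1 by (intro mult_left_mono) auto
  moreover have "real B * (jost' (r + 1) s (- b) / jost (r + 1) s (- b)) < real B * (jost' (r + 1) k (- b) / jost (r + 1) k (- b)) \<or>
    real T * (jost' (r + 1) s b / jost (r + 1) s b) < real T * (jost' (r + 1) k b / jost (r + 1) k b)"
  proof (cases "B = 0")
    case True then show ?thesis using 1 BT by (intro disjI2 mult_strict_left_mono) auto
  next
    case False then show ?thesis using 2 by (intro disjI1 mult_strict_left_mono) auto
  qed
  ultimately show ?thesis unfolding log_deriv_sum_def by linarith
qed

text \<open>The equation for the sum of logarithmic derivatives cleared of denominators; it is
  continuous in s across the node parameter, where that sum has its pole.\<close>

definition secular :: "real \<Rightarrow> nat \<Rightarrow> nat \<Rightarrow> real \<Rightarrow> real \<Rightarrow> real \<Rightarrow> real" where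
  "secular \<nu> B T b A s = real B * jost' \<nu> s (- b) * jost \<nu> s b + real T * jost' \<nu> s b * jost \<nu> s (- b)
     - A * jost \<nu> s b * jost \<nu> s (- b)"

lemma secular_eq:
  assumes "jost \<nu> s (- b) \<noteq> 0" "jost \<nu> s b \<noteq> 0"
  shows "secular \<nu> B T b A s = jost \<nu> s b * jost \<nu> s (- b) * (log_deriv_sum \<nu> B T b s - A)"
  using assms by (simp add: secular_def log_deriv_sum_def field_simps)

lemma continuous_on_secular:
  assumes "0 \<le> \<nu>"
  shows "continuous_on {0..} (secular \<nu> B T b A)"
  unfolding secular_def[abs_def] by (intro continuous_intros continuous_on_jost_parameter assms)

text \<open>For sech^r t tanh t the logarithmic derivative is coth b - (1+r) tanh b at b and the
  opposite at -b. Subtracting A = (B - T) r tanh b leaves (T - B)(coth b - tanh b), and the product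
  of the values at b and -b is negative.\<close>

lemma secular_at_bottom:
  assumes r: "0 < r" and b: "0 < b"
  shows "sgn (secular (r + 1) B T b ((real B - real T) * r * tanh b) r) = sgn (real B - real T)"
proof -
  obtain c where c: "0 < c" "\<And>t. jost (r + 1) r t = c * (tanh t * sech_powr r t)"
    "\<And>t. jost' (r + 1) r t = c * ((1 - (1 + r) * (tanh t)\<^sup>2) * sech_powr r t)"
    using jost_excited[OF r] by blast
  have e: "sech_powr r (- b) = sech_powr r b" by (simp add: sech_powr_def)
  have "secular (r + 1) B T b ((real B - real T) * r * tanh b) r =
    (c * sech_powr r b)\<^sup>2 * tanh b * (1 - (tanh b)\<^sup>2) * (real B - real T)"
    unfolding secular_def c(2,3) e tanh_minus by (simp add: power2_eq_square algebra_simps)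
  moreover have "0 < (c * sech_powr r b)\<^sup>2 * tanh b * (1 - (tanh b)\<^sup>2)"
  proof (intro mult_pos_pos)
    show "0 < (c * sech_powr r b)\<^sup>2" using c(1) sech_powr_pos[of r b] by simp
    show "0 < 1 - (tanh b)\<^sup>2" using tanh_real_bounds[of b] abs_square_less_1[of "tanh b"] by auto
  qed (use b in simp)
  ultimately show ?thesis by (simp only: sgn_mult[of "(c * sech_powr r b)\<^sup>2 * tanh b * (1 - (tanh b)\<^sup>2)"] sgn_pos mult_1)
qed

lemma log_deriv_sum_large:
  assumes \<nu>: "0 \<le> \<nu>" and BT: "0 < B + T"
  obtains S where "\<And>s. S \<le> s \<Longrightarrow> 0 < jost \<nu> s b" "\<And>s. S \<le> s \<Longrightarrow> 0 < jost \<nu> s (- b)"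
    "\<And>s. S \<le> s \<Longrightarrow> log_deriv_sum \<nu> B T b s < A"
proof -
  obtain S1 where S1: "\<And>s. S1 \<le> s \<Longrightarrow> 0 < jost \<nu> s b" "\<And>s. S1 \<le> s \<Longrightarrow> jost' \<nu> s b \<le> (1 - s) * jost \<nu> s b"
    using jost_large_parameter[OF \<nu>, of b] by metis
  obtain S2 where S2: "\<And>s. S2 \<le> s \<Longrightarrow> 0 < jost \<nu> s (- b)" "\<And>s. S2 \<le> s \<Longrightarrow> jost' \<nu> s (- b) \<le> (1 - s) * jost \<nu> s (- b)"
    using jost_large_parameter[OF \<nu>, of "- b"] by metis
  show ?thesis
  \<comment> \<open>From s \<ge> |A| + 2 follows 1 - s < -|A| \<le> A, and the factor B + T \<ge> 1
    only lowers the negative number 1 - s.\<close>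
  proof (rule that[of "max (max S1 S2) (\<bar>A\<bar> + 2)"])
    fix s assume s: "max (max S1 S2) (\<bar>A\<bar> + 2) \<le> s"
    then show p: "0 < jost \<nu> s b" "0 < jost \<nu> s (- b)" using S1(1) S2(1) by auto
    have "jost' \<nu> s b / jost \<nu> s b \<le> 1 - s" "jost' \<nu> s (- b) / jost \<nu> s (- b) \<le> 1 - s"
      using S1(2)[of s] S2(2)[of s] p s by (auto simp: pos_divide_le_eq)
    then have "log_deriv_sum \<nu> B T b s \<le> real B * (1 - s) + real T * (1 - s)"
      unfolding log_deriv_sum_def by (intro add_mono mult_left_mono) auto
    also have "\<dots> = (1 - s) * real (B + T)" by (simp add: algebra_simps)
    also have "\<dots> \<le> (1 - s) * 1" using BT s by (intro mult_left_mono_neg) auto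
    also have "\<dots> < A" using s by (simp add: abs_if split: if_splits)
    finally show "log_deriv_sum \<nu> B T b s < A" .
  qed
qed

text \<open>Both ends of the parameter interval [r, r+1] are explicit: sech^r t tanh t is negative
  at -b, sech^(r+1) t is positive. In between the intermediate value theorem gives a zero, and the
  motion of the node makes it unique.\<close>

lemma jost_node_parameter:
  assumes r: "0 < r" and b: "0 < b"
  obtains s0 where "r < s0" "jost (r + 1) s0 (- b) = 0" "\<And>s. s0 < s \<Longrightarrow> 0 < jost (r + 1) s (- b)"
    "\<And>s. r \<le> s \<Longrightarrow> s < s0 \<Longrightarrow> jost (r + 1) s (- b) < 0" "0 < jost' (r + 1) s0 (- b)"
proof -
  have \<nu>: "0 \<le> r + 1" and r1: "0 < r + 1" using r by auto
  obtain c where c: "0 < c" "\<And>t. jost (r + 1) r t = c * (tanh t * sech_powr r t)"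
    using jost_excited[OF r] by metis
  have lo: "jost (r + 1) r (- b) < 0"
    unfolding c(2) using c(1) sech_powr_pos[of r "- b"] b by (simp add: mult_pos_neg mult_neg_pos)
  obtain d where d: "0 < d" "\<And>t. jost (r + 1) (r + 1) t = d * sech_powr (r + 1) t"
    using jost_ground[OF r1] by metis
  have hi: "0 < jost (r + 1) (r + 1) (- b)" unfolding d(2) using d(1) sech_powr_pos by simp
  have "\<exists>s\<ge>r. s \<le> r + 1 \<and> jost (r + 1) s (- b) = 0"
    by (rule IVT'[OF _ _ _ continuous_on_subset[OF continuous_on_jost_parameter(1)[OF \<nu>]]]) (use lo hi r in auto)
  then obtain s0 where s0: "r \<le> s0" "jost (r + 1) s0 (- b) = 0" by blast
  have rs: "r < s0" using s0 lo by (cases "s0 = r") auto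
  have up: "0 < jost (r + 1) s (- b)" if "s0 < s" for s
    by (rule jost_pos_parameter_mono[OF r s0(1) that]) (use s0 in simp)
  have down: "jost (r + 1) s (- b) < 0" if "r \<le> s" "s < s0" for s
  proof (rule ccontr)
    assume "\<not> jost (r + 1) s (- b) < 0"
    then have "0 < jost (r + 1) s0 (- b)" by (intro jost_pos_parameter_mono[OF r that]) simp
    then show False using s0 by simp
  qed
  have "0 < jost' (r + 1) s0 (- b)"
    using jost_sign_structure[OF r s0(1)] s0(2) by (metis less_irrefl not_less_iff_gr_or_eq)
  with rs s0(2) up down show ?thesis by (rule that)
qed

text \<open>The secular function changes sign between the node parameter and infinity, and between $r$
  and the node parameter precisely if $B < T$; between these points the sum of logarithmic
  derivatives is strictly decreasing, so every sign change gives exactly one root.\<close>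

lemma secular_roots:
  assumes r: "0 < r" and b: "0 < b" and B: "0 < B" and BT: "B \<noteq> T"
  defines "A \<equiv> (real B - real T) * r * tanh b"
  obtains s0 s1 where "r < s0" "s0 < s1" "jost (r + 1) s0 (- b) = 0"
    "\<And>s. r \<le> s \<Longrightarrow> s \<noteq> s0 \<Longrightarrow> jost (r + 1) s (- b) \<noteq> 0"
    "\<And>s. s0 < s \<Longrightarrow> log_deriv_sum (r + 1) B T b s = A \<longleftrightarrow> s = s1"
    "B < T \<Longrightarrow> \<exists>s2. r < s2 \<and> s2 < s0 \<and> (\<forall>s. r \<le> s \<and> s < s0 \<longrightarrow> (log_deriv_sum (r + 1) B T b s = A \<longleftrightarrow> s = s2))"
    "T < B \<Longrightarrow> \<forall>s. r \<le> s \<and> s < s0 \<longrightarrow> log_deriv_sum (r + 1) B T b s \<noteq> A"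
proof -
  have \<nu>: "0 \<le> r + 1" using r by auto
  obtain s0 where s0: "r < s0" "jost (r + 1) s0 (- b) = 0" "\<And>s. s0 < s \<Longrightarrow> 0 < jost (r + 1) s (- b)"
    "\<And>s. r \<le> s \<Longrightarrow> s < s0 \<Longrightarrow> jost (r + 1) s (- b) < 0" "0 < jost' (r + 1) s0 (- b)"
    using jost_node_parameter[OF r b] by metis
  let ?F = "log_deriv_sum (r + 1) B T b" and ?D = "secular (r + 1) B T b A"
  have jb: "0 < jost (r + 1) s b" if "r \<le> s" for s by (rule jost_pos_right[OF r that b])
  have cD: "continuous_on {a..c} ?D" if "r \<le> a" for a c
    by (rule continuous_on_subset[OF continuous_on_secular[OF \<nu>]]) (use that r in auto)
  \<comment> \<open>At the node parameter only the bump term survives, and the derivative at the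
    node is positive.\<close>
  have D0: "0 < ?D s0" using s0(2,5) jb[of s0] s0(1) B by (simp add: secular_def)
  have DF: "?D s = jost (r + 1) s b * jost (r + 1) s (- b) * (?F s - A)" if "r \<le> s" "s \<noteq> s0" for s
    by (rule secular_eq) (use s0(3)[of s] s0(4)[of s] jb[OF that(1)] that in fastforce)+
  have DFz: "?F s = A \<longleftrightarrow> ?D s = 0" if "r \<le> s" "s \<noteq> s0" for s
    using DF[OF that] s0(3)[of s] s0(4)[of s] jb[OF that(1)] that by fastforce
  have inj_up: "?F s < ?F k" if "s0 < k" "k < s" for k s
    by (rule log_deriv_sum_less) (use r s0 that b B in \<open>auto intro!: mult_pos_pos\<close>)
  have inj_down: "?F s < ?F k" if "r \<le> k" "k < s" "s < s0" for k s
    by (rule log_deriv_sum_less) (use r s0 that b B in \<open>auto intro!: mult_neg_neg\<close>)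
  have "0 < B + T" using B by simp
  then obtain S where S: "\<And>s. S \<le> s \<Longrightarrow> ?F s < A" using log_deriv_sum_large[OF \<nu>] by metis
  define M where "M = max S s0 + 1"
  have M: "s0 < M" "?F M < A" using S[of M] by (auto simp: M_def)
  have DM: "?D M < 0"
    using DF[of M] M s0(1) s0(3)[OF M(1)] jb[of M] by (simp add: mult_less_0_iff zero_less_mult_iff)
  have "\<exists>s\<ge>s0. s \<le> M \<and> ?D s = 0"
    by (rule IVT2'[OF _ _ _ cD]) (use D0 DM M s0(1) in auto)
  then obtain s1 where s1: "s0 \<le> s1" "?D s1 = 0" by blast
  have s01: "s0 < s1" using s1 D0 by (cases "s1 = s0") auto
  have F1: "?F s1 = A" using DFz[of s1] s1 s01 s0(1) by auto
  have up: "?F s = A \<longleftrightarrow> s = s1" if "s0 < s" for s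
    using inj_up[of s s1] inj_up[of s1 s] that s01 F1 by (cases s s1 rule: linorder_cases) auto
  have sr: "sgn (?D r) = sgn (real B - real T)" unfolding A_def by (rule secular_at_bottom[OF r b])
  show ?thesis
  proof (rule that[OF s0(1) s01 s0(2) _ up])
    show "jost (r + 1) s (- b) \<noteq> 0" if "r \<le> s" "s \<noteq> s0" for s
      using s0(3)[of s] s0(4)[of s] that by fastforce
    show "\<exists>s2. r < s2 \<and> s2 < s0 \<and> (\<forall>s. r \<le> s \<and> s < s0 \<longrightarrow> (?F s = A \<longleftrightarrow> s = s2))" if "B < T"
    proof -
      have Dr: "?D r < 0" using sr that by (simp add: sgn_if split: if_splits)
      have "\<exists>s\<ge>r. s \<le> s0 \<and> ?D s = 0"
        by (rule IVT'[OF _ _ _ cD]) (use D0 Dr s0(1) in auto)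
      then obtain s2 where s2: "r \<le> s2" "s2 \<le> s0" "?D s2 = 0" by blast
      then have s2': "r < s2" "s2 < s0" using Dr D0 by (cases "s2 = r"; cases "s2 = s0"; auto)+
      then have F2: "?F s2 = A" using DFz[of s2] s2 by auto
      have "?F s = A \<longleftrightarrow> s = s2" if "r \<le> s" "s < s0" for s
        using inj_down[of s s2] inj_down[of s2 s] that s2' F2 by (cases s s2 rule: linorder_cases) auto
      then show ?thesis using s2' by blast
    qed
    show "\<forall>s. r \<le> s \<and> s < s0 \<longrightarrow> ?F s \<noteq> A" if "T < B"
    proof -
      have "0 < ?D r" using sr that by (simp add: sgn_if split: if_splits)
      then have "?F r < A"
        using DF[of r] s0(1) s0(4)[of r] jb[of r] by (simp add: zero_less_mult_iff mult_less_0_iff)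
      then show ?thesis using inj_down[of r] by (metis dual_order.strict_trans order_less_irrefl le_less)
    qed
  qed
qed

text \<open>For B = 0 the secular function has the extra factor v_s(-b), which would add a spurious
  root at the node parameter. The function \<open>E\<close> omits it and obtains its sign at r by
  dividing by v_r(-b) < 0.\<close>

lemma secular_root_without_bumps:
  assumes r: "0 < r" and b: "0 < b" and T: "0 < T"
  obtains s1 where "r < s1" "\<And>s. r \<le> s \<Longrightarrow> log_deriv_sum (r + 1) 0 T b s = - (real T * r * tanh b) \<longleftrightarrow> s = s1"
proof -
  define A where "A = (real 0 - real T) * r * tanh b"
  have Ae: "A = - (real T * r * tanh b)" by (simp add: A_def)
  have \<nu>: "0 \<le> r + 1" using r by auto
  let ?F = "log_deriv_sum (r + 1) 0 T b"
  define E where "E s = real T * jost' (r + 1) s b - A * jost (r + 1) s b" for s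
  have jb: "0 < jost (r + 1) s b" if "r \<le> s" for s by (rule jost_pos_right[OF r that b])
  have EF: "E s = jost (r + 1) s b * (?F s - A)" if "r \<le> s" for s
    using jb[OF that] by (simp add: E_def log_deriv_sum_def field_simps)
  have inj: "?F s < ?F k" if "r \<le> k" "k < s" for k s
    by (rule log_deriv_sum_less) (use r that b T in auto)
  have "0 < 0 + T" using T by simp
  then obtain S where S: "\<And>s. S \<le> s \<Longrightarrow> ?F s < A" using log_deriv_sum_large[OF \<nu>] by metis
  define M where "M = max S r + 1"
  have M: "r < M" "?F M < A" using S[of M] by (auto simp: M_def)
  have EM: "E M < 0" using EF[of M] jb[of M] M by (simp add: mult_pos_neg)
  obtain c where c: "0 < c" "\<And>t. jost (r + 1) r t = c * (tanh t * sech_powr r t)"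
    using jost_excited[OF r] by metis
  have neg: "jost (r + 1) r (- b) < 0"
    unfolding c(2) using c(1) sech_powr_pos[of r "- b"] b by (simp add: mult_pos_neg mult_neg_pos)
  have "sgn (secular (r + 1) 0 T b A r) = sgn (real 0 - real T)"
    unfolding A_def by (rule secular_at_bottom[OF r b])
  then have "secular (r + 1) 0 T b A r < 0" using T by (simp add: sgn_if split: if_splits)
  moreover have "secular (r + 1) 0 T b A r = jost (r + 1) r (- b) * E r"
    by (simp add: secular_def E_def algebra_simps)
  ultimately have Er: "0 < E r" using neg by (simp add: mult_less_0_iff)
  have "continuous_on {r..M} E"
    unfolding E_def[abs_def]
    by (intro continuous_intros continuous_on_subset[OF continuous_on_jost_parameter(1)[OF \<nu>]]
        continuous_on_subset[OF continuous_on_jost_parameter(2)[OF \<nu>]]) (use r in auto)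
  then have "\<exists>s\<ge>r. s \<le> M \<and> E s = 0"
    by (intro IVT2') (use Er EM M in auto)
  then obtain s1 where s1: "r \<le> s1" "E s1 = 0" by blast
  have F1: "?F s1 = A" using EF[OF s1(1)] s1(2) jb[OF s1(1)] by simp
  show ?thesis
  proof (rule that[of s1])
    show "r < s1" using s1 Er by (cases "s1 = r") auto
    show "?F s = - (real T * r * tanh b) \<longleftrightarrow> s = s1" if "r \<le> s" for s
      unfolding Ae[symmetric]
      using inj[of s s1] inj[of s1 s] that s1 F1 by (cases s s1 rule: linorder_cases) auto
  qed
qed

text \<open>For \<nu> = r the reference solution sech^r t is positive, so no v_s with s \<ge> r has
  a node. The sum therefore decreases on all of [r, infinity), starting from exactly the required
  value.\<close>

lemma jost_ground_family:
  assumes r: "0 < r" and b: "0 < b" and BT: "0 < B + T" and s: "r \<le> s"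
  shows "0 < jost r s t"
    and "log_deriv_sum r B T b s = (real B - real T) * r * tanh b \<longleftrightarrow> s = r"
proof -
  have r0: "0 \<le> r" using r by simp
  obtain c where c: "0 < c" "\<And>t. jost r r t = c * sech_powr r t" "\<And>t. jost' r r t = c * (- r * tanh t * sech_powr r t)"
    using jost_ground[OF r] by metis
  have p: "0 < jost r r t" for t unfolding c(2) using c(1) sech_powr_pos by simp
  have pos: "0 < jost r s t" if "r \<le> s" for s t
    using jost_pos_by_comparison[OF r0 r, of s t t] p that by (cases "s = r") (auto simp: less_imp_le)
  show "0 < jost r s t" by (rule pos[OF s])
  have q: "jost' r r t / jost r r t = - r * tanh t" for t
    unfolding c(2,3) using c(1) sech_powr_pos[of r t] by simp
  have Fr: "log_deriv_sum r B T b r = (real B - real T) * r * tanh b"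
    unfolding log_deriv_sum_def q by (simp add: algebra_simps)
  have "log_deriv_sum r B T b s < log_deriv_sum r B T b r" if "r < s"
  proof -
    have less: "jost' r s x / jost r s x < jost' r r x / jost r r x" for x
      using that by (intro ratio_less_if_wronskian_neg wronskian_neg[OF r0 r that] mult_pos_pos pos) auto
    show ?thesis
    proof (cases "B = 0")
      case True then show ?thesis unfolding log_deriv_sum_def using less BT
        by (intro add_le_less_mono mult_strict_left_mono) auto
    next
      case False then show ?thesis unfolding log_deriv_sum_def using less
        by (intro add_less_le_mono mult_strict_left_mono mult_left_mono less_imp_le[OF less]) auto
    qed
  qed
  then show "log_deriv_sum r B T b s = (real B - real T) * r * tanh b \<longleftrightarrow> s = r"
    using s Fr by (cases "s = r") auto
qed

section \<open>Eigenspaces of the Hessian operators\<close>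

text \<open>Independence is stated for the indexed family and makes \<open>e\<close> injective on
  \<open>I\<close>: a repeated vector would give a relation with coefficients 1 and -1. The empty
  index set covers the zero space, so the second claim decides at the same time whether there is an
  eigenvector.\<close>

lemma subspace_dim_of_basis:
  fixes e :: "'i \<Rightarrow> graph_fun"
  assumes I: "finite I"
    and inj: "\<And>k i. (\<Sum>i\<in>I. graph_scale (k i) (e i)) = 0 \<Longrightarrow> i \<in> I \<Longrightarrow> k i = 0"
    and S: "S = range (\<lambda>k. \<Sum>i\<in>I. graph_scale (k i) (e i))"
  shows "subspace_dim S = enat (card I)" "(\<exists>\<Psi>\<in>S. \<Psi> \<noteq> 0) \<longleftrightarrow> I \<noteq> {}"
proof -
  have inje: "inj_on e I"
  proof (rule inj_onI, rule ccontr)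
    fix i j assume ij: "i \<in> I" "j \<in> I" "e i = e j" "i \<noteq> j"
    define k :: "'i \<Rightarrow> complex" where "k l = (if l = i then 1 else if l = j then -1 else 0)" for l
    have "(\<Sum>l\<in>I. graph_scale (k l) (e l)) = (\<Sum>l\<in>{i, j}. graph_scale (k l) (e l))"
      by (rule sum.mono_neutral_right) (use I ij in \<open>auto simp: k_def graph_scale_def fun_eq_iff\<close>)
    also have "\<dots> = 0" using ij by (simp add: k_def graph_scale_def fun_eq_iff)
    finally have "k i = 0" using inj ij(1) by blast
    then show False by (simp add: k_def)
  qed
  have re: "(\<Sum>x\<in>e ` I. graph_scale (f x) x) = (\<Sum>i\<in>I. graph_scale (f (e i)) (e i))" for f
    by (simp add: sum.reindex[OF inje])
  have ind: "graph.independent (e ` I)"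
  proof (rule graph.independent_if_scalars_zero)
    fix f x assume "(\<Sum>x\<in>e ` I. graph_scale (f x) x) = 0" "x \<in> e ` I"
    then show "f x = 0" unfolding re using inj[of "\<lambda>i. f (e i)"] by auto
  qed (use I in simp)
  have span: "graph.span (e ` I) = S"
  proof -
    have "graph.span (e ` I) = range (\<lambda>f. \<Sum>i\<in>I. graph_scale (f (e i)) (e i))"
      by (subst graph.span_finite) (use I re in auto)
    also have "\<dots> = S"
    proof (intro equalityI subsetI)
      fix x assume "x \<in> range (\<lambda>f. \<Sum>i\<in>I. graph_scale (f (e i)) (e i))"
      then obtain f where x: "x = (\<Sum>i\<in>I. graph_scale (f (e i)) (e i))" by auto
      show "x \<in> S" unfolding S by (rule range_eqI[where x = "\<lambda>i. f (e i)"]) (rule x)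
    next
      fix x assume "x \<in> S"
      then obtain k where "x = (\<Sum>i\<in>I. graph_scale (k i) (e i))" unfolding S by auto
      also have "\<dots> = (\<Sum>i\<in>I. graph_scale (k (the_inv_into I e (e i))) (e i))"
        by (rule sum.cong) (simp_all add: the_inv_into_f_f[OF inje])
      finally show "x \<in> range (\<lambda>f. \<Sum>i\<in>I. graph_scale (f (e i)) (e i))"
        by (rule range_eqI[where x = "\<lambda>x. k (the_inv_into I e x)"])
    qed
    finally show ?thesis .
  qed
  have "graph.dim S = card I"
    using graph.dim_span_eq_card_independent[OF ind] by (simp add: span card_image[OF inje])
  then show "subspace_dim S = enat (card I)"
    unfolding subspace_dim_def using I span by (auto intro: exI[of _ "e ` I"])
  show "(\<exists>\<Psi>\<in>S. \<Psi> \<noteq> 0) \<longleftrightarrow> I \<noteq> {}"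
  proof
    assume "I \<noteq> {}"
    then obtain i where i: "i \<in> I" by blast
    have "(\<Sum>i\<in>I. graph_scale 1 (e i)) \<noteq> 0"
      using inj[of "\<lambda>_. 1" i] i by auto
    moreover have "(\<Sum>i\<in>I. graph_scale 1 (e i)) \<in> S"
      unfolding S by (rule range_eqI[where x = "\<lambda>_. 1"]) (rule refl)
    ultimately show "\<exists>\<Psi>\<in>S. \<Psi> \<noteq> 0" by (rule bexI)
  qed (auto simp: S)
qed

section \<open>Solutions on a single edge\<close>

definition edge_function :: "(real \<Rightarrow> real) \<Rightarrow> complex \<Rightarrow> real \<Rightarrow> complex" where
  "edge_function u C x = (if x < 0 then 0 else C * of_real (u x))"

lemma jost_scaled_deriv:
  assumes "0 \<le> \<nu>" "0 \<le> s"
  shows "((\<lambda>x. jost \<nu> s (\<beta> * (x + \<sigma>))) has_real_derivative \<beta> * jost' \<nu> s (\<beta> * (x + \<sigma>))) (at x)"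
    "((\<lambda>x. \<beta> * jost' \<nu> s (\<beta> * (x + \<sigma>))) has_real_derivative
      \<beta>\<^sup>2 * jost_potential \<nu> s (\<beta> * (x + \<sigma>)) * jost \<nu> s (\<beta> * (x + \<sigma>))) (at x)"
proof -
  have lin: "((\<lambda>x. \<beta> * (x + \<sigma>)) has_real_derivative \<beta>) (at x)"
    by (auto intro!: derivative_eq_intros)
  show "((\<lambda>x. jost \<nu> s (\<beta> * (x + \<sigma>))) has_real_derivative \<beta> * jost' \<nu> s (\<beta> * (x + \<sigma>))) (at x)"
    using DERIV_chain2[OF jost_deriv[OF assms] lin] by (simp add: mult.commute)
  show "((\<lambda>x. \<beta> * jost' \<nu> s (\<beta> * (x + \<sigma>))) has_real_derivative
      \<beta>\<^sup>2 * jost_potential \<nu> s (\<beta> * (x + \<sigma>)) * jost \<nu> s (\<beta> * (x + \<sigma>))) (at x)"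
    by (rule DERIV_cong[OF DERIV_cmult[OF DERIV_chain2[OF jost'_deriv[OF assms] lin]]])
      (simp add: power2_eq_square mult_ac)
qed

lemma jost_scaled_decay:
  assumes \<nu>: "0 \<le> \<nu>" and s: "0 < s" and \<beta>: "0 < \<beta>"
  obtains C where "\<And>x. 0 \<le> x \<Longrightarrow> \<bar>jost \<nu> s (\<beta> * (x + \<sigma>))\<bar> \<le> C * exp (- (s * \<beta>) * x)"
    "\<And>x. 0 \<le> x \<Longrightarrow> \<bar>\<beta> * jost' \<nu> s (\<beta> * (x + \<sigma>))\<bar> \<le> C * exp (- (s * \<beta>) * x)"
    "\<And>x. 0 \<le> x \<Longrightarrow> \<bar>\<beta>\<^sup>2 * jost_potential \<nu> s (\<beta> * (x + \<sigma>)) * jost \<nu> s (\<beta> * (x + \<sigma>))\<bar> \<le> C * exp (- (s * \<beta>) * x)"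
proof -
  obtain D where D: "\<And>t. \<beta> * \<sigma> \<le> t \<Longrightarrow> \<bar>jost \<nu> s t\<bar> \<le> D * exp (- s * t)"
    "\<And>t. \<beta> * \<sigma> \<le> t \<Longrightarrow> \<bar>jost' \<nu> s t\<bar> \<le> D * exp (- s * t)"
    using jost_decay[OF \<nu> less_imp_le[OF s]] by metis
  have D0: "0 \<le> D" using order_trans[OF abs_ge_zero D(1)[of "\<beta> * \<sigma>"]] by (simp add: zero_le_mult_iff)
  define C0 where "C0 = D * exp (- s * \<beta> * \<sigma>)"
  have C0: "0 \<le> C0" using D0 by (simp add: C0_def)
  have b: "\<bar>jost \<nu> s (\<beta> * (x + \<sigma>))\<bar> \<le> C0 * exp (- (s * \<beta>) * x)"
    "\<bar>jost' \<nu> s (\<beta> * (x + \<sigma>))\<bar> \<le> C0 * exp (- (s * \<beta>) * x)" if "0 \<le> x" for x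
  proof -
    have "\<beta> * \<sigma> \<le> \<beta> * (x + \<sigma>)" using that \<beta> by simp
    moreover have "D * exp (- s * (\<beta> * (x + \<sigma>))) = C0 * exp (- (s * \<beta>) * x)"
      by (simp add: C0_def exp_add[symmetric] algebra_simps)
    ultimately show "\<bar>jost \<nu> s (\<beta> * (x + \<sigma>))\<bar> \<le> C0 * exp (- (s * \<beta>) * x)"
      "\<bar>jost' \<nu> s (\<beta> * (x + \<sigma>))\<bar> \<le> C0 * exp (- (s * \<beta>) * x)" using D by metis+
  qed
  define Q where "Q = \<beta>\<^sup>2 * (s\<^sup>2 + \<nu> * (\<nu> + 1) * 2)"
  \<comment> \<open>One constant for all three bounds: 1, \<beta> and \<open>Q\<close> bound the
    factors in the function and its first and second derivative.\<close>
  define C where "C = (1 + \<beta> + Q) * C0"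
  have Q: "0 \<le> Q" using \<nu> by (simp add: Q_def)
  have up: "k * y \<le> C * exp (- (s * \<beta>) * x)" if "0 \<le> k" "k \<le> 1 + \<beta> + Q" "y \<le> C0 * exp (- (s * \<beta>) * x)" for k y x
  proof -
    have "k * y \<le> k * (C0 * exp (- (s * \<beta>) * x))" using that by (intro mult_left_mono)
    also have "\<dots> \<le> (1 + \<beta> + Q) * (C0 * exp (- (s * \<beta>) * x))" using that C0 by (intro mult_right_mono) auto
    finally show ?thesis by (simp add: C_def mult_ac)
  qed
  show ?thesis
  proof (rule that[of C])
    fix x :: real assume x: "0 \<le> x"
    show "\<bar>jost \<nu> s (\<beta> * (x + \<sigma>))\<bar> \<le> C * exp (- (s * \<beta>) * x)"
      using up[OF _ _ b(1)[OF x], of 1] \<beta> Q by simp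
    show "\<bar>\<beta> * jost' \<nu> s (\<beta> * (x + \<sigma>))\<bar> \<le> C * exp (- (s * \<beta>) * x)"
      using up[OF _ _ b(2)[OF x], of \<beta>] \<beta> Q by (simp add: abs_mult)
    let ?q = "\<beta>\<^sup>2 * jost_potential \<nu> s (\<beta> * (x + \<sigma>))"
    have "\<bar>?q\<bar> \<le> Q"
      unfolding abs_mult Q_def using jost_potential_bounded[OF \<nu>] by (intro mult_mono) auto
    then have "\<bar>?q\<bar> \<le> 1 + \<beta> + Q" using \<beta> by simp
    from up[OF abs_ge_zero this b(1)[OF x]]
    show "\<bar>?q * jost \<nu> s (\<beta> * (x + \<sigma>))\<bar> \<le> C * exp (- (s * \<beta>) * x)"
      by (simp only: abs_mult[of ?q])
  qed
qed

lemma edge_function_jost: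
  fixes \<nu> s \<beta> \<sigma> :: real
  assumes \<nu>: "0 \<le> \<nu>" and s: "0 < s" and \<beta>: "0 < \<beta>"
  defines "u \<equiv> (\<lambda>x. jost \<nu> s (\<beta> * (x + \<sigma>)))"
    and "q \<equiv> (\<lambda>x. \<beta>\<^sup>2 * jost_potential \<nu> s (\<beta> * (x + \<sigma>)))"
  shows "edge_function u C \<in> H2_half"
    "AE x in lborel. 0 < x \<longrightarrow> weak_deriv (weak_deriv (edge_function u C)) x = q x *\<^sub>R edge_function u C x"
    "vector_derivative (edge_function u C) (at_right 0) = C * of_real (\<beta> * jost' \<nu> s (\<beta> * \<sigma>))"
proof -
  note s0 = less_imp_le[OF s]
  obtain D where D: "\<And>x. 0 \<le> x \<Longrightarrow> \<bar>jost \<nu> s (\<beta> * (x + \<sigma>))\<bar> \<le> D * exp (- (s * \<beta>) * x)"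
    "\<And>x. 0 \<le> x \<Longrightarrow> \<bar>\<beta> * jost' \<nu> s (\<beta> * (x + \<sigma>))\<bar> \<le> D * exp (- (s * \<beta>) * x)"
    "\<And>x. 0 \<le> x \<Longrightarrow> \<bar>\<beta>\<^sup>2 * jost_potential \<nu> s (\<beta> * (x + \<sigma>)) * jost \<nu> s (\<beta> * (x + \<sigma>))\<bar> \<le> D * exp (- (s * \<beta>) * x)"
    by (rule jost_scaled_decay[OF \<nu> s \<beta>, where \<sigma> = \<sigma>]) blast
  have cj: "continuous_on UNIV (jost \<nu> s)"
    by (rule DERIV_continuous_on[of UNIV "jost \<nu> s" "jost' \<nu> s"]) (rule jost_deriv[OF \<nu> s0])
  have c2: "continuous_on UNIV (\<lambda>x. \<beta>\<^sup>2 * jost_potential \<nu> s (\<beta> * (x + \<sigma>)) * jost \<nu> s (\<beta> * (x + \<sigma>)))"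
    by (intro continuous_intros continuous_on_compose2[OF cj]) (auto simp: less_imp_neq[THEN not_sym])
  have e: "edge_function u C = (\<lambda>x. if x < 0 then 0 else C * complex_of_real (jost \<nu> s (\<beta> * (x + \<sigma>))))"
    by (auto simp: edge_function_def u_def)
  note * = decaying_classical_in_H2_half[OF jost_scaled_deriv(1)[OF \<nu> s0] jost_scaled_deriv(2)[OF \<nu> s0] c2 mult_pos_pos[OF s \<beta>] D, of C]
  show "edge_function u C \<in> H2_half"
    unfolding e by (rule *(1))
  show "AE x in lborel. 0 < x \<longrightarrow> weak_deriv (weak_deriv (edge_function u C)) x = q x *\<^sub>R edge_function u C x"
  proof -
    have "AE x in lborel. 0 < x \<longrightarrow> weak_deriv (weak_deriv (edge_function u C)) x = C * of_real (q x * u x)"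
      unfolding e unfolding q_def u_def by (rule *(2))
    then show ?thesis
      by eventually_elim (simp add: edge_function_def scaleR_conv_of_real)
  qed
  show "vector_derivative (edge_function u C) (at_right 0) = C * of_real (\<beta> * jost' \<nu> s (\<beta> * \<sigma>))"
    unfolding e by (rule trans[OF *(3)]) simp_all
qed

text \<open>The Wronskian of an $L^2$ solution with $L^2$ derivative and the decaying solution is constant
  and integrable on the half-line, hence zero.\<close>

lemma H2_half_solution_is_jost:
  fixes \<nu> s \<beta> \<sigma> :: real
  assumes \<nu>: "0 \<le> \<nu>" and s: "0 < s" and \<beta>: "0 < \<beta>"
  defines "u \<equiv> (\<lambda>x. jost \<nu> s (\<beta> * (x + \<sigma>)))"
    and "q \<equiv> (\<lambda>x. \<beta>\<^sup>2 * jost_potential \<nu> s (\<beta> * (x + \<sigma>)))"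
  assumes f: "f \<in> H2_half" and ae: "AE x in lborel. 0 < x \<longrightarrow> weak_deriv (weak_deriv f) x = q x *\<^sub>R f x"
  obtains C where "f = edge_function u C"
proof -
  note s0 = less_imp_le[OF s]
  define u' where "u' x = \<beta> * jost' \<nu> s (\<beta> * (x + \<sigma>))" for x
  have du: "(u has_real_derivative u' x) (at x)" "(u' has_real_derivative q x * u x) (at x)" for x
    unfolding u_def u'_def[abs_def] q_def by (rule jost_scaled_deriv[OF \<nu> s0])+
  have cf: "continuous_on {0..} f" and fL: "f \<in> L2_half" and fneg: "\<And>x. x < 0 \<Longrightarrow> f x = 0"
    using f by (auto simp: H2_half_def)
  have cf': "continuous_on {0<..} f" by (rule continuous_on_subset[OF cf]) auto
  have cq: "continuous_on {0<..} q" unfolding q_def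
    by (intro continuous_intros) (auto simp: less_imp_neq[THEN not_sym])
  obtain f' where f': "\<And>x. 0 < x \<Longrightarrow> (f has_vector_derivative f' x) (at x)"
    "\<And>x. 0 < x \<Longrightarrow> (f' has_vector_derivative q x *\<^sub>R f x) (at x)" and fL': "f' \<in> L2_half"
    using weak_solution_is_classical[OF cf' H2_half_weak_derivs[OF f] ae cq] by metis
  obtain D where D: "\<And>x. 0 \<le> x \<Longrightarrow> \<bar>u x\<bar> \<le> D * exp (- (s * \<beta>) * x)" "\<And>x. 0 \<le> x \<Longrightarrow> \<bar>u' x\<bar> \<le> D * exp (- (s * \<beta>) * x)"
    using jost_scaled_decay[OF \<nu> s \<beta>] unfolding u_def u'_def by metis
  have cu: "continuous_on S u" "continuous_on S u'" for S
    using DERIV_continuous_on[of S u u'] DERIV_continuous_on[of S u' "\<lambda>x. q x * u x"] du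
      has_field_derivative_at_within by blast+
  have uL: "(\<lambda>x. complex_of_real (u x)) \<in> L2_half" "(\<lambda>x. complex_of_real (u' x)) \<in> L2_half"
  proof -
    have "(\<lambda>x. complex_of_real (k x)) \<in> L2_half"
      if "continuous_on {0<..} k" "\<And>x. 0 \<le> x \<Longrightarrow> \<bar>k x\<bar> \<le> D * exp (- (s * \<beta>) * x)" for k
      by (rule L2_half_exp_decay[where C = D and s = "s * \<beta>"]) (use that s \<beta> in \<open>auto intro!: continuous_intros\<close>)
    then show "(\<lambda>x. complex_of_real (u x)) \<in> L2_half" "(\<lambda>x. complex_of_real (u' x)) \<in> L2_half"
      using cu D by blast+
  qed
  define W where "W x = u x *\<^sub>R f' x - u' x *\<^sub>R f x" for x
  have dW: "(W has_vector_derivative 0) (at x)" if "0 < x" for x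
  proof -
    have "(W has_vector_derivative (u x *\<^sub>R (q x *\<^sub>R f x) + u' x *\<^sub>R f' x) - (u' x *\<^sub>R f' x + (q x * u x) *\<^sub>R f x)) (at x)"
      unfolding W_def[abs_def]
      by (intro has_vector_derivative_diff has_vector_derivative_scaleR du f' that)
    then show ?thesis by (simp add: mult.commute)
  qed
  have "\<exists>c. \<forall>x\<in>{0<..}. W x = c"
    by (rule has_derivative_zero_constant)
      (use dW in \<open>auto simp: has_vector_derivative_def intro: has_derivative_at_withinI\<close>)
  then obtain c where c: "\<And>x. 0 < x \<Longrightarrow> W x = c" by auto
  have "set_integrable lborel {0<..} (\<lambda>x::real. c)"
  proof (rule set_integrable_bound)
    have i: "set_integrable lborel {0<..} (\<lambda>x. (cmod (k x))\<^sup>2)" if "k \<in> L2_half" for k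
      using that by (simp add: L2_half_def)
    show "set_integrable lborel {0<..} (\<lambda>x. ((cmod (complex_of_real (u x)))\<^sup>2 + (cmod (f' x))\<^sup>2) + ((cmod (complex_of_real (u' x)))\<^sup>2 + (cmod (f x))\<^sup>2))"
      by (intro set_integral_add i uL fL fL')
    show "set_borel_measurable lborel {0<..} (\<lambda>x::real. c)"
      by (rule set_borel_measurable_halfline_continuous) simp
    show "AE x in lborel. x \<in> {0<..} \<longrightarrow> norm c \<le> norm (((cmod (complex_of_real (u x)))\<^sup>2 + (cmod (f' x))\<^sup>2) + ((cmod (complex_of_real (u' x)))\<^sup>2 + (cmod (f x))\<^sup>2))"
    proof (intro AE_I2 impI)
      fix x :: real assume "x \<in> {0<..}"
      then have "norm c = norm (u x *\<^sub>R f' x - u' x *\<^sub>R f x)" using c[of x] by (simp add: W_def)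
      also have "\<dots> \<le> \<bar>u x\<bar> * cmod (f' x) + \<bar>u' x\<bar> * cmod (f x)"
        using norm_triangle_ineq4[of "u x *\<^sub>R f' x" "u' x *\<^sub>R f x"] by simp
      also have "\<dots> \<le> (\<bar>u x\<bar>\<^sup>2 + (cmod (f' x))\<^sup>2) + (\<bar>u' x\<bar>\<^sup>2 + (cmod (f x))\<^sup>2)"
      proof -
        have "a * b \<le> a\<^sup>2 + b\<^sup>2" for a b :: real
          using sum_squares_bound[of a b] zero_le_power2[of a] zero_le_power2[of b]
            zero_le_power2[of "a + b"] by (simp add: power2_sum)
        then show ?thesis by (intro add_mono)
      qed
      finally show "norm c \<le> norm (((cmod (complex_of_real (u x)))\<^sup>2 + (cmod (f' x))\<^sup>2) + ((cmod (complex_of_real (u' x)))\<^sup>2 + (cmod (f x))\<^sup>2))"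
        by simp
    qed
  qed
  then have c0: "c = 0" by (rule set_integrable_halfline_const)
  have "\<forall>\<^sub>F x in at_top. 0 < u x \<and> 0 < x"
  proof -
    have "filterlim (\<lambda>x. \<beta> * (x + \<sigma>)) at_top at_top"
      using \<beta> by real_asymp
    from eventually_compose_filterlim[OF jost_eventually_pos[OF \<nu> s0] this] eventually_gt_at_top[of 0]
    show ?thesis by eventually_elim (simp add: u_def)
  qed
  then obtain X where X: "0 < u X" "0 < X" using eventually_happens[of _ at_top] by fastforce
  have q_bd: "\<bar>q x\<bar> \<le> \<beta>\<^sup>2 * (s\<^sup>2 + \<nu> * (\<nu> + 1) * 2)" for x
    unfolding q_def abs_mult using jost_potential_bounded[OF \<nu>] by (intro mult_mono) auto
  \<comment> \<open>The uniqueness lemma is real-valued; it is applied to the real and imaginary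
    parts of f, whose Wronskians with u vanish at \<open>X\<close>.\<close>
  have part: "L (f x) = L (f X) / u X * u x" if L: "bounded_linear L" and x: "0 < x" for L :: "complex \<Rightarrow> real" and x
  proof -
    interpret bounded_linear L by fact
    have d: "((\<lambda>x. L (f x)) has_real_derivative L (f' x)) (at x)"
      "((\<lambda>x. L (f' x)) has_real_derivative q x * L (f x)) (at x)" if "x \<in> {0<..}" for x
      using has_vector_derivative[OF f'(1)[of x]] has_vector_derivative[OF f'(2)[of x]] that
      by (simp_all add: has_real_derivative_iff_has_vector_derivative scale)
    have "L (W X) = 0" using c[OF X(2)] c0 by (simp add: zero)
    then have w: "L (f' X) * u X = L (f X) * u' X" by (simp add: W_def diff scale mult.commute)
    show ?thesis
      by (rule multiple_if_wronskian_zero(1)[where S = "{0<..}" and v' = u' and w' = "\<lambda>x. L (f' x)" and q = q])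
        (use du d q_bd w X x in auto)
  qed
  define C where "C = Complex (Re (f X) / u X) (Im (f X) / u X)"
  have eq: "f x = C * of_real (u x)" if "0 < x" for x
    using part[OF bounded_linear_Re that] part[OF bounded_linear_Im that] by (simp add: C_def complex_eq_iff)
  have "f x = edge_function u C x" for x
  proof -
    consider "x < 0" | "0 \<le> x" by linarith
    then show ?thesis
    proof cases
      case 2
      \<comment> \<open>The differential equation says nothing at x = 0; there the identity follows
        from the continuity up to the vertex that \<open>H2_half\<close> demands.\<close>
      have "f x - C * of_real (u x) = 0"
      proof (rule continuous_constant_on_closure[of "{0<..}" "\<lambda>x. f x - C * of_real (u x)" 0 x])
        show "continuous_on (closure {0<..}) (\<lambda>x. f x - C * of_real (u x))"
          by (intro continuous_intros cu continuous_on_subset[OF cf]) auto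
      qed (use eq 2 in auto)
      then show ?thesis using 2 by (simp add: edge_function_def)
    qed (simp add: edge_function_def fneg)
  qed
  then show ?thesis by (intro that[of C]) (rule ext)
qed

section \<open>The vertex conditions as linear algebra\<close>

lemma graph_sum_apply:
  fixes f :: "'i \<Rightarrow> graph_fun"
  shows "(\<Sum>i\<in>I. f i) j x = (\<Sum>i\<in>I. f i j x)"
  by (induction I rule: infinite_finite_induct) (simp_all add: zero_fun_def plus_fun_def)

definition star_function :: "nat \<Rightarrow> (nat \<Rightarrow> real \<Rightarrow> real) \<Rightarrow> (nat \<Rightarrow> complex) \<Rightarrow> graph_fun" where
  "star_function N u C = (\<lambda>j. if j \<in> {1..N} then edge_function (u j) (C j) else (\<lambda>x. 0))"

lemma star_function_sum:
  "(\<Sum>i\<in>I. graph_scale (k i) (star_function N u (C i))) = star_function N u (\<lambda>j. \<Sum>i\<in>I. k i * C i j)"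
proof (intro ext)
  fix j x
  show "(\<Sum>i\<in>I. graph_scale (k i) (star_function N u (C i))) j x = star_function N u (\<lambda>j. \<Sum>i\<in>I. k i * C i j) j x"
    by (cases "j \<in> {1..N}") (simp_all add: graph_sum_apply star_function_def edge_function_def graph_scale_def
      sum_distrib_right mult.assoc del: atLeastAtMost_iff)
qed

lemma star_function_cong:
  "(\<And>j. j \<in> {1..N} \<Longrightarrow> C j = C' j) \<Longrightarrow> star_function N u C = star_function N u C'"
  by (auto simp: star_function_def fun_eq_iff)

lemma star_function_eq_0:
  assumes "star_function N u C = 0" "j \<in> {1..N}" "0 \<le> x" "u j x \<noteq> 0"
  shows "C j = 0"
proof -
  have "star_function N u C j x = 0" using assms(1) by (simp add: zero_fun_def)
  then show ?thesis using assms(2-4) by (simp add: star_function_def edge_function_def)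
qed

text \<open>By \<open>st\<close> and \<open>\<mu>\<close> the eigenvalue equation on edge j reads
  w'' = q w, which leaves one free coefficient \<open>C j\<close>. What remains of the domain are
  the vertex conditions, finitely many linear equations for these coefficients.\<close>

lemma eigenspace_hessian:
  fixes \<sigma> :: "nat \<Rightarrow> real"
  assumes N: "1 \<le> N" and \<nu>: "0 \<le> \<nu>" and s: "0 < s" and \<beta>: "0 < \<beta>"
    and st: "\<And>j x. j \<in> {1..N} \<Longrightarrow> c * stationary_state N K p \<alpha> \<omega> j x powr (2 * p) =
        \<beta>\<^sup>2 * (\<nu> * (\<nu> + 1) * (1 - (tanh (\<beta> * (x + \<sigma> j)))\<^sup>2))"
    and \<mu>: "\<mu> = \<omega> - \<beta>\<^sup>2 * s\<^sup>2"
  defines "u \<equiv> (\<lambda>j x. jost \<nu> s (\<beta> * (x + \<sigma> j)))"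
  shows "eigenspace (hessian c N K p \<alpha> \<omega>) \<mu> = star_function N u ` {C.
    (\<forall>i\<in>{1..N}. \<forall>j\<in>{1..N}. C i * of_real (jost \<nu> s (\<beta> * \<sigma> i)) = C j * of_real (jost \<nu> s (\<beta> * \<sigma> j))) \<and>
    (\<Sum>j=1..N. C j * of_real (\<beta> * jost' \<nu> s (\<beta> * \<sigma> j))) = of_real \<alpha> * (C 1 * of_real (jost \<nu> s (\<beta> * \<sigma> 1)))}"
    (is "?E = star_function N u ` ?V")
proof -
  define q where "q j x = \<beta>\<^sup>2 * jost_potential \<nu> s (\<beta> * (x + \<sigma> j))" for j x
  have st': "complex_of_real (c * stationary_state N K p \<alpha> \<omega> j x powr (2 * p)) = of_real (\<omega> - \<mu> - q j x)" if "j \<in> {1..N}" for j x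
    unfolding st[OF that] by (simp add: q_def \<mu> algebra_simps)
  have eqv: "- L + of_real \<omega> * y - of_real (c * stationary_state N K p \<alpha> \<omega> j x powr (2 * p)) * y = of_real \<mu> * y
      \<longleftrightarrow> L = q j x *\<^sub>R y" if "j \<in> {1..N}" for j x and L y :: complex
    unfolding st'[OF that] by (auto simp: algebra_simps scaleR_conv_of_real)
  have u0: "edge_function (u j) C 0 = C * of_real (jost \<nu> s (\<beta> * \<sigma> j))" for j C
    by (simp add: edge_function_def u_def)
  note edge = edge_function_jost[OF \<nu> s \<beta>]
  have mem: "star_function N u C \<in> dom_laplacian N \<alpha> \<longleftrightarrow> C \<in> ?V" for C
  proof -
    have "star_function N u C \<in> H2_graph N"
      by (auto simp: H2_graph_def star_function_def u_def intro: edge(1))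
    moreover have "star_function N u C j 0 = C j * of_real (jost \<nu> s (\<beta> * \<sigma> j))" if "j \<in> {1..N}" for j
      using that u0 by (simp add: star_function_def)
    moreover have "vector_derivative (star_function N u C j) (at_right 0) = C j * of_real (\<beta> * jost' \<nu> s (\<beta> * \<sigma> j))" if "j \<in> {1..N}" for j
      using that edge(3) by (simp add: star_function_def u_def)
    ultimately show ?thesis using N unfolding dom_laplacian_def by simp
  qed
  show ?thesis
  proof (intro equalityI subsetI)
    fix \<Psi> assume "\<Psi> \<in> ?E"
    then have dom: "\<Psi> \<in> dom_laplacian N \<alpha>"
      and ae: "\<And>j. AE x in lborel. 0 < x \<longrightarrow> - laplacian N \<Psi> j x + of_real \<omega> * \<Psi> j x
              - of_real (c * stationary_state N K p \<alpha> \<omega> j x powr (2 * p)) * \<Psi> j x = of_real \<mu> * \<Psi> j x"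
      by (auto simp: eigenspace_def hessian_def)
    have H2: "\<And>j. j \<in> {1..N} \<Longrightarrow> \<Psi> j \<in> H2_half" "\<And>j. j \<notin> {1..N} \<Longrightarrow> \<Psi> j = (\<lambda>x. 0)"
      using dom by (auto simp: dom_laplacian_def H2_graph_def)
    have "\<exists>C. \<Psi> j = edge_function (u j) C" if j: "j \<in> {1..N}" for j
    proof -
      have "AE x in lborel. 0 < x \<longrightarrow> weak_deriv (weak_deriv (\<Psi> j)) x = q j x *\<^sub>R \<Psi> j x"
        using ae[of j]
      proof eventually_elim
        case (elim x)
        then show ?case unfolding eqv[OF j] using j by (simp add: laplacian_def)
      qed
      then show ?thesis
        using H2_half_solution_is_jost[OF \<nu> s \<beta> H2(1)[OF j], of "\<sigma> j"] unfolding q_def u_def by blast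
    qed
    then obtain C where "\<And>j. j \<in> {1..N} \<Longrightarrow> \<Psi> j = edge_function (u j) (C j)" by metis
    with H2(2) have eq: "\<Psi> = star_function N u C" by (auto simp: star_function_def)
    have "star_function N u C \<in> dom_laplacian N \<alpha>" using dom unfolding eq .
    then have "C \<in> ?V" by (rule mem[THEN iffD1])
    with eq show "\<Psi> \<in> star_function N u ` ?V" by blast
  next
    fix \<Psi> assume "\<Psi> \<in> star_function N u ` ?V"
    then obtain C where C: "C \<in> ?V" "\<Psi> = star_function N u C" by blast
    have dom: "\<Psi> \<in> dom_laplacian N \<alpha>" unfolding C(2) by (rule mem[THEN iffD2, OF C(1)])
    have "AE x in lborel. 0 < x \<longrightarrow> - laplacian N \<Psi> j x + of_real \<omega> * \<Psi> j x
              - of_real (c * stationary_state N K p \<alpha> \<omega> j x powr (2 * p)) * \<Psi> j x = of_real \<mu> * \<Psi> j x" for j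
    proof (cases "j \<in> {1..N}")
      case True
      have "AE x in lborel. 0 < x \<longrightarrow> weak_deriv (weak_deriv (\<Psi> j)) x = q j x *\<^sub>R \<Psi> j x"
        using edge(2)[of "\<sigma> j" "C j"] True by (simp add: C(2) star_function_def q_def u_def)
      then show ?thesis
        by eventually_elim (unfold eqv[OF True], use True in \<open>simp add: laplacian_def\<close>)
    next
      case False
      then show ?thesis by (simp add: laplacian_def C(2) star_function_def del: atLeastAtMost_iff)
    qed
    then show "\<Psi> \<in> ?E" using dom by (simp add: eigenspace_def hessian_def)
  qed
qed

lemma jost_scaled_nonzero_somewhere:
  assumes \<nu>: "0 \<le> \<nu>" and s: "0 \<le> s" and \<beta>: "0 < \<beta>"
  shows "\<exists>x\<ge>0. jost \<nu> s (\<beta> * (x + \<sigma>)) \<noteq> 0"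
proof -
  have "filterlim (\<lambda>x. \<beta> * (x + \<sigma>)) at_top at_top" using \<beta> by real_asymp
  from eventually_compose_filterlim[OF jost_eventually_pos[OF \<nu> s] this] eventually_ge_at_top[of 0]
  have "\<forall>\<^sub>F x in at_top. 0 \<le> x \<and> jost \<nu> s (\<beta> * (x + \<sigma>)) \<noteq> 0"
    by eventually_elim simp
  from eventually_happens[OF this] show ?thesis by auto
qed

text \<open>Continuity determines every coefficient from the common vertex value z, as z divided by
  the vertex value of v_s on that edge. The derivative condition then reads z (\<beta> S - \<alpha>)
  = 0, with S the sum of the logarithmic derivatives, and holds for every z or only for z =
  0.\<close>

lemma
  fixes \<sigma> :: "nat \<Rightarrow> real"
  assumes N: "1 \<le> N" and \<nu>: "0 \<le> \<nu>" and s: "0 < s" and \<beta>: "0 < \<beta>"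
    and st: "\<And>j x. j \<in> {1..N} \<Longrightarrow> c * stationary_state N K p \<alpha> \<omega> j x powr (2 * p) =
        \<beta>\<^sup>2 * (\<nu> * (\<nu> + 1) * (1 - (tanh (\<beta> * (x + \<sigma> j)))\<^sup>2))"
    and \<mu>: "\<mu> = \<omega> - \<beta>\<^sup>2 * s\<^sup>2"
    and nz: "\<And>j. j \<in> {1..N} \<Longrightarrow> jost \<nu> s (\<beta> * \<sigma> j) \<noteq> 0"
  defines "cond \<equiv> \<beta> * (\<Sum>j=1..N. jost' \<nu> s (\<beta> * \<sigma> j) / jost \<nu> s (\<beta> * \<sigma> j)) = \<alpha>"
  shows eigen_mult_hessian_regular: "eigen_mult (hessian c N K p \<alpha> \<omega>) \<mu> = (if cond then 1 else 0)"
    and is_eigenvalue_hessian_regular: "is_eigenvalue (hessian c N K p \<alpha> \<omega>) \<mu> \<longleftrightarrow> cond"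
proof -
  let ?E = "eigenspace (hessian c N K p \<alpha> \<omega>) \<mu>"
  define y where "y j = jost \<nu> s (\<beta> * \<sigma> j)" for j
  define y' where "y' j = jost' \<nu> s (\<beta> * \<sigma> j)" for j
  define u where "u j x = jost \<nu> s (\<beta> * (x + \<sigma> j))" for j x
  have ynz: "y j \<noteq> 0" if "j \<in> {1..N}" for j using nz[OF that] by (simp add: y_def)
  have one: "1 \<in> {1..N}" using N by simp
  have E: "?E = star_function N u ` {C. (\<forall>i\<in>{1..N}. \<forall>j\<in>{1..N}. C i * of_real (y i) = C j * of_real (y j)) \<and>
      (\<Sum>j=1..N. C j * of_real (\<beta> * y' j)) = of_real \<alpha> * (C 1 * of_real (y 1))}" (is "_ = star_function N u ` ?V")
    using eigenspace_hessian[OF N \<nu> s \<beta> st \<mu>] unfolding y_def y'_def u_def[abs_def] by blast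
  define e where "e = star_function N u (\<lambda>j. 1 / of_real (y j))"
  have sum_eq: "(\<Sum>j=1..N. z / of_real (y j) * of_real (\<beta> * y' j)) = z * complex_of_real (\<beta> * (\<Sum>j=1..N. y' j / y j))" for z
    by (simp add: sum_distrib_left of_real_sum mult_ac)
  have VD1: "C i * of_real (y i) = C j * of_real (y j)" if "C \<in> ?V" "i \<in> {1..N}" "j \<in> {1..N}" for C i j
    by (rule bspec[OF bspec[OF conjunct1[OF CollectD[OF that(1)]] that(2)] that(3)])
  have VD2: "(\<Sum>j=1..N. C j * of_real (\<beta> * y' j)) = of_real \<alpha> * (C 1 * of_real (y 1))" if "C \<in> ?V" for C
    by (rule conjunct2[OF CollectD[OF that]])
  have V1: "C j = C 1 * of_real (y 1) / of_real (y j)" if "C \<in> ?V" "j \<in> {1..N}" for C j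
    using VD1[OF that one] ynz[OF that(2)] by (simp add: eq_divide_eq)
  have V2: "z * complex_of_real (\<beta> * (\<Sum>j=1..N. y' j / y j)) = of_real \<alpha> * z" if "C \<in> ?V" "z = C 1 * of_real (y 1)" for C z
  proof -
    have "(\<Sum>j=1..N. C j * of_real (\<beta> * y' j)) = (\<Sum>j=1..N. z / of_real (y j) * of_real (\<beta> * y' j))"
      by (rule sum.cong[OF refl]) (simp only: V1[OF that(1)] that(2))
    then show ?thesis unfolding sum_eq VD2[OF that(1)] that(2) by (rule sym)
  qed
  have scale_e: "graph_scale z e = star_function N u (\<lambda>j. z / of_real (y j))" for z
    using star_function_sum[of "\<lambda>_. z" N u "\<lambda>_ j. 1 / of_real (y j)" "{()}"] by (simp add: e_def)
  have e_nz: "k = 0" if "graph_scale k e = 0" for k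
  proof -
    have z: "star_function N u (\<lambda>j. k / of_real (y j)) = 0"
      using that unfolding scale_e .
    obtain x where x: "0 \<le> x" "u 1 x \<noteq> 0"
      using jost_scaled_nonzero_somewhere[OF \<nu> less_imp_le[OF s] \<beta>] unfolding u_def by blast
    have "k / complex_of_real (y 1) = 0" by (rule star_function_eq_0[OF z one x])
    then show "k = 0" using ynz[OF one] by simp
  qed
  \<comment> \<open>One basis vector or none, so that both cases go through the same dimension
    lemma.\<close>
  define I where "I = (if cond then {()} else {})"
  have S: "?E = range (\<lambda>k. \<Sum>i\<in>I. graph_scale (k i) e)"
  proof (cases cond)
    case True
    then have bs: "\<beta> * (\<Sum>j=1..N. y' j / y j) = \<alpha>" by (simp add: cond_def y_def y'_def)
    have "?E = range (\<lambda>z. graph_scale z e)"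
    proof (intro equalityI subsetI)
      fix \<Psi> assume "\<Psi> \<in> ?E"
      then obtain C where C: "C \<in> ?V" "\<Psi> = star_function N u C" unfolding E by blast
      then have "\<Psi> = graph_scale (C 1 * of_real (y 1)) e"
        unfolding scale_e C(2) by (intro star_function_cong V1)
      then show "\<Psi> \<in> range (\<lambda>z. graph_scale z e)" by blast
    next
      fix \<Psi> assume "\<Psi> \<in> range (\<lambda>z. graph_scale z e)"
      then obtain z where z: "\<Psi> = star_function N u (\<lambda>j. z / of_real (y j))" using scale_e by auto
      have "(\<lambda>j. z / of_real (y j)) \<in> ?V"
      proof (intro CollectI conjI ballI)
        have c: "z / of_real (y i) * of_real (y i) = z" if "i \<in> {1..N}" for i using ynz[OF that] by simp
        show "z / of_real (y i) * of_real (y i) = z / of_real (y j) * of_real (y j)" if "i \<in> {1..N}" "j \<in> {1..N}" for i j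
          using c[OF that(1)] c[OF that(2)] by simp
        show "(\<Sum>j=1..N. z / of_real (y j) * of_real (\<beta> * y' j)) = of_real \<alpha> * (z / of_real (y 1) * of_real (y 1))"
          unfolding sum_eq c[OF one] bs by (rule mult.commute)
      qed
      then show "\<Psi> \<in> ?E" unfolding E z by blast
    qed
    also have "\<dots> = range (\<lambda>k. \<Sum>i\<in>I. graph_scale (k i) e)"
      using True by (auto simp: I_def image_iff intro: exI[of _ "\<lambda>_. _"])
    finally show ?thesis .
  next
    case False
    then have bs: "\<beta> * (\<Sum>j=1..N. y' j / y j) \<noteq> \<alpha>" by (simp add: cond_def y_def y'_def)
    have "?E = {0}"
    proof (intro equalityI subsetI)
      fix \<Psi> assume "\<Psi> \<in> ?E"
      then obtain C where C: "C \<in> ?V" "\<Psi> = star_function N u C" unfolding E by blast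
      have key: "w = 0" if "w * complex_of_real a = of_real b * w" "a \<noteq> b" for w a b
      proof -
        have "w * (complex_of_real a - of_real b) = 0" using that(1) by (simp add: algebra_simps)
        then show ?thesis using that(2) by simp
      qed
      have C1: "C 1 * of_real (y 1) = 0"
        by (rule key[OF V2[OF C(1) refl] bs])
      have "\<Psi> = graph_scale 0 e"
        unfolding scale_e C(2) by (intro star_function_cong) (use V1[OF C(1)] C1 in metis)
      then show "\<Psi> \<in> {0}" by simp
    next
      fix \<Psi> :: graph_fun assume "\<Psi> \<in> {0}"
      then have "\<Psi> = star_function N u (\<lambda>_. 0)"
        by (simp add: star_function_def edge_function_def fun_eq_iff)
      then show "\<Psi> \<in> ?E" unfolding E by (intro image_eqI[of _ _ "\<lambda>_. 0"]) auto
    qed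
    then show ?thesis using False by (simp add: I_def)
  qed
  have I: "finite I" by (simp add: I_def)
  have inj: "k i = 0" if "(\<Sum>i\<in>I. graph_scale (k i) e) = 0" "i \<in> I" for k i
    using that e_nz by (auto simp: I_def split: if_splits)
  have dims: "subspace_dim ?E = enat (card I)" "(\<exists>\<Psi>\<in>?E. \<Psi> \<noteq> 0) \<longleftrightarrow> I \<noteq> {}"
    by (rule subspace_dim_of_basis[where e = "\<lambda>_. e", OF I _ S], erule (1) inj)+
  show "eigen_mult (hessian c N K p \<alpha> \<omega>) \<mu> = (if cond then 1 else 0)"
    unfolding eigen_mult_def dims(1)
    by (simp add: I_def one_enat_def zero_enat_def)
  show "is_eigenvalue (hessian c N K p \<alpha> \<omega>) \<mu> \<longleftrightarrow> cond"
    unfolding is_eigenvalue_def dims(2) by (simp add: I_def)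
qed

text \<open>Edges in \<open>J\<close> force the common vertex value to be 0, hence the coefficients
  off \<open>J\<close> vanish. On \<open>J\<close> continuity holds for any coefficients, and as the
  vertex slopes share the nonzero value \<open>D\<close>, the derivative condition only says that
  the coefficients sum to 0.\<close>

lemma
  fixes \<sigma> :: "nat \<Rightarrow> real"
  assumes N: "1 \<le> N" and \<nu>: "0 \<le> \<nu>" and s: "0 < s" and \<beta>: "0 < \<beta>"
    and st: "\<And>j x. j \<in> {1..N} \<Longrightarrow> c * stationary_state N K p \<alpha> \<omega> j x powr (2 * p) =
        \<beta>\<^sup>2 * (\<nu> * (\<nu> + 1) * (1 - (tanh (\<beta> * (x + \<sigma> j)))\<^sup>2))"
    and \<mu>: "\<mu> = \<omega> - \<beta>\<^sup>2 * s\<^sup>2"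
    and J: "J \<subseteq> {1..N}" "J \<noteq> {}"
    and nz: "\<And>j. j \<in> {1..N} \<Longrightarrow> jost \<nu> s (\<beta> * \<sigma> j) = 0 \<longleftrightarrow> j \<in> J"
    and D: "\<And>j. j \<in> J \<Longrightarrow> jost' \<nu> s (\<beta> * \<sigma> j) = D" "D \<noteq> 0"
  shows eigen_mult_hessian_node: "eigen_mult (hessian c N K p \<alpha> \<omega>) \<mu> = enat (card J - 1)"
    and is_eigenvalue_hessian_node: "is_eigenvalue (hessian c N K p \<alpha> \<omega>) \<mu> \<longleftrightarrow> 1 < card J"
proof -
  let ?E = "eigenspace (hessian c N K p \<alpha> \<omega>) \<mu>"
  define u where "u j x = jost \<nu> s (\<beta> * (x + \<sigma> j))" for j x
  have one: "1 \<in> {1..N}" using N by simp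
  have fJ: "finite J" using J(1) finite_subset by blast
  obtain j0 where j0: "j0 \<in> J" using J(2) by blast
  have V: "(\<forall>i\<in>{1..N}. \<forall>j\<in>{1..N}. C i * of_real (jost \<nu> s (\<beta> * \<sigma> i)) = C j * of_real (jost \<nu> s (\<beta> * \<sigma> j))) \<and>
      (\<Sum>j=1..N. C j * of_real (\<beta> * jost' \<nu> s (\<beta> * \<sigma> j))) = of_real \<alpha> * (C 1 * of_real (jost \<nu> s (\<beta> * \<sigma> 1)))
    \<longleftrightarrow> (\<forall>j\<in>{1..N} - J. C j = 0) \<and> (\<Sum>j\<in>J. C j) = 0" (is "?A \<and> ?B \<longleftrightarrow> ?A' \<and> ?B'") for C :: "nat \<Rightarrow> complex"
  proof -
    have A: "?A \<longleftrightarrow> ?A'"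
    proof
      assume ?A
      show ?A'
      proof
        fix j assume j: "j \<in> {1..N} - J"
        have "C j * of_real (jost \<nu> s (\<beta> * \<sigma> j)) = C j0 * of_real (jost \<nu> s (\<beta> * \<sigma> j0))"
          using \<open>?A\<close> j j0 J(1) by blast
        then show "C j = 0" using nz[of j] nz[of j0] j j0 J(1) by auto
      qed
    next
      assume ?A'
      then have z: "C i * of_real (jost \<nu> s (\<beta> * \<sigma> i)) = 0" if "i \<in> {1..N}" for i
        using nz[OF that] that by (cases "i \<in> J") auto
      show ?A by (intro ballI trans[OF z z[symmetric]])
    qed
    have "?B \<longleftrightarrow> ?B'" if A': ?A'
    proof -
      have e1: "C 1 * of_real (jost \<nu> s (\<beta> * \<sigma> 1)) = 0"
        using nz[OF one] one A' by (cases "1 \<in> J") auto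
      have e2: "(\<Sum>j=1..N. C j * of_real (\<beta> * jost' \<nu> s (\<beta> * \<sigma> j))) = (\<Sum>j\<in>J. C j * of_real (\<beta> * D))"
        by (rule sum.mono_neutral_cong_right) (use J(1) A' D in auto)
      have e3: "(\<Sum>j\<in>J. C j * of_real (\<beta> * D)) = (\<Sum>j\<in>J. C j) * of_real (\<beta> * D)"
        by (rule sum_distrib_right[symmetric])
      have "(\<Sum>j\<in>J. C j) * complex_of_real (\<beta> * D) = of_real \<alpha> * 0 \<longleftrightarrow> (\<Sum>j\<in>J. C j) = 0"
        using D(2) \<beta> by simp
      then show ?thesis unfolding e1 e2 e3 .
    qed
    with A show ?thesis by blast
  qed
  have E: "?E = star_function N u ` {C. (\<forall>j\<in>{1..N} - J. C j = 0) \<and> (\<Sum>j\<in>J. C j) = 0}" (is "_ = star_function N u ` ?V")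
    using eigenspace_hessian[OF N \<nu> s \<beta> st \<mu>] unfolding V u_def[abs_def] by blast
  define I where "I = J - {j0}"
  have I: "finite I" using fJ by (simp add: I_def)
  \<comment> \<open>The vectors e_i - e_j0, for i in J other than j0, form a basis of the
    coefficient vectors on J with sum 0.\<close>
  define b :: "nat \<Rightarrow> nat \<Rightarrow> complex" where "b i j = (if j = i then 1 else if j = j0 then -1 else 0)" for i j
  have bs: "(\<Sum>i\<in>I. k i * b i j) = (if j \<in> I then k j else if j = j0 then - (\<Sum>i\<in>I. k i) else 0)" for k j
  proof (cases "j = j0")
    case True
    then have "k i * b i j = - k i" if "i \<in> I" for i using that by (auto simp: b_def I_def)
    then show ?thesis using True by (simp add: I_def sum_negf)
  next
    case False
    then have "k i * b i j = (if i = j then k j else 0)" for i by (auto simp: b_def)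
    then show ?thesis using False I by (simp add: sum.delta)
  qed
  have inj: "k i = 0" if "(\<Sum>i\<in>I. graph_scale (k i) (star_function N u (b i))) = 0" "i \<in> I" for k i
  proof -
    have iN: "i \<in> {1..N}" using that(2) J(1) by (auto simp: I_def)
    obtain x where x: "0 \<le> x" "u i x \<noteq> 0"
      using jost_scaled_nonzero_somewhere[OF \<nu> less_imp_le[OF s] \<beta>] unfolding u_def by blast
    have "(\<Sum>i'\<in>I. k i' * b i' i) = 0"
      by (rule star_function_eq_0[OF that(1)[unfolded star_function_sum] iN x])
    then show ?thesis using that(2) by (simp add: bs)
  qed
  have S: "?E = range (\<lambda>k. \<Sum>i\<in>I. graph_scale (k i) (star_function N u (b i)))"
  proof (intro equalityI subsetI)
    fix \<Psi> assume "\<Psi> \<in> ?E"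
    then obtain C where C: "C \<in> ?V" "\<Psi> = star_function N u C" unfolding E by blast
    have "C j0 = - (\<Sum>i\<in>I. C i)"
      using C(1) sum.remove[OF fJ j0, of C] by (simp add: I_def eq_neg_iff_add_eq_0)
    then have "\<Psi> = (\<Sum>i\<in>I. graph_scale (C i) (star_function N u (b i)))"
      unfolding star_function_sum C(2) bs using C(1) by (intro star_function_cong) (auto simp: I_def)
    then show "\<Psi> \<in> range (\<lambda>k. \<Sum>i\<in>I. graph_scale (k i) (star_function N u (b i)))"
      by (rule range_eqI[where x = C])
  next
    fix \<Psi> assume "\<Psi> \<in> range (\<lambda>k. \<Sum>i\<in>I. graph_scale (k i) (star_function N u (b i)))"
    then obtain k where k: "\<Psi> = star_function N u (\<lambda>j. \<Sum>i\<in>I. k i * b i j)"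
      unfolding star_function_sum by blast
    have "(\<lambda>j. \<Sum>i\<in>I. k i * b i j) \<in> ?V"
    proof -
      have "(\<Sum>j\<in>I. \<Sum>i\<in>I. k i * b i j) = (\<Sum>j\<in>I. k j)"
        by (rule sum.cong) (simp_all add: bs)
      moreover have "(\<Sum>i\<in>I. k i * b i j0) = - (\<Sum>i\<in>I. k i)"
        using bs[of k j0] by (simp add: I_def)
      ultimately have "(\<Sum>j\<in>J. \<Sum>i\<in>I. k i * b i j) = 0"
        unfolding sum.remove[OF fJ j0] I_def[symmetric] by simp
      moreover have "(\<Sum>i\<in>I. k i * b i j) = 0" if "j \<in> {1..N} - J" for j
        using bs[of k j] that j0 by (auto simp: I_def)
      ultimately show ?thesis by blast
    qed
    then show "\<Psi> \<in> ?E" unfolding E k by blast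
  qed
  have cI: "card I = card J - 1" using j0 fJ by (simp add: I_def)
  have dims: "subspace_dim ?E = enat (card I)" "(\<exists>\<Psi>\<in>?E. \<Psi> \<noteq> 0) \<longleftrightarrow> I \<noteq> {}"
    by (rule subspace_dim_of_basis[where e = "\<lambda>i. star_function N u (b i)", OF I _ S], erule (1) inj)+
  show "eigen_mult (hessian c N K p \<alpha> \<omega>) \<mu> = enat (card J - 1)"
    unfolding eigen_mult_def dims(1) cI ..
  have "I \<noteq> {} \<longleftrightarrow> 0 < card I" using I by (simp add: card_gt_0_iff)
  then show "is_eigenvalue (hessian c N K p \<alpha> \<omega>) \<mu> \<longleftrightarrow> 1 < card J"
    unfolding is_eigenvalue_def dims(2) cI by auto
qed

section \<open>Counting negative eigenvalues\<close>

lemma tanh_artanh_real: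
  fixes x :: real
  assumes "- 1 < x" "x < 1"
  shows "tanh (artanh x) = x"
proof -
  have "exp (- 2 * artanh x) = inverse ((1 + x) / (1 - x))"
    using assms by (simp add: artanh_def exp_minus)
  also have "\<dots> = (1 - x) / (1 + x)" by simp
  finally have "tanh (artanh x) = (1 - (1 - x) / (1 + x)) / (1 + (1 - x) / (1 + x))"
    by (simp add: tanh_real_altdef)
  also have "\<dots> = x" using assms by (simp add: field_simps)
  finally show ?thesis .
qed

text \<open>The exponent 2p undoes both 1/(2p) and 1/p, so the potential is a multiple of sech^2 for
  every p.\<close>

lemma soliton_powr:
  assumes "0 < p" "0 < \<omega>"
  shows "soliton p \<omega> x powr (2 * p) = \<omega> * (1 - (tanh (p * sqrt \<omega> * x))\<^sup>2)"
proof -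
  let ?y = "p * sqrt \<omega> * x"
  have c: "0 < cosh ?y" by (rule cosh_real_pos)
  have "soliton p \<omega> x powr (2 * p) = (\<omega> powr (1 / (2 * p))) powr (2 * p) * ((1 / cosh ?y) powr (1 / p)) powr (2 * p)"
    unfolding soliton_def by (rule powr_mult)
  also have "\<dots> = \<omega> powr (1 / (2 * p) * (2 * p)) * (1 / cosh ?y) powr (1 / p * (2 * p))"
    by (simp only: powr_powr)
  also have "\<dots> = \<omega> * (1 / cosh ?y) powr 2" using assms by simp
  also have "(1 / cosh ?y) powr 2 = (1 / cosh ?y)\<^sup>2" using c by (subst powr_numeral) simp_all
  also have "\<dots> = 1 - (tanh ?y)\<^sup>2"
  proof -
    have "(1 / y)\<^sup>2 = 1 - (z / y)\<^sup>2" if "y\<^sup>2 - z\<^sup>2 = 1" "0 < y" for y z :: real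
    proof -
      have "1 - (z / y)\<^sup>2 = (y\<^sup>2 - z\<^sup>2) / y\<^sup>2" using that(2) by (simp add: power_divide diff_divide_distrib)
      then show ?thesis using that(1) by (simp add: power_divide)
    qed
    from this[OF hyperbolic_pythagoras c] show ?thesis by (simp add: tanh_def)
  qed
  finally show ?thesis .
qed

text \<open>The edges in $J$ carry a bump: their soliton has its maximum at distance $d$ from the
  vertex; the other edges carry a decreasing tail.\<close>

locale bump_tail_star =
  fixes N K :: nat and p \<alpha> \<omega> d :: real and J :: "nat set"
  assumes N: "1 \<le> N" and p: "0 < p" and \<omega>: "0 < \<omega>" and d: "0 < d" and J: "J \<subseteq> {1..N}"
    and bumps: "\<And>j x. j \<in> {1..N} \<Longrightarrow>
      stationary_state N K p \<alpha> \<omega> j x = soliton p \<omega> (x + (if j \<in> J then - d else d))"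
    and \<alpha>: "\<alpha> = (real (card J) - real (N - card J)) * sqrt \<omega> * tanh (p * sqrt \<omega> * d)"
    and unbalanced: "card J \<noteq> N - card J"
begin

definition "\<beta> = p * sqrt \<omega>"
definition "r = 1 / p"
definition "B = card J"
definition "T = N - card J"
text \<open>This is \<alpha>/\<beta>: the logarithmic derivative -r tanh t of sech^r t, summed over
  the bumps at argument -b and the tails at b.\<close>

definition "A = (real B - real T) * r * tanh (\<beta> * d)"

definition level :: "real \<Rightarrow> real" where
  "level s = \<omega> - \<beta>\<^sup>2 * s\<^sup>2"

lemma \<beta>_pos: "0 < \<beta>" and r_pos: "0 < r" and b_pos: "0 < \<beta> * d"
  using p \<omega> d by (simp_all add: \<beta>_def r_def)

lemma BT: "0 < B + T" "B \<noteq> T"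
proof -
  have "card J \<le> card {1..N}" by (rule card_mono) (use J in auto)
  then show "0 < B + T" using N by (simp add: B_def T_def)
  show "B \<noteq> T" using unbalanced by (simp add: B_def T_def)
qed

lemma \<alpha>_eq: "\<alpha> = \<beta> * A"
  using p by (simp add: \<alpha> A_def B_def T_def \<beta>_def r_def)

lemma potential:
  assumes c: "c = p\<^sup>2 * (\<nu> * (\<nu> + 1))" and j: "j \<in> {1..N}"
  shows "c * stationary_state N K p \<alpha> \<omega> j x powr (2 * p) =
    \<beta>\<^sup>2 * (\<nu> * (\<nu> + 1) * (1 - (tanh (\<beta> * (x + (if j \<in> J then - d else d))))\<^sup>2))"
  unfolding bumps[OF j] soliton_powr[OF p \<omega>] c \<beta>_def
  using \<omega> by (simp add: power_mult_distrib)

lemma sum_edges: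
  fixes f :: "real \<Rightarrow> real"
  shows "(\<Sum>j=1..N. f (\<beta> * (if j \<in> J then - d else d))) = real B * f (- (\<beta> * d)) + real T * f (\<beta> * d)"
proof -
  have fJ: "finite J" using J finite_subset by blast
  have "(\<Sum>j=1..N. f (\<beta> * (if j \<in> J then - d else d))) =
    (\<Sum>j\<in>{1..N} - J. f (\<beta> * (if j \<in> J then - d else d))) + (\<Sum>j\<in>J. f (\<beta> * (if j \<in> J then - d else d)))"
    by (rule sum.subset_diff[OF J]) simp
  also have "(\<Sum>j\<in>{1..N} - J. f (\<beta> * (if j \<in> J then - d else d))) = real T * f (\<beta> * d)"
    using card_Diff_subset[OF fJ J] by (simp add: T_def)
  also have "(\<Sum>j\<in>J. f (\<beta> * (if j \<in> J then - d else d))) = real B * f (- (\<beta> * d))"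
    by (simp add: B_def)
  finally show ?thesis by simp
qed

lemma
  assumes c: "c = p\<^sup>2 * (\<nu> * (\<nu> + 1))" and \<nu>: "0 \<le> \<nu>" and s: "0 < s"
    and nz: "B = 0 \<or> jost \<nu> s (- (\<beta> * d)) \<noteq> 0" "jost \<nu> s (\<beta> * d) \<noteq> 0"
  shows mult_regular: "eigen_mult (hessian c N K p \<alpha> \<omega>) (level s) =
      (if log_deriv_sum \<nu> B T (\<beta> * d) s = A then 1 else 0)"
    and eigenvalue_regular: "is_eigenvalue (hessian c N K p \<alpha> \<omega>) (level s) \<longleftrightarrow>
      log_deriv_sum \<nu> B T (\<beta> * d) s = A"
proof -
  have fJ: "finite J" using J finite_subset by blast
  have "jost \<nu> s (\<beta> * (if j \<in> J then - d else d)) \<noteq> 0" for j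
    using nz fJ by (auto simp: B_def)
  note * = eigen_mult_hessian_regular[OF N \<nu> s \<beta>_pos potential[OF c] level_def this]
    is_eigenvalue_hessian_regular[OF N \<nu> s \<beta>_pos potential[OF c] level_def this]
  have cond: "\<beta> * (\<Sum>j=1..N. jost' \<nu> s (\<beta> * (if j \<in> J then - d else d)) / jost \<nu> s (\<beta> * (if j \<in> J then - d else d))) = \<alpha>
      \<longleftrightarrow> log_deriv_sum \<nu> B T (\<beta> * d) s = A"
    unfolding sum_edges[of "\<lambda>x. jost' \<nu> s x / jost \<nu> s x"] \<alpha>_eq log_deriv_sum_def using \<beta>_pos by simp
  show "eigen_mult (hessian c N K p \<alpha> \<omega>) (level s) = (if log_deriv_sum \<nu> B T (\<beta> * d) s = A then 1 else 0)"
    by (rule *(1)[unfolded cond])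
  show "is_eigenvalue (hessian c N K p \<alpha> \<omega>) (level s) \<longleftrightarrow> log_deriv_sum \<nu> B T (\<beta> * d) s = A"
    by (rule *(2)[unfolded cond])
qed

lemma
  assumes c: "c = p\<^sup>2 * (\<nu> * (\<nu> + 1))" and \<nu>: "0 \<le> \<nu>" and s: "0 < s" and B: "0 < B"
    and z: "jost \<nu> s (- (\<beta> * d)) = 0" "jost \<nu> s (\<beta> * d) \<noteq> 0"
  shows mult_node: "eigen_mult (hessian c N K p \<alpha> \<omega>) (level s) = enat (B - 1)"
    and eigenvalue_node: "is_eigenvalue (hessian c N K p \<alpha> \<omega>) (level s) \<longleftrightarrow> 1 < B"
proof -
  have J0: "J \<noteq> {}" using B by (auto simp: B_def)
  have nz: "jost \<nu> s (\<beta> * (if j \<in> J then - d else d)) = 0 \<longleftrightarrow> j \<in> J" for j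
    using z by simp
  have D: "jost' \<nu> s (\<beta> * (if j \<in> J then - d else d)) = jost' \<nu> s (- (\<beta> * d))" if "j \<in> J" for j
    using that by simp
  have D0: "jost' \<nu> s (- (\<beta> * d)) \<noteq> 0" by (rule jost_nontrivial[OF \<nu> less_imp_le[OF s] z(1)])
  show "eigen_mult (hessian c N K p \<alpha> \<omega>) (level s) = enat (B - 1)"
    unfolding B_def
    by (rule eigen_mult_hessian_node[OF N \<nu> s \<beta>_pos potential[OF c] level_def J J0 nz D D0])
  show "is_eigenvalue (hessian c N K p \<alpha> \<omega>) (level s) \<longleftrightarrow> 1 < B"
    unfolding B_def
    by (rule is_eigenvalue_hessian_node[OF N \<nu> s \<beta>_pos potential[OF c] level_def J J0 nz D D0])
qed

lemma level_bottom: "level r = 0"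
  using p \<omega> by (simp add: level_def r_def \<beta>_def power_mult_distrib power_divide)

lemma level_less: "0 \<le> s \<Longrightarrow> s < t \<Longrightarrow> level t < level s"
  using \<beta>_pos by (simp add: level_def power_strict_mono)

lemma level_surj:
  assumes "\<mu> < 0"
  obtains s where "r < s" "\<mu> = level s"
proof -
  define s where "s = sqrt ((\<omega> - \<mu>) / \<beta>\<^sup>2)"
  have "0 \<le> (\<omega> - \<mu>) / \<beta>\<^sup>2" using \<omega> assms by simp
  then have l: "\<mu> = level s" using \<beta>_pos by (simp add: level_def s_def)
  have "0 \<le> s" using \<open>0 \<le> (\<omega> - \<mu>) / \<beta>\<^sup>2\<close> by (simp add: s_def)
  then have "r < s"
    using level_less[of s r] level_bottom l assms by (cases s r rule: linorder_cases) auto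
  then show ?thesis using l by (rule that)
qed

lemma negative_eigenvalues_eq:
  "negative_eigenvalues H = level ` {s. r < s \<and> is_eigenvalue H (level s)}"
proof (intro equalityI subsetI)
  fix \<mu> assume "\<mu> \<in> negative_eigenvalues H"
  then have "\<mu> < 0" "is_eigenvalue H \<mu>" by (auto simp: negative_eigenvalues_def)
  then show "\<mu> \<in> level ` {s. r < s \<and> is_eigenvalue H (level s)}" using level_surj[of \<mu>] by auto
next
  fix \<mu> assume "\<mu> \<in> level ` {s. r < s \<and> is_eigenvalue H (level s)}"
  then obtain s where "r < s" "\<mu> = level s" "is_eigenvalue H \<mu>" by auto
  then show "\<mu> \<in> negative_eigenvalues H"
    using level_less[of r s] r_pos level_bottom by (simp add: negative_eigenvalues_def)
qed

section \<open>The spectrum of L_-\<close>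

text \<open>The coefficient p + 1 selects \<nu> = r, where every s \<ge> r is regular and the only
  root of the secular equation is s = r, that is, energy 0.\<close>

lemma L_minus_spectrum:
  "degeneracy_index (L_minus N K p \<alpha> \<omega>) = 1" "morse_index (L_minus N K p \<alpha> \<omega>) = 0"
proof -
  have c: "p + 1 = p\<^sup>2 * (r * (r + 1))" using p by (simp add: r_def field_simps power2_eq_square)
  have r0: "0 \<le> r" using r_pos by simp
  have pos: "0 < jost r s t" if "r \<le> s" for s t by (rule jost_ground_family(1)[OF r_pos b_pos BT(1) that])
  have F: "log_deriv_sum r B T (\<beta> * d) s = A \<longleftrightarrow> s = r" if "r \<le> s" for s
    unfolding A_def by (rule jost_ground_family(2)[OF r_pos b_pos BT(1) that])
  have nz: "jost r s t \<noteq> 0" if "r \<le> s" for s t using pos[OF that, of t] by simp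
  show "degeneracy_index (L_minus N K p \<alpha> \<omega>) = 1"
    using mult_regular[OF c r0 r_pos disjI2[OF nz] nz] F[of r]
    by (simp add: degeneracy_index_def L_minus_def level_bottom)
  have "\<not> is_eigenvalue (L_minus N K p \<alpha> \<omega>) (level s)" if "r < s" for s
  proof -
    have rs: "r \<le> s" "0 < s" using that r_pos by auto
    show ?thesis
      using eigenvalue_regular[OF c r0 rs(2) disjI2[OF nz[OF rs(1)]] nz[OF rs(1)]] F[OF rs(1)] that
      by (simp add: L_minus_def)
  qed
  then have "negative_eigenvalues (L_minus N K p \<alpha> \<omega>) = {}"
    unfolding negative_eigenvalues_eq by auto
  then show "morse_index (L_minus N K p \<alpha> \<omega>) = 0" by (simp add: morse_index_def)
qed

section \<open>The spectrum of L_+\<close>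

lemma L_plus_coeff: "(2 * p + 1) * (p + 1) = p\<^sup>2 * ((r + 1) * (r + 1 + 1))"
  using p by (simp add: r_def field_simps power2_eq_square)

lemma L_plus_without_bumps:
  assumes B: "B = 0"
  shows "degeneracy_index (L_plus N K p \<alpha> \<omega>) = 0" "morse_index (L_plus N K p \<alpha> \<omega>) = 1"
proof -
  have T: "0 < T" using BT(1) B by simp
  have \<nu>: "0 \<le> r + 1" using r_pos by simp
  obtain s1 where s1: "r < s1" "\<And>s. r \<le> s \<Longrightarrow> log_deriv_sum (r + 1) 0 T (\<beta> * d) s = - (real T * r * tanh (\<beta> * d)) \<longleftrightarrow> s = s1"
    using secular_root_without_bumps[OF r_pos b_pos T] by metis
  have F: "log_deriv_sum (r + 1) B T (\<beta> * d) s = A \<longleftrightarrow> s = s1" if "r \<le> s" for s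
    using s1(2)[OF that] by (simp add: B A_def)
  have nz: "jost (r + 1) s (\<beta> * d) \<noteq> 0" if "r \<le> s" for s
    using jost_pos_right[OF r_pos that b_pos] by simp
  have mult: "eigen_mult (L_plus N K p \<alpha> \<omega>) (level s) = (if s = s1 then 1 else 0)"
    and eig: "is_eigenvalue (L_plus N K p \<alpha> \<omega>) (level s) \<longleftrightarrow> s = s1" if rs: "r \<le> s" for s
    using mult_regular[OF L_plus_coeff \<nu> _ disjI1[OF B] nz[OF rs]] eigenvalue_regular[OF L_plus_coeff \<nu> _ disjI1[OF B] nz[OF rs]]
      F[OF rs] rs r_pos by (simp_all add: L_plus_def)
  show "degeneracy_index (L_plus N K p \<alpha> \<omega>) = 0"
    using mult[of r] s1(1) by (simp add: degeneracy_index_def level_bottom)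
  have "{s. r < s \<and> is_eigenvalue (L_plus N K p \<alpha> \<omega>) (level s)} = {s1}"
    using eig s1(1) by auto
  then have "negative_eigenvalues (L_plus N K p \<alpha> \<omega>) = {level s1}" unfolding negative_eigenvalues_eq by simp
  then show "morse_index (L_plus N K p \<alpha> \<omega>) = 1"
    using mult[of s1] s1(1) by (simp add: morse_index_def)
qed

text \<open>\<open>level\<close> is decreasing, so roots s2 < s0 < s1 turn into energies in the
  opposite order. For B = 1 a single coefficient with sum 0 vanishes: the node energy
  \<open>\<mu>s\<close> then has multiplicity 0 and is left out of the set of eigenvalues.\<close>

lemma L_plus_with_bumps:
  assumes B: "0 < B"
  obtains \<mu>1 \<mu>s where "\<mu>1 < \<mu>s" "\<mu>s < 0"
    "eigen_mult (L_plus N K p \<alpha> \<omega>) \<mu>1 = 1" "eigen_mult (L_plus N K p \<alpha> \<omega>) \<mu>s = enat (B - 1)"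
    "degeneracy_index (L_plus N K p \<alpha> \<omega>) = 0"
    "B < T \<Longrightarrow> \<exists>\<mu>2. \<mu>s < \<mu>2 \<and> \<mu>2 < 0 \<and> eigen_mult (L_plus N K p \<alpha> \<omega>) \<mu>2 = 1 \<and>
      negative_eigenvalues (L_plus N K p \<alpha> \<omega>) = {\<mu>1, \<mu>2} \<union> (if B = 1 then {} else {\<mu>s})"
    "T < B \<Longrightarrow> negative_eigenvalues (L_plus N K p \<alpha> \<omega>) = {\<mu>1} \<union> (if B = 1 then {} else {\<mu>s})"
proof -
  let ?L = "L_plus N K p \<alpha> \<omega>" and ?F = "log_deriv_sum (r + 1) B T (\<beta> * d)"
  have \<nu>: "0 \<le> r + 1" using r_pos by simp
  obtain s0 s1 where s: "r < s0" "s0 < s1" "jost (r + 1) s0 (- (\<beta> * d)) = 0"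
    "\<And>s. r \<le> s \<Longrightarrow> s \<noteq> s0 \<Longrightarrow> jost (r + 1) s (- (\<beta> * d)) \<noteq> 0"
    "\<And>s. s0 < s \<Longrightarrow> ?F s = A \<longleftrightarrow> s = s1"
    "B < T \<Longrightarrow> \<exists>s2. r < s2 \<and> s2 < s0 \<and> (\<forall>s. r \<le> s \<and> s < s0 \<longrightarrow> (?F s = A \<longleftrightarrow> s = s2))"
    "T < B \<Longrightarrow> \<forall>s. r \<le> s \<and> s < s0 \<longrightarrow> ?F s \<noteq> A"
    unfolding A_def by (rule secular_roots[OF r_pos b_pos B BT(2)]) blast
  have nz: "jost (r + 1) s (\<beta> * d) \<noteq> 0" if "r \<le> s" for s
    using jost_pos_right[OF r_pos that b_pos] by simp
  have reg: "eigen_mult ?L (level s) = (if ?F s = A then 1 else 0)" "is_eigenvalue ?L (level s) \<longleftrightarrow> ?F s = A"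
    if rs: "r \<le> s" "s \<noteq> s0" for s
    using mult_regular[OF L_plus_coeff \<nu> _ disjI2[OF s(4)[OF rs]] nz[OF rs(1)]]
      eigenvalue_regular[OF L_plus_coeff \<nu> _ disjI2[OF s(4)[OF rs]] nz[OF rs(1)]] rs r_pos
    by (simp_all add: L_plus_def)
  have s0: "0 < s0" "r \<le> s0" using s(1) r_pos by auto
  have node: "eigen_mult ?L (level s0) = enat (B - 1)" "is_eigenvalue ?L (level s0) \<longleftrightarrow> 1 < B"
    unfolding L_plus_def
    by (rule mult_node[OF L_plus_coeff \<nu> s0(1) B s(3) nz[OF s0(2)]]
        eigenvalue_node[OF L_plus_coeff \<nu> s0(1) B s(3) nz[OF s0(2)]])+
  have sr: "r < s1" using s(1,2) by simp
  have r0: "0 \<le> r" using r_pos by simp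
  show ?thesis
  proof (rule that[of "level s1" "level s0"])
    show "level s1 < level s0" using level_less[of s0 s1] s0 s(2) by simp
    show "level s0 < 0" using level_less[OF r0 s(1)] level_bottom by simp
    show "eigen_mult ?L (level s1) = 1" using reg(1)[of s1] s(2) s(5)[of s1] sr by simp
    show "eigen_mult ?L (level s0) = enat (B - 1)" by (rule node(1))
    \<comment> \<open>Energy 0 is s = r, below the node parameter: for B < T the only root there is
      larger than r, for T < B there is none.\<close>
    have "?F r \<noteq> A"
    proof (cases "B < T")
      case True
      then obtain s2 where "r < s2" "s2 < s0" "\<And>s. r \<le> s \<and> s < s0 \<Longrightarrow> ?F s = A \<longleftrightarrow> s = s2" using s(6) by blast
      then show ?thesis using s(1) by force
    next
      case False
      then show ?thesis using s(7) BT(2) s(1) by simp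
    qed
    then show "degeneracy_index ?L = 0"
      using reg(1)[of r] s(1) by (simp add: degeneracy_index_def level_bottom)
    have split: "{s. r < s \<and> is_eigenvalue ?L (level s)} =
      {s. r < s \<and> s < s0 \<and> ?F s = A} \<union> {s1} \<union> (if B = 1 then {} else {s0})"
    proof (rule set_eqI)
      fix t
      consider "t \<le> r" | "r < t" "t < s0" | "t = s0" | "s0 < t" by linarith
      then show "t \<in> {s. r < s \<and> is_eigenvalue ?L (level s)} \<longleftrightarrow>
        t \<in> {s. r < s \<and> s < s0 \<and> ?F s = A} \<union> {s1} \<union> (if B = 1 then {} else {s0})"
      proof cases
        case 1 then show ?thesis using sr s(1) by auto
      next
        case 2 then show ?thesis using reg(2)[of t] s(2) by auto
      next
        case 3 then show ?thesis using node(2) s(1,2) B by auto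
      next
        case 4 then show ?thesis using reg(2)[of t] s(5)[of t] s(1) by auto
      qed
    qed
    show "\<exists>\<mu>2. level s0 < \<mu>2 \<and> \<mu>2 < 0 \<and> eigen_mult ?L \<mu>2 = 1 \<and>
      negative_eigenvalues ?L = {level s1, \<mu>2} \<union> (if B = 1 then {} else {level s0})" if "B < T"
    proof -
      obtain s2 where s2: "r < s2" "s2 < s0" "\<And>s. r \<le> s \<Longrightarrow> s < s0 \<Longrightarrow> ?F s = A \<longleftrightarrow> s = s2"
        using s(6)[OF \<open>B < T\<close>] by blast
      have "{s. r < s \<and> s < s0 \<and> ?F s = A} = {s2}" using s2 by auto
      then have "negative_eigenvalues ?L = {level s1, level s2} \<union> (if B = 1 then {} else {level s0})"
        unfolding negative_eigenvalues_eq split by auto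
      moreover have "eigen_mult ?L (level s2) = 1" using reg(1)[of s2] s2(1,2) s2(3)[of s2] by simp
      moreover have "level s0 < level s2" "level s2 < 0"
        using level_less[of s2 s0] level_less[OF r0 s2(1)] s2(1,2) r0 level_bottom by auto
      ultimately show ?thesis by blast
    qed
    show "negative_eigenvalues ?L = {level s1} \<union> (if B = 1 then {} else {level s0})" if "T < B"
    proof -
      have "{s. r < s \<and> s < s0 \<and> ?F s = A} = {}" using s(7)[OF that] by auto
      then show ?thesis unfolding negative_eigenvalues_eq split by auto
    qed
  qed
qed

end

section \<open>Assembling the two signs of \<alpha>\<close>

lemma morse_index_finite:
  assumes "negative_eigenvalues H = S" "finite S"
  shows "morse_index H = (\<Sum>\<mu>\<in>S. eigen_mult H \<mu>)"
  using assms by (simp add: morse_index_def)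

theorem theorem3p1:
  fixes N K :: nat and p \<alpha> \<omega> :: real
  assumes "N \<ge> 2" and "p > 0" and "\<alpha> \<noteq> 0"
    and "K \<le> (N - 1) div 2"
    and "\<omega> > \<alpha>\<^sup>2 / (real N - 2 * real K)\<^sup>2"
  shows "degeneracy_index (L_minus N K p \<alpha> \<omega>) = 1 \<and>
    morse_index (L_minus N K p \<alpha> \<omega>) = 0 \<and>
    degeneracy_index (L_plus N K p \<alpha> \<omega>) = 0 \<and>
    morse_index (L_plus N K p \<alpha> \<omega>) = (if \<alpha> < 0 then enat (K + 1) else enat (N - K)) \<and>
    (\<alpha> < 0 \<and> K \<ge> 1 \<longrightarrow>
      (\<exists>\<mu>\<^sub>1 \<mu>\<^sub>2 \<mu>s. \<mu>\<^sub>1 < \<mu>s \<and> \<mu>s < \<mu>\<^sub>2 \<and> \<mu>\<^sub>2 < 0 \<and>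
        negative_eigenvalues (L_plus N K p \<alpha> \<omega>) =
          {\<mu>\<^sub>1, \<mu>\<^sub>2} \<union> (if K = 1 then {} else {\<mu>s}) \<and>
        eigen_mult (L_plus N K p \<alpha> \<omega>) \<mu>\<^sub>1 = 1 \<and>
        eigen_mult (L_plus N K p \<alpha> \<omega>) \<mu>\<^sub>2 = 1 \<and>
        eigen_mult (L_plus N K p \<alpha> \<omega>) \<mu>s = enat (K - 1))) \<and>
    (\<alpha> > 0 \<longrightarrow>
      (\<exists>\<mu>\<^sub>1 \<mu>ss. \<mu>\<^sub>1 < \<mu>ss \<and> \<mu>ss < 0 \<and>
        negative_eigenvalues (L_plus N K p \<alpha> \<omega>) = {\<mu>\<^sub>1, \<mu>ss} \<and>
        eigen_mult (L_plus N K p \<alpha> \<omega>) \<mu>\<^sub>1 = 1 \<and>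
        eigen_mult (L_plus N K p \<alpha> \<omega>) \<mu>ss = enat (N - K - 1)))"
proof -
  have K: "2 * K < N" using assms(1,4) by linarith
  define D where "D = real N - 2 * real K"
  have D: "0 < D" using K by (simp add: D_def)
  have "0 \<le> \<alpha>\<^sup>2 / (real N - 2 * real K)\<^sup>2" by simp
  then have \<omega>: "0 < \<omega>" using assms(5) by (rule le_less_trans)
  define \<theta> where "\<theta> = \<alpha> / (D * sqrt \<omega>)"
  define a where "a = shift N K p \<alpha> \<omega>"
  \<comment> \<open>The lower bound on \<omega> says exactly that the argument of artanh in the
    shift lies in (-1, 1), where tanh inverts artanh.\<close>
  have "\<alpha>\<^sup>2 < \<omega> * D\<^sup>2" using assms(5)[folded D_def] D by (simp add: pos_divide_less_eq)
  then have "\<theta>\<^sup>2 < 1"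
    using D \<omega> by (simp add: \<theta>_def power_divide power_mult_distrib divide_less_eq_1 mult.commute)
  then have \<theta>: "- 1 < \<theta>" "\<theta> < 1" by (auto simp: abs_square_less_1)
  have pa: "p * sqrt \<omega> * a = artanh \<theta>"
    using assms(2) \<omega> by (simp add: a_def shift_def \<theta>_def D_def)
  have "tanh (p * sqrt \<omega> * a) = \<theta>" unfolding pa by (rule tanh_artanh_real[OF \<theta>])
  then have \<alpha>: "\<alpha> = D * sqrt \<omega> * tanh (p * sqrt \<omega> * a)" using D \<omega> by (simp add: \<theta>_def)
  have sgn_a: "a < 0 \<longleftrightarrow> \<alpha> < 0" "0 < a \<longleftrightarrow> 0 < \<alpha>"
    unfolding \<alpha> using D \<omega> assms(2) by (simp_all add: mult_less_0_iff zero_less_mult_iff)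
  have state: "stationary_state N K p \<alpha> \<omega> j x = soliton p \<omega> (x + (if j \<le> K then a else - a))" for j x
    by (simp add: stationary_state_def a_def)
  consider "\<alpha> < 0" | "0 < \<alpha>" using assms(3) by linarith
  then show ?thesis
  proof cases
    case 1
    \<comment> \<open>For \<alpha> < 0 the shift a is negative, so the first K edges, with x + a,
      carry the bumps at distance -a.\<close>
    interpret bump_tail_star N K p \<alpha> \<omega> "- a" "{1..K}"
    proof
      show "\<alpha> = (real (card {1..K}) - real (N - card {1..K})) * sqrt \<omega> * tanh (p * sqrt \<omega> * (- a))"
      proof -
        have e: "real (card {1..K}) - real (N - card {1..K}) = - D" using K by (simp add: D_def of_nat_diff)
        show ?thesis unfolding e using \<alpha> by simp
      qed
      show "stationary_state N K p \<alpha> \<omega> j x = soliton p \<omega> (x + (if j \<in> {1..K} then - (- a) else - a))" if "j \<in> {1..N}" for j x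
        unfolding state using that by simp
    qed (use assms \<omega> 1 sgn_a K in auto)
    have BK: "B = K" "T = N - K" unfolding B_def T_def by simp_all
    show ?thesis
    proof (cases "K = 0")
      case True
      then show ?thesis using L_minus_spectrum L_plus_without_bumps[unfolded BK, OF True] 1 by (simp add: one_enat_def)
    next
      case False
      then have "0 < B" unfolding BK by simp
      then obtain \<mu>1 \<mu>s where m: "\<mu>1 < \<mu>s" "\<mu>s < 0"
        "eigen_mult (L_plus N K p \<alpha> \<omega>) \<mu>1 = 1" "eigen_mult (L_plus N K p \<alpha> \<omega>) \<mu>s = enat (B - 1)"
        "degeneracy_index (L_plus N K p \<alpha> \<omega>) = 0"
        "B < T \<Longrightarrow> \<exists>\<mu>2. \<mu>s < \<mu>2 \<and> \<mu>2 < 0 \<and> eigen_mult (L_plus N K p \<alpha> \<omega>) \<mu>2 = 1 \<and>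
          negative_eigenvalues (L_plus N K p \<alpha> \<omega>) = {\<mu>1, \<mu>2} \<union> (if B = 1 then {} else {\<mu>s})"
        using L_plus_with_bumps by metis
      have KT: "K < N - K" using K by simp
      obtain \<mu>2 where m2: "\<mu>s < \<mu>2" "\<mu>2 < 0" "eigen_mult (L_plus N K p \<alpha> \<omega>) \<mu>2 = 1"
        "negative_eigenvalues (L_plus N K p \<alpha> \<omega>) = {\<mu>1, \<mu>2} \<union> (if K = 1 then {} else {\<mu>s})"
        using m(6)[unfolded BK, OF KT] by blast
      have "morse_index (L_plus N K p \<alpha> \<omega>) = enat (K + 1)"
      \<comment> \<open>For K = 1 there are two negative eigenvalues instead of three, so the sum is
        evaluated separately.\<close>
      proof (cases "K = 1")
        case True
        then show ?thesis using morse_index_finite[OF m2(4)] m m2 by (simp add: one_enat_def)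
      next
        case False
        have "morse_index (L_plus N K p \<alpha> \<omega>) = (\<Sum>\<mu>\<in>{\<mu>1, \<mu>2, \<mu>s}. eigen_mult (L_plus N K p \<alpha> \<omega>) \<mu>)"
          by (rule morse_index_finite) (use m2(4) False in auto)
        also have "\<dots> = 1 + (1 + enat (K - 1))" using m(1-3) m(4)[unfolded BK] m2 by simp
        also have "\<dots> = enat (K + 1)" using \<open>K \<noteq> 0\<close> by (simp add: one_enat_def)
        finally show ?thesis .
      qed
      moreover have "\<exists>\<mu>\<^sub>1 \<mu>\<^sub>2 \<mu>s. \<mu>\<^sub>1 < \<mu>s \<and> \<mu>s < \<mu>\<^sub>2 \<and> \<mu>\<^sub>2 < 0 \<and>
        negative_eigenvalues (L_plus N K p \<alpha> \<omega>) = {\<mu>\<^sub>1, \<mu>\<^sub>2} \<union> (if K = 1 then {} else {\<mu>s}) \<and>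
        eigen_mult (L_plus N K p \<alpha> \<omega>) \<mu>\<^sub>1 = 1 \<and> eigen_mult (L_plus N K p \<alpha> \<omega>) \<mu>\<^sub>2 = 1 \<and>
        eigen_mult (L_plus N K p \<alpha> \<omega>) \<mu>s = enat (K - 1)"
        using m(1,3) m(4)[unfolded BK] m2 by blast
      ultimately show ?thesis using L_minus_spectrum m(5) 1 by simp
    qed
  next
    case 2
    \<comment> \<open>For \<alpha> > 0 the edges beyond the first K, with x - a, carry the
      bumps.\<close>
    interpret bump_tail_star N K p \<alpha> \<omega> a "{K+1..N}"
    proof
      show "\<alpha> = (real (card {K+1..N}) - real (N - card {K+1..N})) * sqrt \<omega> * tanh (p * sqrt \<omega> * a)"
      proof -
        have e: "real (card {K+1..N}) - real (N - card {K+1..N}) = D" using K by (simp add: D_def of_nat_diff)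
        show ?thesis unfolding e by (rule \<alpha>)
      qed
      show "stationary_state N K p \<alpha> \<omega> j x = soliton p \<omega> (x + (if j \<in> {K+1..N} then - a else a))" if "j \<in> {1..N}" for j x
        unfolding state using that by simp
    qed (use assms \<omega> 2 sgn_a K in auto)
    have BK: "B = N - K" "T = K" unfolding B_def T_def using K by simp_all
    have "0 < B" using K unfolding BK by simp
    obtain \<mu>1 \<mu>s where m: "\<mu>1 < \<mu>s" "\<mu>s < 0"
      "eigen_mult (L_plus N K p \<alpha> \<omega>) \<mu>1 = 1" "eigen_mult (L_plus N K p \<alpha> \<omega>) \<mu>s = enat (B - 1)"
      "degeneracy_index (L_plus N K p \<alpha> \<omega>) = 0"
      "T < B \<Longrightarrow> negative_eigenvalues (L_plus N K p \<alpha> \<omega>) = {\<mu>1} \<union> (if B = 1 then {} else {\<mu>s})"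
      using L_plus_with_bumps[OF \<open>0 < B\<close>] by metis
    \<comment> \<open>From N \<ge> 2 and 2 K < N follows N - K \<ge> 2, so B = 1 cannot occur and
      the node energy is always an eigenvalue.\<close>
    have neg: "negative_eigenvalues (L_plus N K p \<alpha> \<omega>) = {\<mu>1, \<mu>s}"
      using m(6)[unfolded BK] K assms(1) by auto
    have "morse_index (L_plus N K p \<alpha> \<omega>) = 1 + enat (N - K - 1)"
      using morse_index_finite[OF neg] m(1-3) m(4)[unfolded BK] by simp
    also have "\<dots> = enat (N - K)" using K by (simp add: one_enat_def)
    finally have "morse_index (L_plus N K p \<alpha> \<omega>) = enat (N - K)" .
    moreover have "\<exists>\<mu>\<^sub>1 \<mu>ss. \<mu>\<^sub>1 < \<mu>ss \<and> \<mu>ss < 0 \<and>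
        negative_eigenvalues (L_plus N K p \<alpha> \<omega>) = {\<mu>\<^sub>1, \<mu>ss} \<and>
        eigen_mult (L_plus N K p \<alpha> \<omega>) \<mu>\<^sub>1 = 1 \<and>
        eigen_mult (L_plus N K p \<alpha> \<omega>) \<mu>ss = enat (N - K - 1)"
      using m(1-3) m(4)[unfolded BK] neg by blast
    ultimately show ?thesis using L_minus_spectrum m(5) 2 by simp
  qed
qed

end
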